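(* Let $h\in\mathbb{Q}^4$. Then $\mathcal{S}(h)$, the space of symmetric shift operators with shift $h$, is a free module over $\mathcal{S}(0)$, of rank $1$ if $h\cdot v_i\in\mathbb{Z}$ for $i=1,\dots,4$, and of rank $0$ otherwise.
   Context: Let $K=\mathbb{Q}(\sqrt{-ab},b,\sqrt{-cd},d,q^{1/2})$ be the field of rational functions in the five indeterminates $\sqrt{-ab},b,\sqrt{-cd},d,q^{1/2}$; put $a=-(\sqrt{-ab})^2/b$, $c=-(\sqrt{-cd})^2/d$. Let $*$ be the field involution of $K$ inverting the five generators. Let $\mathcal{A}=K[z,z^{-1}]$ and $\mathcal{A}_0=\{f\in\mathcal{A}: f(z)=f(z^{-1})\}$. For $f=\sum_n f_nz^n$ put $f^*=\sum_n f_n^*z^{-n}$. Write $(x;q)_\infty=\prod_{j\ge0}(1-xq^j)$ and $(x_1,\dots,x_r;q)_\infty=\prod_i(x_i;q)_\infty$. Let \[ \Delta=\frac{(z^2,qz^{-2};q)_\infty}{(az,bz,cz,dz,aqz^{-1},bqz^{-1},cz^{-1},dz^{-1};q)_\infty}, \] expanded as a power series in $z$ and $q^{1/2}z^{-1}$ with coefficients in $\mathcal{R}=\mathbb{Q}[a^{\pm1},b^{\pm1},(cq^{-1/2})^{\pm1},(dq^{-1/2})^{\pm1}]$, hence regarded as an element of $\mathcal{R}((q^{1/2}))[[z^{\pm1}]]$. With $\mathrm{ct}$ denoting the coefficient of $z^0$, put $(f,g)=\mathrm{ct}(fg^*\Delta)\in K\otimes_{\mathcal{R}[q^{\pm1/2}]}\mathcal{R}((q^{1/2}))$.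 The symmetric Askey--Wilson polynomial $P_n=P_{n,k}\in\mathcal{A}_0$ ($n\in\mathbb{N}_0$) is the unique element with $P_0=1$ and, for $n\ge1$, $P_n=z^n+z^{-n}+$ (a $K$-linear combination of $z^j+z^{-j}$, $0\le j<n$), such that $(P_n,z^m+z^{-m})=0$ for $0\le m<n$. Here $k$ is a formal label for the parameters $(a,b,c,d)$; for $h\in\mathbb{Q}^4$, the subscript $k+h$ means that $(a,b,c,d)$ is replaced by $(aq^{h_1},bq^{h_2},cq^{h_3},dq^{h_4})$ (adjoining further rational powers of $q$ to $K$ if needed). Put $P_{n,k+h}=0$ if $n\notin\mathbb{N}_0$. Let $(Tf)(z)=f(q^{1/2}z)$. A symmetric difference operator is an operator $S=\sum_{n\in\mathbb{Z}}c_n(z)T^n$ with $c_n\in K(z)$, almost all zero, with $S\mathcal{A}_0\subset\mathcal{A}_0$. It is a shift operator with shift $h\in\mathbb{Q}^4$ if for every $m\in\mathbb{N}_0$ there is $C\in K$ with $SP_{m,k}=C\,P_{m+d',k+h}$, where $2d'+h_1+h_2+h_3+h_4=0$. $\mathcal{S}(h)$ is the set of these operators. $\mathcal{S}(0)$ is a commutative ring under composition, and it acts on $\mathcal{S}(h)$ by composition on the right, $S\cdot X=SX$ for $S\in\mathcal{S}(h)$, $X\in\mathcal{S}(0)$. $v_1=\frac12(1,1,1,1)$, $v_2=\frac12(1,1,-1,-1)$, $v_3=\frac12(1,-1,1,-1)$, $v_4=\frac12(1,-1,-1,1)$, and $\cdot$ is the standard inner product of $\mathbb{Q}^4$. *)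

theory Defs
  imports
    "HOL-Analysis.Analysis"
    "HOL-Algebra.Module"
    "HOL-Library.Poly_Mapping"
    "HOL-Computational_Algebra.Computational_Algebra"
begin

section \<open>Rational functions\<close>

text \<open>
  Extension of an injective ring homomorphism from an integral domain into a field to the
  fraction field.  It does not depend on the chosen representation of the fraction.
\<close>

definition fract_lift :: "('a::idom \<Rightarrow> 'b::field) \<Rightarrow> 'a fract \<Rightarrow> 'b" where
  "fract_lift \<phi> x =
     (let (p, r) = (SOME (p, r). r \<noteq> 0 \<and> x = Fract p r) in \<phi> p / \<phi> r)"

lemma fract_lift_Fract:
  assumes mult: "\<And>x y. \<phi> (x * y) = \<phi> x * \<phi> y"
    and nz: "\<And>x. x \<noteq> 0 \<Longrightarrow> \<phi> x \<noteq> 0"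
    and r: "r \<noteq> 0"
  shows "fract_lift \<phi> (Fract p r) = \<phi> p / \<phi> r"
proof -
  define w where "w = (SOME (p', r'). r' \<noteq> 0 \<and> Fract p r = Fract p' r')"
  obtain p' r' where w: "w = (p', r')" by fastforce
  have "(case w of (p', r') \<Rightarrow> r' \<noteq> 0 \<and> Fract p r = Fract p' r')"
    unfolding w_def by (rule someI[of _ "(p, r)"]) (use r in auto)
  hence r': "r' \<noteq> 0" and eq: "Fract p r = Fract p' r'" by (auto simp: w)
  from eq r r' have "p * r' = p' * r" by (simp add: eq_fract)
  hence "\<phi> p * \<phi> r' = \<phi> p' * \<phi> r" by (metis mult)
  hence "\<phi> p' / \<phi> r' = \<phi> p / \<phi> r"
    using nz[OF r] nz[OF r'] by (simp add: field_simps)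
  thus ?thesis
    unfolding fract_lift_def w_def[symmetric] w by simp
qed

definition poly_lift :: "('a::zero \<Rightarrow> 'b::comm_semiring_0) \<Rightarrow> 'b \<Rightarrow> 'a poly \<Rightarrow> 'b" where
  "poly_lift \<phi> x p = poly (map_poly \<phi> p) x"

text \<open>
  The fields of rational functions over the rationals in four and in five indeterminates.  The
  indeterminates are numbered from the innermost polynomial ring outwards.
\<close>

type_synonym ratfun4 = "rat poly poly poly poly fract"
type_synonym ratfun5 = "rat poly poly poly poly poly fract"

text \<open>
  \<open>rat_eval x1 x2 x3 x4 x5 R\<close> is the value \<open>R(x1, x2, x3, x4, x5)\<close>.  It is only used at
  algebraically independent arguments, where it is an embedding of fields.
\<close>

definition rat_eval :: "'b \<Rightarrow> 'b \<Rightarrow> 'b \<Rightarrow> 'b \<Rightarrow> 'b \<Rightarrow> ratfun5 \<Rightarrow> 'b::field_char_0" where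
  "rat_eval x1 x2 x3 x4 x5 =
     fract_lift (poly_lift (poly_lift (poly_lift (poly_lift (poly_lift of_rat x1) x2) x3) x4) x5)"


section \<open>The ground field\<close>

text \<open>
  To have the powers \<open>q\<^sup>r\<close> with \<open>2 N r\<close> an integer at our disposal, where \<open>N > 0\<close>, we work over
  the field of rational functions in \<open>\<surd>(-ab)\<close>, \<open>b\<close>, \<open>\<surd>(-cd)\<close>, \<open>d\<close> and
  \<open>u = q powr (1 / (2 N))\<close>.  As an abstract field it does not depend on \<open>N\<close>, but the position of
  \<open>q\<close> in it does.  For \<open>N = 1\<close> there is no extension, the fifth indeterminate being the square
  root of \<open>q\<close>.
\<close>

definition sqrt_mab :: ratfun5 where "sqrt_mab = to_fract [:[:[:[:[:0, 1:]:]:]:]:]"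
definition par_b :: ratfun5 where "par_b = to_fract [:[:[:[:0, 1:]:]:]:]"
definition sqrt_mcd :: ratfun5 where "sqrt_mcd = to_fract [:[:[:0, 1:]:]:]"
definition par_d :: ratfun5 where "par_d = to_fract [:[:0, 1:]:]"
definition q_root :: ratfun5 where "q_root = to_fract [:0, 1:]"

definition par_a :: ratfun5 where "par_a = - (sqrt_mab ^ 2) / par_b"
definition par_c :: ratfun5 where "par_c = - (sqrt_mcd ^ 2) / par_d"

definition q_pow :: "nat \<Rightarrow> rat \<Rightarrow> ratfun5" where
  "q_pow N r = q_root powi \<lfloor>2 * of_nat N * r\<rfloor>"

definition field_star :: "ratfun5 \<Rightarrow> ratfun5" where
  "field_star = rat_eval (inverse sqrt_mab) (inverse par_b) (inverse sqrt_mcd) (inverse par_d)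
            (inverse q_root)"

text \<open>
  The replacement of \<open>(a, b, c, d)\<close> by \<open>(a q\<^bsup>h1\<^esup>, b q\<^bsup>h2\<^esup>, c q\<^bsup>h3\<^esup>, d q\<^bsup>h4\<^esup>)\<close> in an element of the field
  generated by \<open>a\<close>, \<open>b\<close>, \<open>c\<close>, \<open>d\<close> and \<open>u\<close>: such an element is \<open>R(a, b, c, d, u)\<close> for exactly one
  rational function \<open>R\<close>.  Elements outside of this subfield, where the value is arbitrary, do
  not occur as coefficients of Askey--Wilson polynomials.
\<close>

definition shift_params :: "nat \<Rightarrow> rat ^ 4 \<Rightarrow> ratfun5 \<Rightarrow> ratfun5" where
  "shift_params N h x =
     rat_eval (par_a * q_pow N (h $ 1)) (par_b * q_pow N (h $ 2))
              (par_c * q_pow N (h $ 3)) (par_d * q_pow N (h $ 4)) q_root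
       (inv_into UNIV (rat_eval par_a par_b par_c par_d q_root) x)"


section \<open>Laurent polynomials and the weight function\<close>

text \<open>Laurent polynomials in \<open>z\<close> are represented as the group algebra of the integers.\<close>

type_synonym laurent = "int \<Rightarrow>\<^sub>0 ratfun5"

definition sym_laurent :: "laurent set" where
  "sym_laurent = {f. \<forall>n. Poly_Mapping.lookup f (- n) = Poly_Mapping.lookup f n}"

definition laurent_star :: "laurent \<Rightarrow> laurent" where
  "laurent_star f =
     (\<Sum>n\<in>Poly_Mapping.keys f. Poly_Mapping.single (- n) (field_star (Poly_Mapping.lookup f n)))"

definition qpochhammer_inf :: "'a::{t2_space, comm_ring_1} \<Rightarrow> 'a \<Rightarrow> 'a" where
  "qpochhammer_inf x q = prodinf (\<lambda>j. 1 - x * q ^ j)"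

text \<open>
  The indeterminates of \<^typ>\<open>ratfun4\<close> stand for \<open>\<surd>(-ab)\<close>, \<open>b\<close>, \<open>\<surd>(-cd) / \<surd>q\<close> and \<open>d / \<surd>q\<close>;
  \<open>coef_a\<close>, \<open>coef_b\<close>, \<open>coef_c\<close>, \<open>coef_d\<close> are \<open>a\<close>, \<open>b\<close>, \<open>c / \<surd>q\<close>, \<open>d / \<surd>q\<close>.
\<close>

definition coef_sab :: ratfun4 where "coef_sab = to_fract [:[:[:[:0, 1:]:]:]:]"
definition coef_b :: ratfun4 where "coef_b = to_fract [:[:[:0, 1:]:]:]"
definition coef_scd :: ratfun4 where "coef_scd = to_fract [:[:0, 1:]:]"
definition coef_d :: ratfun4 where "coef_d = to_fract [:0, 1:]"

definition coef_a :: ratfun4 where "coef_a = - (coef_sab ^ 2) / coef_b"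
definition coef_c :: ratfun4 where "coef_c = - (coef_scd ^ 2) / coef_d"

text \<open>
  The weight as a power series in \<open>z\<close> (inner variable) and \<open>y = \<surd>q / z\<close> (outer variable).  Note
  \<open>\<surd>q = z y\<close>, \<open>q / z\<^sup>2 = y\<^sup>2\<close>, \<open>c z = (c / \<surd>q) \<surd>q z\<close>, \<open>a q / z = a \<surd>q y\<close> and \<open>c / z = (c / \<surd>q) y\<close>.
\<close>

definition weight_series :: "ratfun4 fps fps" where
  "weight_series =
    (let z = fps_const fps_X; y = fps_X; sq = z * y;
         C = (\<lambda>x. fps_const (fps_const x));
         a = C coef_a; b = C coef_b; c = C coef_c; d = C coef_d;
         P = (\<lambda>x. qpochhammer_inf x (sq ^ 2))
     in P (z ^ 2) * P (y ^ 2) *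
        inverse (P (a * z) * P (b * z) * P (c * sq * z) * P (d * sq * z) *
                 P (a * sq * y) * P (b * sq * y) * P (c * y) * P (d * y)))"

text \<open>
  The coefficient of \<open>z\<^sup>n\<close> in the weight, a power series in \<open>\<surd>q\<close>, as \<open>z\<^sup>i y\<^sup>j = z\<^bsup>i-j\<^esup> (\<surd>q)\<^sup>j\<close>.
\<close>

definition weight_coeff :: "int \<Rightarrow> ratfun4 fps" where
  "weight_coeff n =
     Abs_fps (\<lambda>j. if n + int j \<ge> 0 then weight_series $ j $ nat (n + int j) else 0)"

text \<open>
  The values of the pairing lie in the field of Laurent series in \<open>u\<close> over \<^typ>\<open>ratfun4\<close>.  It
  contains the ground field via \<open>embed N\<close> and the Laurent series in \<open>\<surd>q = u\<^sup>N\<close> over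
  \<open>\<R> = \<rat>[a\<^sup>\<plusminus>, b\<^sup>\<plusminus>, (c / \<surd>q)\<^sup>\<plusminus>, (d / \<surd>q)\<^sup>\<plusminus>]\<close>.  The induced map from the tensor product of the two
  over \<open>\<R>[(\<surd>q)\<^sup>\<plusminus>]\<close> to this field is injective: the tensor product is obtained from \<open>\<R>((\<surd>q))\<close> by
  inverting the nonzero elements of \<open>\<R>[(\<surd>q)\<^sup>\<plusminus>]\<close> and adjoining \<open>\<surd>(-ab)\<close>, \<open>\<surd>(-cd)\<close> and \<open>u\<close>.
\<close>

definition embed :: "nat \<Rightarrow> ratfun5 \<Rightarrow> ratfun4 fls" where
  "embed N = rat_eval (fls_const coef_sab) (fls_const coef_b)
               (fls_const coef_scd * fls_X ^ N) (fls_const coef_d * fls_X ^ N) fls_X"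

definition ct_weight :: "nat \<Rightarrow> laurent \<Rightarrow> ratfun4 fls" where
  "ct_weight N f =
     (\<Sum>n\<in>Poly_Mapping.keys f.
        embed N (Poly_Mapping.lookup f n) * fps_to_fls (fps_compose (weight_coeff (- n)) (fps_X ^ N)))"

definition aw_pairing :: "nat \<Rightarrow> laurent \<Rightarrow> laurent \<Rightarrow> ratfun4 fls" where
  "aw_pairing N f g = ct_weight N (f * laurent_star g)"


section \<open>Symmetric Askey--Wilson polynomials\<close>

definition z_sym :: "nat \<Rightarrow> laurent" where
  "z_sym n = Poly_Mapping.single (int n) 1 + Poly_Mapping.single (- int n) 1"

definition askey_wilson :: "nat \<Rightarrow> nat \<Rightarrow> laurent" where
  "askey_wilson N n =
     (THE P. P \<in> sym_laurent \<and>
        (if n = 0 then P = 1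
         else (\<exists>c. P = z_sym n + (\<Sum>j<n. Poly_Mapping.single 0 (c j) * z_sym j)) \<and>
              (\<forall>m<n. aw_pairing N P (z_sym m) = 0)))"

definition askey_wilson_shifted :: "nat \<Rightarrow> rat ^ 4 \<Rightarrow> rat \<Rightarrow> laurent" where
  "askey_wilson_shifted N h n =
     (if n \<in> \<nat> then Poly_Mapping.map (shift_params N h) (askey_wilson N (nat \<lfloor>n\<rfloor>)) else 0)"


section \<open>Difference operators and shift operators\<close>

type_synonym ratfun_z = "ratfun5 poly fract"

definition const_z :: "ratfun5 \<Rightarrow> ratfun_z" where
  "const_z x = to_fract [:x:]"

definition laurent_z :: "laurent \<Rightarrow> ratfun_z" where
  "laurent_z f =
     (\<Sum>n\<in>Poly_Mapping.keys f. const_z (Poly_Mapping.lookup f n) * to_fract [:0, 1:] powi n)"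

definition sym_laurent_z :: "ratfun_z set" where
  "sym_laurent_z = laurent_z ` sym_laurent"

text \<open>\<open>T_pow N n f\<close> is \<open>f(q\<^bsup>n/2\<^esup> z)\<close>.\<close>

definition T_pow :: "nat \<Rightarrow> int \<Rightarrow> ratfun_z \<Rightarrow> ratfun_z" where
  "T_pow N n = fract_lift (\<lambda>p. to_fract (pcompose p [:0, q_pow N (of_int n / 2):]))"

text \<open>
  Difference operators are regarded as maps on the field of rational functions in \<open>z\<close>; their
  coefficients are determined by these maps since the automorphisms \<open>T_pow N n\<close> are distinct.
\<close>

definition difference_operators :: "nat \<Rightarrow> (ratfun_z \<Rightarrow> ratfun_z) set" where
  "difference_operators N =
     {S. \<exists>c. finite {n. c n \<noteq> 0} \<and> S = (\<lambda>f. \<Sum>n | c n \<noteq> 0. c n * T_pow N n f)}"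

definition symmetric_difference_operators :: "nat \<Rightarrow> (ratfun_z \<Rightarrow> ratfun_z) set" where
  "symmetric_difference_operators N = {S \<in> difference_operators N. S ` sym_laurent_z \<subseteq> sym_laurent_z}"

definition shift_operators :: "nat \<Rightarrow> rat ^ 4 \<Rightarrow> (ratfun_z \<Rightarrow> ratfun_z) set" where
  "shift_operators N h =
     {S \<in> symmetric_difference_operators N.
        \<forall>m. \<exists>C. S (laurent_z (askey_wilson N m)) =
          const_z C * laurent_z (askey_wilson_shifted N h
            (of_nat m - (h $ 1 + h $ 2 + h $ 3 + h $ 4) / 2))}"

definition shift_ring :: "nat \<Rightarrow> (ratfun_z \<Rightarrow> ratfun_z) ring" where
  "shift_ring N =
     \<lparr>carrier = shift_operators N 0, monoid.mult = (\<circ>), one = id,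
      zero = (\<lambda>_. 0), add = (\<lambda>S S' f. S f + S' f)\<rparr>"

text \<open>
  The library only has left modules; as the ring is commutative, the right action by composition
  is one.  The multiplicative fields of the record play no role for modules.
\<close>

definition shift_module ::
    "nat \<Rightarrow> rat ^ 4 \<Rightarrow> (ratfun_z \<Rightarrow> ratfun_z, ratfun_z \<Rightarrow> ratfun_z) module" where
  "shift_module N h =
     \<lparr>carrier = shift_operators N h, monoid.mult = undefined, one = undefined,
      zero = (\<lambda>_. 0), add = (\<lambda>S S' f. S f + S' f), smult = (\<lambda>X S. S \<circ> X)\<rparr>"

definition free_module_of_rank :: "('a, 'r) ring_scheme \<Rightarrow> ('a, 'b, 'm) module_scheme \<Rightarrow> nat \<Rightarrow> bool" where
  "free_module_of_rank R M r \<longleftrightarrow>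
     Module.module R M \<and>
     (\<exists>B. finite B \<and> card B = r \<and> B \<subseteq> carrier M \<and>
        (\<forall>x\<in>carrier M. \<exists>!c. c \<in> B \<rightarrow>\<^sub>E carrier R \<and> x = (\<Oplus>\<^bsub>M\<^esub>b\<in>B. c b \<odot>\<^bsub>M\<^esub> b)))"

definition shift_dir :: "rat ^ 4 ^ 4" where
  "shift_dir = vector [vector [1/2, 1/2, 1/2, 1/2], vector [1/2, 1/2, -1/2, -1/2],
                       vector [1/2, -1/2, 1/2, -1/2], vector [1/2, -1/2, -1/2, 1/2]]"

end

theory Submission imports Defs begin

text \<open>
  With \<open>q = r\<^sup>2\<close>, the polynomials \<open>P\<^sub>n\<close> are the eigenfunctions of the operator
  \<open>L = r\<^sup>-\<^sup>1 S\<^sup>- S\<^sup>+ + const\<close>, where \<open>S\<^sup>+\<close> and \<open>S\<^sup>-\<close> shift by \<open>v\<^sub>1\<close> and \<open>- v\<^sub>1\<close>; orthogonality follows from a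
  discrete Wronskian identity.  As the eigenvalues separate the \<open>P\<^sub>n\<close>, a symmetric difference
  operator \<open>S\<close> has shift \<open>h\<close> iff \<open>S L = \<kappa> L' S\<close> for the shifted operator \<open>L'\<close> and a suitable constant \<open>\<kappa>\<close>.
  Comparing leading terms \<open>x T\<^sup>s\<close> gives a first order difference equation for \<open>x\<close>.  Counting its zeros
  and poles along the orbit of \<open>1 / a\<close> determines \<open>h\<^sub>1\<close> modulo the integers from \<open>s\<close>, likewise for
  \<open>b\<close>, \<open>c\<close>, \<open>d\<close>; this forces \<open>h \<cdot> v\<^sub>i \<in> \<int>\<close> and fixes the parity of \<open>s\<close>.  Solutions of the equation are
  unique up to constants.  Hence, subtracting multiples of \<open>S\<^sub>0 L\<^sup>k\<close>, a nonzero \<open>S\<^sub>0\<close> of minimal order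
  generates.  For \<open>h\<close> in the lattice a nonzero operator is a composition of elementary ones with shifts \<open>\<plusminus> v\<^sub>i\<close>.
\<close>


section \<open>Evaluation of rational functions\<close>

text \<open>The weight is a formal series without symmetry under \<open>z -> 1/z\<close>:
  \<open>a\<close>, \<open>b\<close> and \<open>c\<close>, \<open>d\<close> enter its denominator
  differently. Orthogonality therefore needs two reflections, \<open>z -> 1/z\<close> for the weight
  stripped of some factors with \<open>a\<close> and \<open>b\<close>, and \<open>z -> q/z\<close>
  for a modification with \<open>c\<close> and \<open>d\<close>. Norms must be shown to be nonzero
  as well, since otherwise the defining conditions would not single out \<open>P_n\<close>.

  The eigenvalue of \<open>P_n\<close> is \<open>q^(-n) + abcd q^(n-1)\<close>. A shift by
  \<open>h\<close> multiplies \<open>abcd\<close> by \<open>q^(2m)\<close> with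
  \<open>m = h . v_1\<close>, and the eigenvalue of \<open>L'\<close> at degree \<open>n - m\<close>
  is \<open>q^m\<close> times that of \<open>L\<close> at \<open>n\<close>; this is the origin of
  \<open>\<kappa> = q^(-m)\<close>. If \<open>m\<close> is not an integer, all target polynomials
  are zero by convention and so is \<open>S\<close>.

  All four parameters see the same order \<open>s\<close>, so each \<open>h_i\<close> is congruent
  to \<open>s/2\<close> modulo the integers; together with the integrality of \<open>m\<close> this
  is the lattice condition. As \<open>L\<close> has order two, its powers can only bridge orders of
  equal parity, and the descent stops because symmetry under \<open>z -> 1/z\<close> excludes
  negative orders.\<close>

locale ring_homo =
  fixes \<phi> :: "'a::comm_ring_1 \<Rightarrow> 'b::comm_ring_1"
  assumes add: "\<phi> (x + y) = \<phi> x + \<phi> y"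
    and mult: "\<phi> (x * y) = \<phi> x * \<phi> y"
    and one [simp]: "\<phi> 1 = 1"
begin

lemma zero [simp]: "\<phi> 0 = 0"
  using add[of 0 0] by simp

lemma uminus: "\<phi> (- x) = - \<phi> x"
  using add[of x "- x"] by (simp add: eq_neg_iff_add_eq_0 add.commute)

lemma diff: "\<phi> (x - y) = \<phi> x - \<phi> y"
  using add[of x "- y"] by (simp add: uminus)

lemma sum: "\<phi> (sum f A) = (\<Sum>x\<in>A. \<phi> (f x))"
  by (induction A rule: infinite_finite_induct) (auto simp: add)

lemma prod: "\<phi> (prod f A) = (\<Prod>x\<in>A. \<phi> (f x))"
  by (induction A rule: infinite_finite_induct) (auto simp: mult)

lemma power: "\<phi> (x ^ n) = \<phi> x ^ n"
  by (induction n) (auto simp: mult)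

lemma of_nat [simp]: "\<phi> (of_nat n) = of_nat n"
  by (induction n) (auto simp: add)

lemma of_int [simp]: "\<phi> (of_int n) = of_int n"
  by (cases n) (auto simp: uminus diff)

lemma numeral [simp]: "\<phi> (numeral n) = numeral n"
  using of_nat[of "numeral n"] by simp

end

locale field_homo = ring_homo \<phi> for \<phi> :: "'a::field \<Rightarrow> 'b::field"
begin

lemma eq_0_iff [simp]: "\<phi> x = 0 \<longleftrightarrow> x = 0"
proof
  assume "\<phi> x = 0"
  show "x = 0"
  proof (rule ccontr)
    assume "x \<noteq> 0"
    hence "1 = \<phi> (x * inverse x)" by simp
    also have "\<dots> = 0" by (simp only: mult \<open>\<phi> x = 0\<close> mult_zero_left)
    finally show False by simp
  qed
qed auto

lemma eq_iff: "\<phi> x = \<phi> y \<longleftrightarrow> x = y"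
  using eq_0_iff[of "x - y"] by (simp add: diff del: eq_0_iff)

lemma inverse: "\<phi> (inverse x) = inverse (\<phi> x)"
proof (cases "x = 0")
  case False
  have "\<phi> x * \<phi> (inverse x) = 1"
    using False by (simp flip: mult)
  thus ?thesis by (metis inverse_unique)
qed auto

lemma divide: "\<phi> (x / y) = \<phi> x / \<phi> y"
  by (simp add: divide_inverse mult inverse)

lemma powi: "\<phi> (x powi n) = \<phi> x powi n"
  by (simp add: power_int_def power inverse)

end

lemma ring_homo_to_fract: "ring_homo (to_fract :: 'a::idom \<Rightarrow> 'a fract)"
  by unfold_locales auto

lemma ring_homo_const_poly: "ring_homo (\<lambda>c. [:c:])"
  by unfold_locales (auto simp: one_pCons)

lemma field_homo_of_rat: "field_homo (of_rat :: rat \<Rightarrow> 'a::field_char_0)"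
  by unfold_locales (auto simp: of_rat_add of_rat_mult)

lemma ring_homo_comp: "ring_homo f \<Longrightarrow> ring_homo g \<Longrightarrow> ring_homo (\<lambda>x. f (g x))"
  by (simp add: ring_homo_def)

lemma
  fixes \<phi> :: "'a::idom \<Rightarrow> 'b::field"
  assumes "ring_homo \<phi>" and nz: "\<And>x. x \<noteq> 0 \<Longrightarrow> \<phi> x \<noteq> 0"
  shows field_homo_fract_lift: "field_homo (fract_lift \<phi>)"
    and fract_lift_to_fract: "fract_lift \<phi> (to_fract p) = \<phi> p"
proof -
  interpret ring_homo \<phi> by fact
  have F: "fract_lift \<phi> (Fract p r) = \<phi> p / \<phi> r" if "r \<noteq> 0" for p r
    using fract_lift_Fract[of \<phi>] mult nz that by metis
  show "fract_lift \<phi> (to_fract p) = \<phi> p" by (simp add: to_fract_def F)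
  show "field_homo (fract_lift \<phi>)"
  proof
    fix x y :: "'a fract"
    obtain a b c d where xy: "x = Fract a b" "y = Fract c d" "b \<noteq> 0" "d \<noteq> 0"
      by (metis Fract_cases)
    have n: "\<phi> b \<noteq> 0" "\<phi> d \<noteq> 0" using xy nz by auto
    show "fract_lift \<phi> (x + y) = fract_lift \<phi> x + fract_lift \<phi> y"
      using xy n by (simp add: F add mult add_frac_eq)
    show "fract_lift \<phi> (x * y) = fract_lift \<phi> x * fract_lift \<phi> y"
      using xy n by (simp add: F mult)
  next
    have "fract_lift \<phi> (Fract 1 1) = 1" by (subst F) auto
    thus "fract_lift \<phi> 1 = 1" by (simp add: One_fract_def)
  qed
qed

lemma
  assumes "ring_homo \<phi>"
  shows ring_homo_poly_lift: "ring_homo (poly_lift \<phi> x)"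
    and poly_lift_const: "poly_lift \<phi> x [:c:] = \<phi> c"
    and poly_lift_X: "poly_lift \<phi> x [:0, 1:] = x"
    and poly_lift_altdef: "poly_lift \<phi> x p = (\<Sum>j | coeff p j \<noteq> 0. \<phi> (coeff p j) * x ^ j)"
proof -
  interpret ring_homo \<phi> by fact
  have a: "map_poly \<phi> (p + r) = map_poly \<phi> p + map_poly \<phi> r" for p r
    by (rule poly_eqI) (simp add: coeff_map_poly add)
  have m: "map_poly \<phi> (p * r) = map_poly \<phi> p * map_poly \<phi> r" for p r
    by (rule poly_eqI) (simp add: coeff_map_poly coeff_mult sum mult)
  show "ring_homo (poly_lift \<phi> x)"
    by unfold_locales (simp_all add: poly_lift_def a m)
  show "poly_lift \<phi> x [:c:] = \<phi> c" "poly_lift \<phi> x [:0, 1:] = x"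
    by (simp_all add: poly_lift_def map_poly_pCons)
  have "poly_lift \<phi> x p = (\<Sum>j\<le>degree p. \<phi> (coeff p j) * x ^ j)"
  proof -
    have "poly_lift \<phi> x p = poly_lift \<phi> x (\<Sum>j\<le>degree p. monom (coeff p j) j)"
      by (simp add: poly_as_sum_of_monoms)
    also have "\<dots> = (\<Sum>j\<le>degree p. poly_lift \<phi> x (monom (coeff p j) j))"
      by (rule ring_homo.sum) fact
    finally show ?thesis by (simp add: poly_lift_def map_poly_monom poly_monom)
  qed
  also have "\<dots> = (\<Sum>j | coeff p j \<noteq> 0. \<phi> (coeff p j) * x ^ j)"
    by (rule sum.mono_neutral_right) (auto simp: le_degree)
  finally show "poly_lift \<phi> x p = (\<Sum>j | coeff p j \<noteq> 0. \<phi> (coeff p j) * x ^ j)" .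
qed

text \<open>Algebraic independence of generators is expressed as linear independence of their
  monomials \<open>m e\<close> over the rationals. The embedding \<open>\<iota>\<close> of the
  rationals is a parameter because in a tower of polynomial rings it is an iterated constant
  polynomial, to be identified with \<open>of_rat\<close> only in a field.\<close>

definition lin_indep_via :: "(rat \<Rightarrow> 'b::comm_ring_1) \<Rightarrow> ('e \<Rightarrow> 'b) \<Rightarrow> bool" where
  "lin_indep_via \<iota> m \<longleftrightarrow>
     (\<forall>S c. finite S \<longrightarrow> (\<Sum>e\<in>S. \<iota> (c e) * m e) = 0 \<longrightarrow> (\<forall>e\<in>S. c e = 0))"

lemma lin_indep_viaD:
  "lin_indep_via \<iota> m \<Longrightarrow> finite S \<Longrightarrow> (\<Sum>e\<in>S. \<iota> (c e) * m e) = 0 \<Longrightarrow> e \<in> S \<Longrightarrow> c e = 0"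
  by (auto simp: lin_indep_via_def)

text \<open>Monomials in substituted generators are, up to a sign \<open>s\<close>, monomials in the
  old generators at injectively changed exponents. The independence of inverted, shifted and
  embedded parameters is reduced to this.\<close>

lemma lin_indep_via_reindex:
  assumes m: "lin_indep_via \<iota> m" and \<iota>: "ring_homo \<iota>" and f: "inj f"
    and s: "\<And>e. s e * s e = (1::rat)" and m': "\<And>e. m' e = \<iota> (s e) * m (f e)"
  shows "lin_indep_via \<iota> m'"
  unfolding lin_indep_via_def
proof (intro allI impI)
  fix S c assume S: "finite S" and 0: "(\<Sum>e\<in>S. \<iota> (c e) * m' e) = 0"
  interpret ring_homo \<iota> by fact
  define g where "g = inv_into UNIV f"
  have g: "g (f e) = e" for e using f by (simp add: g_def)
  have "(\<Sum>e\<in>f ` S. \<iota> (c (g e) * s (g e)) * m e) = (\<Sum>e\<in>S. \<iota> (c e * s e) * m (f e))"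
    by (subst sum.reindex) (use f in \<open>auto simp: g inj_on_def\<close>)
  also have "\<dots> = 0" using 0 by (simp add: m' mult mult.assoc)
  finally have "c (g e) * s (g e) = 0" if "e \<in> f ` S" for e
    using lin_indep_viaD[OF m, of "f ` S" "\<lambda>e. c (g e) * s (g e)"] S that by auto
  hence "c e * s e = 0" if "e \<in> S" for e using that g by fastforce
  moreover have "s e \<noteq> 0" for e using s[of e] by auto
  ultimately show "\<forall>e\<in>S. c e = 0" by simp
qed

text \<open>Complement of \<open>lin_indep_via\<close>: together they give \<open>\<phi>\<close> a
  trivial kernel. Only the existence of a nontrivial expansion is recorded, which passes through
  each level of the polynomial tower without naming coefficients.\<close>

definition expands_via :: "('a::zero \<Rightarrow> 'b::field_char_0) \<Rightarrow> ('e \<Rightarrow> 'b) \<Rightarrow> bool" where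
  "expands_via \<phi> m \<longleftrightarrow> (\<forall>p. p \<noteq> 0 \<longrightarrow>
     (\<exists>S c. finite S \<and> \<phi> p = (\<Sum>e\<in>S. of_rat (c e) * m e) \<and> (\<exists>e\<in>S. c e \<noteq> 0)))"

lemma expands_via_nonzero:
  "expands_via \<phi> m \<Longrightarrow> lin_indep_via of_rat m \<Longrightarrow> p \<noteq> 0 \<Longrightarrow> \<phi> p \<noteq> 0"
  unfolding expands_via_def lin_indep_via_def by metis

lemma expands_via_poly_lift:
  assumes "ring_homo \<phi>" and e: "expands_via \<phi> m"
  shows "expands_via (poly_lift \<phi> x) (\<lambda>(e, j). m e * x ^ j)"
  unfolding expands_via_def
proof (intro allI impI)
  fix p :: "'a poly" assume p: "p \<noteq> 0"
  let ?J = "{j. coeff p j \<noteq> 0}"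
  have fin: "finite ?J"
    by (rule finite_subset[of _ "{..degree p}"]) (auto simp: le_degree)
  define good where "good j Sc \<longleftrightarrow> finite (fst Sc) \<and>
    \<phi> (coeff p j) = (\<Sum>e\<in>fst Sc. of_rat (snd Sc e) * m e) \<and> (\<exists>e\<in>fst Sc. snd Sc e \<noteq> 0)"
    for j and Sc :: "'c set \<times> ('c \<Rightarrow> rat)"
  have "\<forall>j\<in>?J. \<exists>Sc. good j Sc"
    using e by (force simp: expands_via_def good_def)
  then obtain Sc where Sc: "\<forall>j\<in>?J. good j (Sc j)" by metis
  define S where "S j = fst (Sc j)" for j
  define c where "c j = snd (Sc j)" for j
  have Sc: "finite (S j)" "\<phi> (coeff p j) = (\<Sum>e\<in>S j. of_rat (c j e) * m e)"
      "\<exists>e\<in>S j. c j e \<noteq> 0" if "j \<in> ?J" for j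
    using Sc that by (auto simp: good_def S_def c_def)
  define S' where "S' = prod.swap ` (SIGMA j:?J. S j)"
  have fS: "finite (SIGMA j:?J. S j)" by (rule finite_SigmaI[OF fin Sc(1)])
  have "poly_lift \<phi> x p = (\<Sum>j\<in>?J. \<Sum>e\<in>S j. of_rat (c j e) * (m e * x ^ j))"
    unfolding poly_lift_altdef[OF assms(1)]
    by (rule sum.cong) (auto simp: Sc(2) sum_distrib_right mult.assoc)
  also have "\<dots> = (\<Sum>(j, e)\<in>(SIGMA j:?J. S j). of_rat (c j e) * (m e * x ^ j))"
    using fin Sc(1) by (subst sum.Sigma) auto
  also have "\<dots> = (\<Sum>e\<in>S'. of_rat (c (snd e) (fst e)) * (case e of (e, j) \<Rightarrow> m e * x ^ j))"
    unfolding S'_def by (subst sum.reindex) (auto simp: case_prod_unfold)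
  finally have 1: "poly_lift \<phi> x p = \<dots>" .
  \<comment> \<open>The leading coefficient of \<open>p\<close> is nonzero, so its expansion
    supplies a nonzero coefficient of the combined one.\<close>
  have "degree p \<in> ?J" using p by simp
  then obtain e where "e \<in> S (degree p)" "c (degree p) e \<noteq> 0" using Sc(3) by blast
  hence 2: "\<exists>e\<in>S'. c (snd e) (fst e) \<noteq> 0"
    using \<open>degree p \<in> ?J\<close> unfolding S'_def by force
  show "\<exists>S c. finite S \<and> poly_lift \<phi> x p =
          (\<Sum>e\<in>S. of_rat (c e) * (case e of (e, j) \<Rightarrow> m e * x ^ j)) \<and> (\<exists>e\<in>S. c e \<noteq> 0)"
    by (rule exI[of _ S'], rule exI[of _ "\<lambda>e. c (snd e) (fst e)"])
       (use 1 2 fS in \<open>auto simp: S'_def\<close>)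
qed

lemma expands_via_of_rat: "expands_via (of_rat :: rat \<Rightarrow> 'b::field_char_0) (\<lambda>_::unit. 1)"
  unfolding expands_via_def
proof (intro allI impI)
  fix p :: rat assume "p \<noteq> 0"
  thus "\<exists>S c. finite (S :: unit set) \<and> (of_rat p :: 'b) = (\<Sum>e\<in>S. of_rat (c e) * 1) \<and> (\<exists>e\<in>S. c e \<noteq> 0)"
    by (intro exI[of _ "{()}"] exI[of _ "\<lambda>_. p"]) simp
qed

text \<open>The nested pairs over \<open>unit\<close> are the index type that five applications of
  \<open>expands_via_poly_lift\<close> to \<open>expands_via_of_rat\<close> produce.\<close>

definition nat_mon :: "'b \<Rightarrow> 'b \<Rightarrow> 'b \<Rightarrow> 'b \<Rightarrow> 'b \<Rightarrow> ((((unit \<times> nat) \<times> nat) \<times> nat) \<times> nat) \<times> nat \<Rightarrow> 'b::field" where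
  "nat_mon x1 x2 x3 x4 x5 = (\<lambda>(((((_, k1), k2), k3), k4), k5).
     x1 ^ k1 * x2 ^ k2 * x3 ^ k3 * x4 ^ k4 * x5 ^ k5)"

lemma nat_mon_simps:
  "nat_mon x1 x2 x3 x4 x5 (((((u, k1), k2), k3), k4), k5) =
     x1 ^ k1 * x2 ^ k2 * x3 ^ k3 * x4 ^ k4 * x5 ^ k5"
  by (simp add: nat_mon_def)

lemma nat_mon_cases:
  fixes e :: "((((unit \<times> nat) \<times> nat) \<times> nat) \<times> nat) \<times> nat"
  obtains u k1 k2 k3 k4 k5 where "e = (((((u, k1), k2), k3), k4), k5)"
  by (metis surj_pair)

fun int_mon :: "'b \<Rightarrow> 'b \<Rightarrow> 'b \<Rightarrow> 'b \<Rightarrow> 'b \<Rightarrow> int \<times> int \<times> int \<times> int \<times> int \<Rightarrow> 'b::field" where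
  "int_mon x1 x2 x3 x4 x5 (k1, k2, k3, k4, k5) =
     x1 powi k1 * x2 powi k2 * x3 powi k3 * x4 powi k4 * x5 powi k5"

text \<open>Independence of the arguments makes the fivefold \<open>poly_lift\<close> vanish only at
  zero, so that \<open>fract_lift\<close> extends it to a field embedding.\<close>

lemma
  fixes x1 :: "'b::field_char_0"
  assumes ind: "lin_indep_via of_rat (nat_mon x1 x2 x3 x4 x5)"
  shows field_homo_rat_eval: "field_homo (rat_eval x1 x2 x3 x4 x5)"
    and rat_eval_sqrt_mab: "rat_eval x1 x2 x3 x4 x5 sqrt_mab = x1"
    and rat_eval_par_b: "rat_eval x1 x2 x3 x4 x5 par_b = x2"
    and rat_eval_sqrt_mcd: "rat_eval x1 x2 x3 x4 x5 sqrt_mcd = x3"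
    and rat_eval_par_d: "rat_eval x1 x2 x3 x4 x5 par_d = x4"
    and rat_eval_q_root: "rat_eval x1 x2 x3 x4 x5 q_root = x5"
proof -
  define f1 where "f1 = poly_lift (of_rat :: rat \<Rightarrow> 'b) x1"
  define f2 where "f2 = poly_lift f1 x2"
  define f3 where "f3 = poly_lift f2 x3"
  define f4 where "f4 = poly_lift f3 x4"
  define f5 where "f5 = poly_lift f4 x5"
  have r0: "ring_homo (of_rat :: rat \<Rightarrow> 'b)"
    using field_homo_of_rat by (simp add: field_homo_def)
  have r1: "ring_homo f1" unfolding f1_def by (rule ring_homo_poly_lift[OF r0])
  have r2: "ring_homo f2" unfolding f2_def by (rule ring_homo_poly_lift[OF r1])
  have r3: "ring_homo f3" unfolding f3_def by (rule ring_homo_poly_lift[OF r2])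
  have r4: "ring_homo f4" unfolding f4_def by (rule ring_homo_poly_lift[OF r3])
  have r5: "ring_homo f5" unfolding f5_def by (rule ring_homo_poly_lift[OF r4])
  note e1 = expands_via_poly_lift[OF r0 expands_via_of_rat, of x1, folded f1_def]
  note e2 = expands_via_poly_lift[OF r1 e1, of x2, folded f2_def]
  note e3 = expands_via_poly_lift[OF r2 e2, of x3, folded f3_def]
  note e4 = expands_via_poly_lift[OF r3 e3, of x4, folded f4_def]
  note e5 = expands_via_poly_lift[OF r4 e4, of x5, folded f5_def]
  have "(\<lambda>(e, j). (case e of (e, j) \<Rightarrow> (case e of (e, j) \<Rightarrow> (case e of (e, j) \<Rightarrow>
          (case e of (e, j) \<Rightarrow> 1 * x1 ^ j) * x2 ^ j) * x3 ^ j) * x4 ^ j) * x5 ^ j) =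
        nat_mon x1 x2 x3 x4 x5"
    by (rule ext) (simp add: nat_mon_def case_prod_unfold)
  hence nz: "\<And>p. p \<noteq> 0 \<Longrightarrow> f5 p \<noteq> 0"
    using expands_via_nonzero[OF e5] ind by simp
  have R: "rat_eval x1 x2 x3 x4 x5 = fract_lift f5"
    by (simp add: rat_eval_def f5_def f4_def f3_def f2_def f1_def)
  show "field_homo (rat_eval x1 x2 x3 x4 x5)"
    unfolding R by (rule field_homo_fract_lift[OF r5 nz])
  have L: "fract_lift f5 (to_fract p) = f5 p" for p
    by (rule fract_lift_to_fract[OF r5 nz])
  have c5: "f5 [:p:] = f4 p" for p unfolding f5_def by (rule poly_lift_const[OF r4])
  have c4: "f4 [:p:] = f3 p" for p unfolding f4_def by (rule poly_lift_const[OF r3])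
  have c3: "f3 [:p:] = f2 p" for p unfolding f3_def by (rule poly_lift_const[OF r2])
  have c2: "f2 [:p:] = f1 p" for p unfolding f2_def by (rule poly_lift_const[OF r1])
  have X5: "f5 [:0, 1:] = x5" unfolding f5_def by (rule poly_lift_X[OF r4])
  have X4: "f4 [:0, 1:] = x4" unfolding f4_def by (rule poly_lift_X[OF r3])
  have X3: "f3 [:0, 1:] = x3" unfolding f3_def by (rule poly_lift_X[OF r2])
  have X2: "f2 [:0, 1:] = x2" unfolding f2_def by (rule poly_lift_X[OF r1])
  have X1: "f1 [:0, 1:] = x1" unfolding f1_def by (rule poly_lift_X[OF r0])
  show "rat_eval x1 x2 x3 x4 x5 q_root = x5" by (simp only: R q_root_def L X5)
  show "rat_eval x1 x2 x3 x4 x5 par_d = x4" by (simp only: R par_d_def L c5 X4)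
  show "rat_eval x1 x2 x3 x4 x5 sqrt_mcd = x3" by (simp only: R sqrt_mcd_def L c5 c4 X3)
  show "rat_eval x1 x2 x3 x4 x5 par_b = x2" by (simp only: R par_b_def L c5 c4 c3 X2)
  show "rat_eval x1 x2 x3 x4 x5 sqrt_mab = x1" by (simp only: R sqrt_mab_def L c5 c4 c3 c2 X1)
qed

text \<open>The coefficient at each power \<open>j\<close> of the new indeterminate is a relation
  among the \<open>m e\<close> alone.\<close>

lemma lin_indep_via_monom:
  assumes \<iota>: "ring_homo \<iota>" and ind: "lin_indep_via \<iota> m"
  shows "lin_indep_via (\<lambda>x. [:\<iota> x:]) (\<lambda>(e, j). [:m e:] * [:0, 1:] ^ j)"
  unfolding lin_indep_via_def
proof (intro allI impI)
  fix S :: "('b \<times> nat) set" and c assume S: "finite S"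
    and 0: "(\<Sum>e\<in>S. [:\<iota> (c e):] * (case e of (e, j) \<Rightarrow> [:m e:] * [:0, 1:] ^ j)) = 0"
  have m: "[:\<iota> (c e):] * (case e of (e, j) \<Rightarrow> [:m e:] * [:0, 1:] ^ j) =
           monom (\<iota> (c e) * m (fst e)) (snd e)" for e
    by (auto simp: monom_altdef split: prod.splits)
  have "c (e, j) = 0" if ej: "(e, j) \<in> S" for e j
  proof -
    let ?S = "{e. (e, j) \<in> S}"
    have fin: "finite ?S" by (rule finite_subset[of _ "fst ` S"]) (use S in force)+
    have "0 = coeff (\<Sum>e\<in>S. monom (\<iota> (c e) * m (fst e)) (snd e)) j"
      using 0 unfolding m by simp
    also have "\<dots> = (\<Sum>e\<in>S. if snd e = j then \<iota> (c e) * m (fst e) else 0)"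
      by (simp add: coeff_sum)
    also have "\<dots> = (\<Sum>e\<in>{e\<in>S. snd e = j}. \<iota> (c e) * m (fst e))"
      using S by (simp add: sum.inter_filter)
    also have "{e\<in>S. snd e = j} = (\<lambda>e. (e, j)) ` ?S" by auto
    also have "(\<Sum>e\<in>(\<lambda>e. (e, j)) ` ?S. \<iota> (c e) * m (fst e)) = (\<Sum>e\<in>?S. \<iota> (c (e, j)) * m e)"
      by (subst sum.reindex) (auto simp: inj_on_def)
    finally show ?thesis
      using lin_indep_viaD[OF ind fin, of "\<lambda>e. c (e, j)" e] ej by auto
  qed
  thus "\<forall>e\<in>S. c e = 0" by auto
qed

lemma lin_indep_via_to_fract:
  assumes "lin_indep_via \<iota> m"
  shows "lin_indep_via (\<lambda>x. to_fract (\<iota> x)) (\<lambda>e. to_fract (m e))"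
  unfolding lin_indep_via_def
proof (intro allI impI)
  fix S c assume S: "finite S" and 0: "(\<Sum>e\<in>S. to_fract (\<iota> (c e)) * to_fract (m e)) = 0"
  have "(\<Sum>e\<in>S. \<iota> (c e) * m e) = 0"
    using 0 by (simp only: to_fract_mult[symmetric] ring_homo.sum[OF ring_homo_to_fract, symmetric]
        to_fract_eq_0_iff)
  thus "\<forall>e\<in>S. c e = 0" using lin_indep_viaD[OF assms S] by blast
qed

lemma ring_homo_rat_unique:
  fixes \<iota> :: "rat \<Rightarrow> 'a::field_char_0"
  assumes "ring_homo \<iota>"
  shows "\<iota> = of_rat"
proof
  interpret field_homo \<iota> using assms by (simp add: field_homo_def)
  show "\<iota> x = of_rat x" for x
    by (cases x) (simp add: divide of_rat_divide Fract_of_int_quotient)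
qed

lemma lin_indep_via_rat: "lin_indep_via (\<lambda>x::rat. x) (\<lambda>_::unit. 1)"
  unfolding lin_indep_via_def
proof (intro allI impI ballI)
  fix S :: "unit set" and c :: "unit \<Rightarrow> rat" and e
  assume 0: "(\<Sum>e\<in>S. c e * 1) = 0" and e: "e \<in> S"
  have "S = {e}" using e by auto
  thus "c e = 0" using 0 by simp
qed

lemma lin_indep_via_mono_fun:
  "lin_indep_via \<iota> m \<Longrightarrow> (\<And>x. \<iota> x = \<iota>' x) \<Longrightarrow> (\<And>e. m e = m' e) \<Longrightarrow> lin_indep_via \<iota>' m'"
  by (simp add: lin_indep_via_def)


section \<open>Algebraic independence of the parameters\<close>

lemma const_poly_mult: "[:x * y:] = [:x:] * [:y::'a::comm_ring_1:]"
  by simp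

lemma const_poly_power: "[:x ^ n:] = [:x::'a::comm_ring_1:] ^ n"
  by (rule ring_homo.power[OF ring_homo_const_poly])

lemma lin_indep_nat_mon_gens:
  "lin_indep_via of_rat (nat_mon sqrt_mab par_b sqrt_mcd par_d q_root)"
proof -
  note h1 = ring_homo_const_poly[where 'a = rat]
  note h2 = ring_homo_comp[OF ring_homo_const_poly h1]
  note h3 = ring_homo_comp[OF ring_homo_const_poly h2]
  note h4 = ring_homo_comp[OF ring_homo_const_poly h3]
  note h5 = ring_homo_comp[OF ring_homo_const_poly h4]
  have h0: "ring_homo (\<lambda>x::rat. x)" by unfold_locales auto
  note i1 = lin_indep_via_monom[OF h0 lin_indep_via_rat]
  note i2 = lin_indep_via_monom[OF h1 i1]
  note i3 = lin_indep_via_monom[OF h2 i2]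
  note i4 = lin_indep_via_monom[OF h3 i3]
  note i5 = lin_indep_via_monom[OF h4 i4]
  note i6 = lin_indep_via_to_fract[OF i5]
  note h6 = ring_homo_rat_unique[OF ring_homo_comp[OF ring_homo_to_fract h5]]
  show ?thesis
    apply (rule lin_indep_via_mono_fun[OF i6])
    subgoal using fun_cong[OF h6] by simp
    by (auto simp only: nat_mon_simps prod.case split_paired_all const_poly_mult const_poly_power to_fract_mult
            ring_homo.power[OF ring_homo_to_fract] sqrt_mab_def par_b_def sqrt_mcd_def par_d_def
            q_root_def pCons_one mult_1 to_fract_1)
qed

lemma lin_indep_nat_mon4:
  "lin_indep_via of_rat (\<lambda>((((_::unit, k1), k2), k3), k4).
     coef_sab ^ k1 * coef_b ^ k2 * coef_scd ^ k3 * coef_d ^ k4)"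
proof -
  note h1 = ring_homo_const_poly[where 'a = rat]
  note h2 = ring_homo_comp[OF ring_homo_const_poly h1]
  note h3 = ring_homo_comp[OF ring_homo_const_poly h2]
  note h4 = ring_homo_comp[OF ring_homo_const_poly h3]
  have h0: "ring_homo (\<lambda>x::rat. x)" by unfold_locales auto
  note i1 = lin_indep_via_monom[OF h0 lin_indep_via_rat]
  note i2 = lin_indep_via_monom[OF h1 i1]
  note i3 = lin_indep_via_monom[OF h2 i2]
  note i4 = lin_indep_via_monom[OF h3 i3]
  note i6 = lin_indep_via_to_fract[OF i4]
  note h6 = ring_homo_rat_unique[OF ring_homo_comp[OF ring_homo_to_fract h4]]
  show ?thesis
    apply (rule lin_indep_via_mono_fun[OF i6])
    subgoal using fun_cong[OF h6] by simp
    subgoal for e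
      by (cases e)
         (simp only: split_paired_all prod.case const_poly_mult const_poly_power to_fract_mult
            ring_homo.power[OF ring_homo_to_fract] coef_sab_def coef_b_def coef_scd_def coef_d_def
            pCons_one mult_1 to_fract_1 split: prod.splits)
    done
qed

lemma gens_nonzero [simp]:
  "sqrt_mab \<noteq> 0" "par_b \<noteq> 0" "sqrt_mcd \<noteq> 0" "par_d \<noteq> 0" "q_root \<noteq> 0"
  by (simp_all add: sqrt_mab_def par_b_def sqrt_mcd_def par_d_def q_root_def)

lemma par_nonzero [simp]: "par_a \<noteq> 0" "par_c \<noteq> 0"
  by (simp_all add: par_a_def par_c_def)

lemma coef_nonzero [simp]:
  "coef_sab \<noteq> 0" "coef_b \<noteq> 0" "coef_scd \<noteq> 0" "coef_d \<noteq> 0" "coef_a \<noteq> 0" "coef_c \<noteq> 0"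
  by (simp_all add: coef_sab_def coef_b_def coef_scd_def coef_d_def coef_a_def coef_c_def)

text \<open>A relation with integer exponents becomes one with natural exponents after
  multiplication by a power product.\<close>

lemma lin_indep_int_mon:
  fixes x1 :: "'b::field_char_0"
  assumes ind: "lin_indep_via of_rat (nat_mon x1 x2 x3 x4 x5)"
    and nz: "x1 \<noteq> 0" "x2 \<noteq> 0" "x3 \<noteq> 0" "x4 \<noteq> 0" "x5 \<noteq> 0"
  shows "lin_indep_via of_rat (int_mon x1 x2 x3 x4 x5)"
  unfolding lin_indep_via_def
proof (intro allI impI ballI)
  fix S :: "(int \<times> int \<times> int \<times> int \<times> int) set" and c e
  assume S: "finite S" and 0: "(\<Sum>e\<in>S. of_rat (c e) * int_mon x1 x2 x3 x4 x5 e) = 0"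
    and e: "e \<in> S"
  define T where "T = (\<Union>(k1, k2, k3, k4, k5)\<in>S. {k1, k2, k3, k4, k5})"
  \<comment> \<open>The sum of all absolute values bounds each exponent; the power product
    \<open>y\<close> below, with all exponents equal to \<open>D\<close>, clears the
    denominators.\<close>
  define D where "D = (\<Sum>k\<in>T. \<bar>k\<bar>)"
  have "finite T" using S unfolding T_def by (intro finite_UN_I) auto
  hence D: "\<bar>k\<bar> \<le> D" if "k \<in> T" for k
    unfolding D_def using that by (intro member_le_sum) auto
  have D: "\<bar>k1\<bar> \<le> D" "\<bar>k2\<bar> \<le> D" "\<bar>k3\<bar> \<le> D" "\<bar>k4\<bar> \<le> D" "\<bar>k5\<bar> \<le> D"
    if "(k1, k2, k3, k4, k5) \<in> S" for k1 k2 k3 k4 k5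
    by (rule D; use that in \<open>force simp: T_def\<close>)+
  have N: "0 \<le> k + D" if "\<bar>k\<bar> \<le> D" for k using that by arith
  define f :: "int \<times> int \<times> int \<times> int \<times> int \<Rightarrow> ((((unit \<times> nat) \<times> nat) \<times> nat) \<times> nat) \<times> nat"
    where "f = (\<lambda>(k1, k2, k3, k4, k5). ((((((), nat (k1 + D)), nat (k2 + D)), nat (k3 + D)),
                  nat (k4 + D)), nat (k5 + D)))"
  define g :: "((((unit \<times> nat) \<times> nat) \<times> nat) \<times> nat) \<times> nat \<Rightarrow> int \<times> int \<times> int \<times> int \<times> int"
    where "g = (\<lambda>(((((_::unit, k1), k2), k3), k4), k5). (int k1 - D, int k2 - D, int k3 - D, int k4 - D, int k5 - D))"
  define y where "y = x1 powi D * x2 powi D * x3 powi D * x4 powi D * x5 powi D"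
  have gf: "g (f e) = e" if "e \<in> S" for e
  proof (cases e)
    case (fields k1 k2 k3 k4 k5)
    note N[OF D(1)[OF that[unfolded fields]]] N[OF D(2)[OF that[unfolded fields]]]
      N[OF D(3)[OF that[unfolded fields]]] N[OF D(4)[OF that[unfolded fields]]]
      N[OF D(5)[OF that[unfolded fields]]]
    thus ?thesis unfolding fields by (simp add: f_def g_def)
  qed
  have p: "x ^ nat (k + D) = x powi k * x powi D" if "x \<noteq> 0" "\<bar>k\<bar> \<le> D" for x :: 'b and k
  proof -
    have "x ^ nat (k + D) = x powi (k + D)" using N[OF that(2)] by (simp add: power_int_def)
    thus ?thesis using that by (simp add: power_int_add)
  qed
  have m: "nat_mon x1 x2 x3 x4 x5 (f e) = int_mon x1 x2 x3 x4 x5 e * y" if "e \<in> S" for e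
  proof (cases e)
    case (fields k1 k2 k3 k4 k5)
    note D = D[OF that[unfolded fields]]
    show ?thesis unfolding fields f_def y_def
      by (simp only: prod.case nat_mon_simps int_mon.simps p[OF nz(1) D(1)] p[OF nz(2) D(2)]
          p[OF nz(3) D(3)] p[OF nz(4) D(4)] p[OF nz(5) D(5)] mult.assoc mult.commute mult.left_commute)
  qed
  have inj: "inj_on f S" using gf by (metis inj_onI)
  have "(\<Sum>e\<in>f ` S. of_rat (c (g e)) * nat_mon x1 x2 x3 x4 x5 e) =
        (\<Sum>e\<in>S. of_rat (c e) * int_mon x1 x2 x3 x4 x5 e) * y"
    by (subst sum.reindex[OF inj]) (auto simp: gf m sum_distrib_right mult.assoc intro!: sum.cong)
  also have "\<dots> = 0" by (simp only: 0 mult_zero_left)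
  finally have "c (g (f e)) = 0"
    using lin_indep_viaD[OF ind, of "f ` S" "\<lambda>e. c (g e)" "f e"] S e by auto
  thus "c e = 0" using gf e by simp
qed

lemma lin_indep_int_mon_gens:
  "lin_indep_via of_rat (int_mon sqrt_mab par_b sqrt_mcd par_d q_root)"
  by (rule lin_indep_int_mon[OF lin_indep_nat_mon_gens]) auto

abbreviation "gmon \<equiv> int_mon sqrt_mab par_b sqrt_mcd par_d q_root"

text \<open>Genericity of the ground field, for instance that \<open>q\<close> is not a root of
  unity or that \<open>abcd\<close> is not a power of \<open>q\<close>, is reduced to a comparison
  of exponents. The sign is due to \<open>a = - (\<surd>(-ab))^2 / b\<close>.\<close>

lemma gmon_eq_iff:
  assumes "s * s = 1" "gmon e = of_rat s * gmon e'"
  shows "e = e'"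
proof (rule ccontr)
  assume ne: "e \<noteq> e'"
  define c where "c = (\<lambda>x. if x = e then 1 else - s)"
  have "(\<Sum>x\<in>{e, e'}. of_rat (c x) * gmon x) = 0"
    using ne assms by (simp add: c_def of_rat_minus)
  hence "c e = 0" by (rule lin_indep_viaD[OF lin_indep_int_mon_gens, rotated]) auto
  thus False by (simp add: c_def)
qed

lemma lin_indep_star:
  "lin_indep_via of_rat (nat_mon (inverse sqrt_mab) (inverse par_b) (inverse sqrt_mcd)
     (inverse par_d) (inverse q_root))"
proof -
  define f :: "((((unit \<times> nat) \<times> nat) \<times> nat) \<times> nat) \<times> nat \<Rightarrow> int \<times> int \<times> int \<times> int \<times> int"
    where "f = (\<lambda>(((((_, k1), k2), k3), k4), k5). (-int k1, -int k2, -int k3, -int k4, -int k5))"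
  show ?thesis
  proof (rule lin_indep_via_reindex[OF lin_indep_int_mon_gens, where s = "\<lambda>_. 1" and f = f])
    show "inj f" by (auto simp: inj_on_def f_def split: prod.splits)
    show "nat_mon (inverse sqrt_mab) (inverse par_b) (inverse sqrt_mcd) (inverse par_d) (inverse q_root) e =
      of_rat 1 * gmon (f e)" for e
      by (cases e rule: nat_mon_cases) (simp add: f_def nat_mon_def power_int_minus power_inverse)
  qed (use field_homo_of_rat in \<open>auto simp: field_homo_def\<close>)
qed

lemma par_mon:
  "(par_a * q_root powi n1) ^ k1 * (par_b * q_root powi n2) ^ k2 * (par_c * q_root powi n3) ^ k3 *
     (par_d * q_root powi n4) ^ k4 * q_root ^ k5 =
   of_rat ((-1) ^ (k1 + k3)) * gmon (2 * int k1, int k2 - int k1, 2 * int k3, int k4 - int k3,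
     n1 * int k1 + n2 * int k2 + n3 * int k3 + n4 * int k4 + int k5)"
proof -
  have a: "par_a ^ k1 = (-1) ^ k1 * sqrt_mab powi (2 * int k1) * par_b powi (- int k1)" for k1
    unfolding par_a_def
    by (simp add: power_divide power_minus[of "sqrt_mab\<^sup>2 * inverse par_b"] power_mult_distrib power_inverse power_int_minus divide_inverse power_int_mult power_mult)
  have c: "par_c ^ k1 = (-1) ^ k1 * sqrt_mcd powi (2 * int k1) * par_d powi (- int k1)" for k1
    unfolding par_c_def
    by (simp add: power_divide power_minus[of "sqrt_mcd\<^sup>2 * inverse par_d"] power_mult_distrib power_inverse power_int_minus divide_inverse power_int_mult power_mult)
  have q: "(q_root powi n) ^ k = q_root powi (n * int k)" for n k
    by (simp add: power_int_mult)
  have r: "of_rat ((-1) ^ (k1 + k3)) = (-1) ^ k1 * ((-1) ^ k3 :: ratfun5)"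
    by (simp add: of_rat_power of_rat_minus power_add of_rat_mult)
  show ?thesis
    by (simp only: power_mult_distrib a c q r int_mon.simps)
       (simp add: power_int_add power_int_diff power_int_minus divide_inverse)
qed

text \<open>Substitution of shifted parameters is thus a field embedding. With all \<open>n\<close>
  zero the lemma shows that \<open>a\<close>, \<open>b\<close>, \<open>c\<close>, \<open>d\<close>,
  \<open>u\<close> are themselves independent, as the inverse in \<open>shift_params\<close>
  demands.\<close>

lemma lin_indep_par:
  "lin_indep_via of_rat (nat_mon (par_a * q_root powi n1) (par_b * q_root powi n2)
     (par_c * q_root powi n3) (par_d * q_root powi n4) q_root)"
proof -
  define f :: "((((unit \<times> nat) \<times> nat) \<times> nat) \<times> nat) \<times> nat \<Rightarrow> int \<times> int \<times> int \<times> int \<times> int"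
    where "f = (\<lambda>(((((_, k1), k2), k3), k4), k5).
      (2 * int k1, int k2 - int k1, 2 * int k3, int k4 - int k3,
       n1 * int k1 + n2 * int k2 + n3 * int k3 + n4 * int k4 + int k5))"
  define s :: "((((unit \<times> nat) \<times> nat) \<times> nat) \<times> nat) \<times> nat \<Rightarrow> rat"
    where "s = (\<lambda>(((((_, k1), k2), k3), k4), k5). (-1) ^ (k1 + k3))"
  show ?thesis
  proof (rule lin_indep_via_reindex[OF lin_indep_int_mon_gens, where s = s and f = f])
    show "inj f" by (auto simp: inj_on_def f_def split: prod.splits)
    show "s e * s e = 1" for e
      by (cases e rule: nat_mon_cases) (simp add: s_def flip: power_mult_distrib)
    show "nat_mon (par_a * q_root powi n1) (par_b * q_root powi n2) (par_c * q_root powi n3)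
       (par_d * q_root powi n4) q_root e = of_rat (s e) * gmon (f e)" for e
      by (cases e rule: nat_mon_cases) (simp only: nat_mon_simps prod.case par_mon s_def f_def)
  qed (use field_homo_of_rat in \<open>auto simp: field_homo_def\<close>)
qed

text \<open>The third and fourth generators also contribute to the power of \<open>fls_X\<close>,
  but their exponents remain visible in the coefficient, so the change of exponents is
  injective.\<close>

lemma lin_indep_embed:
  "lin_indep_via of_rat (nat_mon (fls_const coef_sab) (fls_const coef_b)
     (fls_const coef_scd * fls_X ^ N) (fls_const coef_d * fls_X ^ N) fls_X)"
proof -
  let ?m = "\<lambda>((((_::unit, k1), k2), k3), k4).
     coef_sab ^ k1 * coef_b ^ k2 * coef_scd ^ k3 * coef_d ^ k4"
  have h: "ring_homo (\<lambda>x. fls_const (of_rat x) :: ratfun4 fls)"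
    by unfold_locales (auto simp: of_rat_add of_rat_mult fls_plus_const fls_const_mult_const)
  have r: "of_rat x = (fls_const (of_rat x) :: ratfun4 fls)" for x
    using ring_homo_rat_unique[OF h] by metis
  have "lin_indep_via of_rat (\<lambda>(e, n::nat). fls_const (?m e) * fls_X ^ n)"
    unfolding lin_indep_via_def
  proof (intro allI impI ballI)
    fix S :: "(((((unit \<times> nat) \<times> nat) \<times> nat) \<times> nat) \<times> nat) set" and c e
    assume S: "finite S"
      and 0: "(\<Sum>e\<in>S. of_rat (c e) * (case e of (e, n) \<Rightarrow> fls_const (?m e) * fls_X ^ n)) = 0"
      and e: "e \<in> S"
    obtain e0 n where en: "e = (e0, n)" by fastforce
    let ?S = "{e. (e, n) \<in> S}"
    have fin: "finite ?S" by (rule finite_subset[of _ "fst ` S"]) (use S in force)+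
    have t: "of_rat (c e) * (case e of (e, n) \<Rightarrow> fls_const (?m e) * fls_X ^ n) =
        fls_const (of_rat (c e) * ?m (fst e)) * fls_X_intpow (int (snd e))" for e
      by (cases e) (simp add: r fls_X_power_conv_shift_1 fls_const_mult_const mult.assoc[symmetric])
    have "0 = fls_nth (\<Sum>e\<in>S. fls_const (of_rat (c e) * ?m (fst e)) * fls_X_intpow (int (snd e))) (int n)"
      using 0 unfolding t by simp
    also have "\<dots> = (\<Sum>e\<in>S. if snd e = n then of_rat (c e) * ?m (fst e) else 0)"
      unfolding fls_nth_sum by (rule sum.cong) (auto simp: fls_times_fps_to_fls)
    also have "\<dots> = (\<Sum>e\<in>{e\<in>S. snd e = n}. of_rat (c e) * ?m (fst e))"
      using S by (simp add: sum.inter_filter)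
    also have "{e\<in>S. snd e = n} = (\<lambda>e. (e, n)) ` ?S" by auto
    also have "(\<Sum>e\<in>(\<lambda>e. (e, n)) ` ?S. of_rat (c e) * ?m (fst e)) = (\<Sum>e\<in>?S. of_rat (c (e, n)) * ?m e)"
      by (subst sum.reindex) (auto simp: inj_on_def)
    finally show "c e = 0"
      using lin_indep_viaD[OF lin_indep_nat_mon4 fin, of "\<lambda>e. c (e, n)" e0] e en by auto
  qed
  note ind = this
  define f :: "((((unit \<times> nat) \<times> nat) \<times> nat) \<times> nat) \<times> nat \<Rightarrow> ((((unit \<times> nat) \<times> nat) \<times> nat) \<times> nat) \<times> nat"
    where "f = (\<lambda>(((((u, k1), k2), k3), k4), k5). (((((u, k1), k2), k3), k4), N * k3 + N * k4 + k5))"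
  show ?thesis
  proof (rule lin_indep_via_reindex[OF ind, where s = "\<lambda>_. 1" and f = f])
    show "inj f"
      by (auto simp: inj_on_def f_def split: prod.splits)
    have k: "fls_const (x ^ n) = fls_const (x::ratfun4) ^ n" for x n
      by (induction n) (auto simp flip: fls_const_mult_const)
    show "nat_mon (fls_const coef_sab) (fls_const coef_b)
     (fls_const coef_scd * fls_X ^ N) (fls_const coef_d * fls_X ^ N) fls_X e = of_rat 1 *
       (case f e of (e, n) \<Rightarrow> fls_const (?m e) * fls_X ^ n)" for e
      by (cases e rule: nat_mon_cases)
         (simp add: f_def nat_mon_def power_mult_distrib power_add power_mult k fls_const_mult_const[symmetric])
  qed (use field_homo_of_rat in \<open>auto simp: field_homo_def\<close>)
qed


section \<open>Laurent polynomials as rational functions\<close>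

text \<open>Counterparts of \<open>const_z\<close> and of the indeterminate over an arbitrary field,
  as the operator theory is developed for a generic \<open>r\<close> in such a field and specialised
  afterwards.\<close>

definition cz :: "'f::field \<Rightarrow> 'f poly fract" where "cz x = to_fract [:x:]"
definition zz :: "'f::field poly fract" where "zz = to_fract [:0, 1:]"

interpretation cz: field_homo "cz :: 'f::field \<Rightarrow> 'f poly fract"
  by unfold_locales (auto simp: cz_def one_pCons[symmetric] simp flip: to_fract_add to_fract_mult)

lemma zz_nonzero [simp]: "zz \<noteq> 0"
  by (simp add: zz_def)

lemma to_fract_pCons: "to_fract (pCons a p) = cz a + zz * to_fract p"
  by (simp add: cz_def zz_def flip: to_fract_add to_fract_mult)

lemma to_fract_monom: "to_fract (monom c n) = cz c * zz ^ n"
  by (simp add: monom_altdef cz_def zz_def to_fract_def[symmetric] flip: ring_homo.power[OF ring_homo_to_fract] to_fract_mult)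

text \<open>The way in which the rules for compositions of \<open>zscale\<close> and
  \<open>zinv\<close> are verified: only constants and \<open>zz\<close> have to be
  compared.\<close>

lemma field_homo_eqI:
  fixes \<phi> \<psi> :: "'f::field poly fract \<Rightarrow> 'g::field"
  assumes "field_homo \<phi>" "field_homo \<psi>"
    and c: "\<And>x. \<phi> (cz x) = \<psi> (cz x)" and z: "\<phi> zz = \<psi> zz"
  shows "\<phi> x = \<psi> x"
proof -
  interpret \<phi>: field_homo \<phi> by fact
  interpret \<psi>: field_homo \<psi> by fact
  have p: "\<phi> (to_fract p) = \<psi> (to_fract p)" for p
    by (induction p) (simp_all add: to_fract_pCons \<phi>.add \<phi>.mult \<psi>.add \<psi>.mult c z)
  show ?thesis
    by (cases x) (simp add: Fract_conv_to_fract \<phi>.divide \<psi>.divide p)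
qed

lemma powi_lin_indep:
  assumes A: "finite A" and 0: "(\<Sum>n\<in>A. cz (c n) * zz powi n) = 0" and n: "n \<in> A"
  shows "c n = 0"
proof -
  define D where "D = (\<Sum>k\<in>A. \<bar>k\<bar>)"
  have D: "0 \<le> k + D" if "k \<in> A" for k
  proof -
    have "\<bar>k\<bar> \<le> D" unfolding D_def by (rule member_le_sum) (use A that in auto)
    thus ?thesis by arith
  qed
  have p: "zz ^ nat (k + D) = zz powi k * zz powi D" if "k \<in> A" for k
  proof -
    have "zz ^ nat (k + D) = zz powi (k + D)" using D[OF that] by (simp add: power_int_def)
    thus ?thesis by (simp add: power_int_add)
  qed
  have "to_fract (\<Sum>k\<in>A. monom (c k) (nat (k + D))) = (\<Sum>k\<in>A. cz (c k) * zz powi k) * zz powi D"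
    unfolding ring_homo.sum[OF ring_homo_to_fract] sum_distrib_right
    by (rule sum.cong) (simp_all add: to_fract_monom p mult.assoc)
  also have "\<dots> = 0" using 0 by simp
  finally have "(\<Sum>k\<in>A. monom (c k) (nat (k + D))) = 0" unfolding to_fract_eq_0_iff .
  hence "0 = coeff (\<Sum>k\<in>A. monom (c k) (nat (k + D))) (nat (n + D))" by simp
  also have "\<dots> = (\<Sum>k\<in>A. if k = n then c k else 0)"
    unfolding coeff_sum coeff_monom using D n by (intro sum.cong) (auto simp: nat_eq_iff)
  also have "\<dots> = c n" using A n by simp
  finally show ?thesis by simp
qed

section \<open>Scaling and inversion of the variable\<close>

definition zscale :: "'f::field \<Rightarrow> 'f poly fract \<Rightarrow> 'f poly fract" where
  "zscale \<alpha> = fract_lift (\<lambda>p. to_fract (pcompose p [:0, \<alpha>:]))"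

text \<open>Substituting \<open>1/z\<close> leaves the polynomial ring, hence the lift takes values
  in the fraction field at once.\<close>

definition zinv :: "'f::field poly fract \<Rightarrow> 'f poly fract" where
  "zinv = fract_lift (poly_lift cz (inverse zz))"

lemma
  fixes \<alpha> :: "'f::field"
  assumes "\<alpha> \<noteq> 0"
  shows field_homo_zscale: "field_homo (zscale \<alpha>)"
    and zscale_cz: "zscale \<alpha> (cz x) = cz x"
    and zscale_zz: "zscale \<alpha> zz = cz \<alpha> * zz"
proof -
  have h: "ring_homo (\<lambda>p. to_fract (pcompose p [:0, \<alpha>:]))"
    by unfold_locales (auto simp: pcompose_add pcompose_mult pcompose_1)
  have nz: "to_fract (pcompose p [:0, \<alpha>:]) \<noteq> 0" if "p \<noteq> 0" for p
    using that pcompose_eq_0[of p "[:0, \<alpha>:]"] assms by auto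
  show "field_homo (zscale \<alpha>)"
    unfolding zscale_def by (rule field_homo_fract_lift[OF h nz])
  show "zscale \<alpha> (cz x) = cz x" "zscale \<alpha> zz = cz \<alpha> * zz"
    unfolding zscale_def cz_def zz_def
    by (subst fract_lift_to_fract[OF h nz]; simp add: pcompose_pCons flip: to_fract_mult)+
qed

lemma
  shows field_homo_zinv: "field_homo (zinv :: 'f::field poly fract \<Rightarrow> _)"
    and zinv_cz [simp]: "zinv (cz (x::'f)) = cz x"
    and zinv_zz [simp]: "zinv (zz :: 'f poly fract) = inverse zz"
proof -
  have h0: "ring_homo (cz :: 'f \<Rightarrow> _)" by unfold_locales
  note h = ring_homo_poly_lift[OF h0, of "inverse zz"]
  have nz: "poly_lift cz (inverse zz) p \<noteq> 0" if "p \<noteq> (0 :: 'f poly)" for p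
  proof
    assume "poly_lift cz (inverse zz) p = 0"
    hence 0: "(\<Sum>j | coeff p j \<noteq> 0. cz (coeff p j) * inverse zz ^ j) = 0"
      by (simp add: poly_lift_altdef[OF h0])
    have fin: "finite {j. coeff p j \<noteq> 0}"
      by (rule finite_subset[of _ "{..degree p}"]) (auto simp: le_degree)
    have "(\<Sum>n\<in>(\<lambda>j. - int j) ` {j. coeff p j \<noteq> 0}. cz (coeff p (nat (- n))) * zz powi n) = 0"
      using 0 by (subst sum.reindex) (auto simp: inj_on_def power_int_minus power_inverse)
    hence "coeff p (nat (- (- int (degree p)))) = 0"
      by (rule powi_lin_indep[rotated]) (use fin that in auto)
    thus False using that by simp
  qed
  show "field_homo (zinv :: 'f poly fract \<Rightarrow> _)"
    unfolding zinv_def by (rule field_homo_fract_lift[OF h nz])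
  show "zinv (cz x) = cz x" "zinv (zz :: 'f poly fract) = inverse zz"
    unfolding zinv_def unfolding cz_def[of x] zz_def
    by (subst fract_lift_to_fract[OF h[unfolded zz_def] nz[unfolded zz_def]];
        simp add: poly_lift_const[OF h0] poly_lift_X[OF h0] cz_def)+
qed

interpretation zinv: field_homo "zinv :: 'f::field poly fract \<Rightarrow> _"
  by (rule field_homo_zinv)

lemma field_homo_comp: "field_homo f \<Longrightarrow> field_homo g \<Longrightarrow> field_homo (\<lambda>x. f (g x))"
  by (simp add: field_homo_def ring_homo_def)

lemma field_homo_ident: "field_homo (\<lambda>x::'f::field. x)"
  by unfold_locales auto

lemma zinv_zinv [simp]: "zinv (zinv x) = x"
  by (rule field_homo_eqI[OF field_homo_comp[OF field_homo_zinv field_homo_zinv] field_homo_ident])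
     (simp_all add: zinv.inverse)

lemma zscale_1 [simp]: "zscale 1 x = x"
  by (rule field_homo_eqI[OF field_homo_zscale field_homo_ident]) (simp_all add: zscale_cz zscale_zz)

lemma zscale_zscale:
  assumes "\<alpha> \<noteq> 0" "\<beta> \<noteq> 0"
  shows "zscale \<alpha> (zscale \<beta> x) = zscale (\<alpha> * \<beta>) x"
proof (rule field_homo_eqI[OF field_homo_comp[OF field_homo_zscale field_homo_zscale] field_homo_zscale])
  interpret a: field_homo "zscale \<alpha>" by (rule field_homo_zscale) fact
  show "zscale \<alpha> (zscale \<beta> zz) = zscale (\<alpha> * \<beta>) zz"
    using assms by (simp add: zscale_zz zscale_cz a.mult cz.mult)
qed (use assms in \<open>simp_all add: zscale_cz\<close>)

lemma zinv_zscale: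
  assumes "\<alpha> \<noteq> 0"
  shows "zinv (zscale \<alpha> x) = zscale (inverse \<alpha>) (zinv x)"
proof (rule field_homo_eqI[OF field_homo_comp[OF field_homo_zinv field_homo_zscale]
                              field_homo_comp[OF field_homo_zscale field_homo_zinv]])
  interpret a: field_homo "zscale (inverse \<alpha>)" by (rule field_homo_zscale) (use assms in auto)
  show "zinv (zscale \<alpha> zz) = zscale (inverse \<alpha>) (zinv zz)"
    using assms by (simp add: zscale_zz zscale_cz zinv.mult a.inverse cz.inverse)
qed (use assms in \<open>simp_all add: zscale_cz\<close>)

definition lz :: "(int \<Rightarrow>\<^sub>0 'f::field) \<Rightarrow> 'f poly fract" where
  "lz f = (\<Sum>n\<in>Poly_Mapping.keys f. cz (Poly_Mapping.lookup f n) * zz powi n)"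

lemma lz_superset:
  assumes "finite A" "Poly_Mapping.keys f \<subseteq> A"
  shows "lz f = (\<Sum>n\<in>A. cz (Poly_Mapping.lookup f n) * zz powi n)"
  unfolding lz_def
  by (rule sum.mono_neutral_left) (use assms in \<open>auto simp: in_keys_iff\<close>)

lemma lz_single [simp]: "lz (Poly_Mapping.single n c) = cz c * zz powi n"
  by (subst lz_superset[of "{n}"]) (auto simp: lookup_single)

lemma lz_add: "lz (f + g) = lz f + lz g"
proof -
  let ?A = "Poly_Mapping.keys f \<union> Poly_Mapping.keys g"
  have "lz (f + g) = (\<Sum>n\<in>?A. cz (Poly_Mapping.lookup (f + g) n) * zz powi n)"
    by (rule lz_superset) (use keys_add[of f g] in auto)
  also have "\<dots> = lz f + lz g"
    by (subst (1 2) lz_superset[of ?A]) (auto simp: lookup_add cz.add distrib_right sum.distrib)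
  finally show ?thesis .
qed

lemma poly_mapping_sum_single:
  "(\<Sum>n\<in>Poly_Mapping.keys f. Poly_Mapping.single n (Poly_Mapping.lookup f n)) = f"
proof (rule poly_mapping_eqI)
  fix k
  have "(\<Sum>n\<in>Poly_Mapping.keys f. if n = k then Poly_Mapping.lookup f n else 0) = Poly_Mapping.lookup f k"
    by (simp add: in_keys_iff)
  thus "Poly_Mapping.lookup (\<Sum>n\<in>Poly_Mapping.keys f. Poly_Mapping.single n (Poly_Mapping.lookup f n)) k =
        Poly_Mapping.lookup f k"
    by (simp add: lookup_sum lookup_single when_def)
qed

lemma additive_sum:
  assumes "\<And>x y. F (x + y) = F x + (F y :: 'b::ab_group_add)"
  shows "F (sum f A) = (\<Sum>x\<in>A. F (f x))"
proof -
  have "F (0 + 0) = F 0 + F 0" by (rule assms)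
  hence "F 0 = 0" by simp
  thus ?thesis by (induction A rule: infinite_finite_induct) (auto simp: assms)
qed

lemma multiplicative_on_single:
  fixes F :: "('a::comm_monoid_add \<Rightarrow>\<^sub>0 'b::comm_ring_1) \<Rightarrow> 'c::comm_ring_1"
  assumes add: "\<And>x y. F (x + y) = F x + F y"
    and single: "\<And>m n x y. F (Poly_Mapping.single m x * Poly_Mapping.single n y) =
                   F (Poly_Mapping.single m x) * F (Poly_Mapping.single n y)"
  shows "F (f * g) = F f * F g"
proof -
  have "F (f * g) = F ((\<Sum>n\<in>Poly_Mapping.keys f. Poly_Mapping.single n (Poly_Mapping.lookup f n)) *
                       (\<Sum>n\<in>Poly_Mapping.keys g. Poly_Mapping.single n (Poly_Mapping.lookup g n)))"
    by (simp only: poly_mapping_sum_single)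
  also have "\<dots> = F (\<Sum>n\<in>Poly_Mapping.keys f. Poly_Mapping.single n (Poly_Mapping.lookup f n)) *
                  F (\<Sum>n\<in>Poly_Mapping.keys g. Poly_Mapping.single n (Poly_Mapping.lookup g n))"
    by (simp only: sum_product additive_sum[of F, OF add] single)
  finally show ?thesis by (simp only: poly_mapping_sum_single)
qed

interpretation lz: ring_homo "lz :: (int \<Rightarrow>\<^sub>0 'f::field) \<Rightarrow> _"
proof
  show "lz (f * g) = lz f * lz g" for f g :: "int \<Rightarrow>\<^sub>0 'f"
    by (rule multiplicative_on_single)
       (simp_all add: lz_add mult_single cz.mult power_int_add mult_ac)
  show "lz (1 :: int \<Rightarrow>\<^sub>0 'f) = 1"
    using lz_single[of 0 "1::'f"] by simp
qed (rule lz_add)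

lemma lz_eq_0_iff [simp]: "lz f = 0 \<longleftrightarrow> f = 0"
proof
  assume "lz f = 0"
  hence "Poly_Mapping.lookup f n = 0" if "n \<in> Poly_Mapping.keys f" for n
    unfolding lz_def by (rule powi_lin_indep[rotated]) (use that in auto)
  thus "f = 0" by (metis in_keys_iff lookup_zero poly_mapping_eqI)
qed auto

lemma lz_eq_iff [simp]: "lz f = lz g \<longleftrightarrow> f = g"
  using lz_eq_0_iff[of "f - g"] by (simp add: lz.diff)

lemma lookup_map_key_uminus [simp]:
  "Poly_Mapping.lookup (Poly_Mapping.map_key uminus f) (n::int) = Poly_Mapping.lookup f (- n)"
  by (simp add: map_key.rep_eq inj_on_def)

lemma zinv_lz: "zinv (lz f) = lz (Poly_Mapping.map_key uminus f)"
proof -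
  let ?A = "Poly_Mapping.keys f"
  have "lz (Poly_Mapping.map_key uminus f) = (\<Sum>n\<in>uminus ` ?A. cz (Poly_Mapping.lookup f (- n)) * zz powi n)"
    by (subst lz_superset[of "uminus ` ?A"]) (auto simp: in_keys_iff image_iff intro!: bexI[of _ "- _"])
  also have "\<dots> = (\<Sum>n\<in>?A. cz (Poly_Mapping.lookup f n) * zz powi (- n))"
    by (subst sum.reindex) (auto simp: inj_on_def)
  also have "\<dots> = zinv (lz f)"
    unfolding lz_def zinv.sum
    by (rule sum.cong) (simp_all add: zinv.mult zinv.powi power_int_minus power_int_inverse)
  finally show ?thesis ..
qed

lemma zscale_lz:
  assumes "\<alpha> \<noteq> 0"
  shows "zscale \<alpha> (lz f) = lz (Poly_Mapping.mapp (\<lambda>n x. x * \<alpha> powi n) f)"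
proof -
  interpret a: field_homo "zscale \<alpha>" by (rule field_homo_zscale) fact
  show ?thesis
    apply (subst lz_superset[of "Poly_Mapping.keys f" "Poly_Mapping.mapp (\<lambda>n x. x * \<alpha> powi n) f"])
      apply (simp_all add: keys_mapp_subset)
    unfolding lz_def a.sum
    by (rule sum.cong) (simp_all add: a.mult a.powi lookup_mapp zscale_cz[OF assms] zscale_zz[OF assms]
          cz.mult cz.powi power_int_mult_distrib mult_ac)
qed

definition symL :: "(int \<Rightarrow>\<^sub>0 'f::field) set" where
  "symL = {f. \<forall>n. Poly_Mapping.lookup f (- n) = Poly_Mapping.lookup f n}"

definition Laur :: "'f::field poly fract set" where "Laur = range lz"
definition Sym :: "'f::field poly fract set" where "Sym = {f \<in> Laur. zinv f = f}"

lemma lz_in_Sym_iff: "lz f \<in> Sym \<longleftrightarrow> f \<in> symL"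
  by (auto simp: Sym_def Laur_def zinv_lz symL_def poly_mapping_eq_iff fun_eq_iff)

lemma Sym_eq: "Sym = lz ` symL"
  using lz_in_Sym_iff by (auto simp: Sym_def Laur_def)

lemma Laur_closed [intro, simp]:
  fixes x y :: "'a::field poly fract"
  shows
  "x \<in> Laur \<Longrightarrow> y \<in> Laur \<Longrightarrow> x + y \<in> Laur"
  "x \<in> Laur \<Longrightarrow> y \<in> Laur \<Longrightarrow> x - y \<in> Laur"
  "x \<in> Laur \<Longrightarrow> y \<in> Laur \<Longrightarrow> x * y \<in> Laur"
  "cz (c::'a) \<in> Laur" "(zz::'a poly fract) powi n \<in> Laur" "x \<in> Laur \<Longrightarrow> zinv x \<in> Laur"
  "(1::'a poly fract) \<in> Laur" "(0::'a poly fract) \<in> Laur"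
  "x \<in> Laur \<Longrightarrow> \<alpha> \<noteq> 0 \<Longrightarrow> zscale \<alpha> x \<in> Laur" "(zz::'a poly fract) \<in> Laur"
  "inverse (zz::'a poly fract) \<in> Laur"
proof -
  show "x \<in> Laur \<Longrightarrow> y \<in> Laur \<Longrightarrow> x + y \<in> Laur"
    by (auto simp: Laur_def simp flip: lz.add)
  show "x \<in> Laur \<Longrightarrow> y \<in> Laur \<Longrightarrow> x - y \<in> Laur"
    by (auto simp: Laur_def simp flip: lz.diff)
  show "x \<in> Laur \<Longrightarrow> y \<in> Laur \<Longrightarrow> x * y \<in> Laur"
    by (auto simp: Laur_def simp flip: lz.mult)
  show c: "cz c \<in> Laur" for c :: 'a
    using rangeI[of lz "Poly_Mapping.single 0 c"] by (simp add: Laur_def)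
  show z: "zz powi n \<in> (Laur :: 'a poly fract set)" for n
    using rangeI[of lz "Poly_Mapping.single n (1::'a)"] by (simp add: Laur_def)
  show "x \<in> Laur \<Longrightarrow> zinv x \<in> Laur"
    by (auto simp: Laur_def zinv_lz)
  show "1 \<in> (Laur :: 'a poly fract set)" "0 \<in> (Laur :: 'a poly fract set)"
    using c[of 1] c[of 0] by simp_all
  show "x \<in> Laur \<Longrightarrow> \<alpha> \<noteq> 0 \<Longrightarrow> zscale \<alpha> x \<in> Laur"
    by (auto simp: Laur_def zscale_lz)
  show "zz \<in> (Laur :: 'a poly fract set)" "inverse zz \<in> (Laur :: 'a poly fract set)"
    using z[of 1] z[of "-1"] by (simp_all add: power_int_minus)
qed

lemma Laur_sum: "(\<And>x. x \<in> A \<Longrightarrow> f x \<in> Laur) \<Longrightarrow> sum f A \<in> Laur"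
  by (induction A rule: infinite_finite_induct) auto

lemma Laur_prod: "(\<And>x. x \<in> A \<Longrightarrow> f x \<in> Laur) \<Longrightarrow> prod f A \<in> Laur"
  by (induction A rule: infinite_finite_induct) auto

lemma zz_sq_neq_1: "zz * zz \<noteq> (1 :: 'f::field poly fract)"
proof
  assume "zz * zz = (1 :: 'f poly fract)"
  hence "to_fract ([:0, 1:] * [:0, 1:] :: 'f poly) = to_fract 1"
    by (simp add: zz_def flip: to_fract_mult)
  hence "([:0, 1:] * [:0, 1:] :: 'f poly) = 1" unfolding to_fract_eq_iff .
  thus False by (simp add: one_pCons)
qed

definition zdiff :: "'f::field poly fract" where "zdiff = zz - inverse zz"

lemma zdiff_nonzero [simp]: "zdiff \<noteq> 0"
  using zz_sq_neq_1 by (auto simp: zdiff_def field_simps)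

lemma zinv_zdiff [simp]: "zinv zdiff = - zdiff"
  by (simp add: zdiff_def zinv.diff zinv.inverse)

text \<open>Factorisation of \<open>x^n - y^n\<close> for \<open>x y = 1\<close>, whose cofactor is
  a Laurent polynomial; a negative \<open>n\<close> merely changes the sign.\<close>

lemma zdiff_powi: "(zz powi n - zz powi (- n)) / zdiff \<in> (Laur :: 'a::field poly fract set)"
proof -
  have nat: "(zz ^ n - inverse zz ^ n) / zdiff \<in> (Laur :: 'a poly fract set)" for n
  proof -
    have "zz ^ n - inverse zz ^ n = zdiff * (\<Sum>i<n. inverse zz ^ (n - Suc i) * zz ^ i :: 'a poly fract)"
      using power_diff_sumr2[of zz n "inverse zz :: 'a poly fract"] by (simp add: zdiff_def)
    moreover have "(\<Sum>i<n. inverse zz ^ (n - Suc i) * zz ^ i :: 'a poly fract) \<in> Laur"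
    proof (rule Laur_sum)
      fix i
      have "inverse zz ^ (n - Suc i) * zz ^ i = (zz powi (- int (n - Suc i)) * zz powi int i :: 'a poly fract)"
        by (simp add: power_int_minus power_inverse)
      also have "\<dots> \<in> Laur" by (intro Laur_closed)
      finally show "inverse zz ^ (n - Suc i) * zz ^ i \<in> (Laur :: 'a poly fract set)" .
    qed
    ultimately show ?thesis by simp
  qed
  show ?thesis
  proof (cases n)
    case (nonneg k)
    thus ?thesis using nat[of k] by (simp add: power_int_minus power_inverse)
  next
    case (neg k)
    have "(zz powi n - zz powi (- n)) / zdiff = 0 - ((zz ^ Suc k - inverse zz ^ Suc k) / zdiff :: 'a poly fract)"
      unfolding neg by (simp only: power_int_minus minus_minus power_int_of_nat power_inverse) (simp add: diff_divide_distrib)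
    also have "\<dots> \<in> Laur" using nat[of "Suc k"] by (intro Laur_closed)
    finally show ?thesis .
  qed
qed

text \<open>In characteristic zero \<open>f\<close> is half of \<open>f - zinv f\<close>, a
  combination of differences \<open>zz powi n - zz powi (- n)\<close>. This is why operators with
  denominator \<open>zdiff\<close> can preserve symmetric Laurent polynomials.\<close>

lemma antisym_div_zdiff:
  fixes f :: "'f::field_char_0 poly fract"
  assumes "f \<in> Laur" "zinv f = - f"
  shows "f / zdiff \<in> Sym"
proof -
  obtain g where g: "f = lz g" using assms by (auto simp: Laur_def)
  have 2: "cz (1 / 2) * (2 :: 'f poly fract) = 1"
    by (metis cz.mult cz.numeral cz.one divide_self mult.commute numeral_One times_divide_eq_right mult.right_neutral zero_neq_numeral)
  have "f = cz (1 / 2) * 2 * f" by (simp only: 2 mult_1)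
  also have "\<dots> = cz (1 / 2) * (f - zinv f)" using assms by simp
  also have "f - zinv f = (\<Sum>n\<in>Poly_Mapping.keys g. cz (Poly_Mapping.lookup g n) * (zz powi n - zz powi (- n)))"
    unfolding g lz_def zinv.sum sum_subtractf[symmetric]
    by (rule sum.cong) (simp_all add: zinv.mult zinv.powi power_int_minus power_int_inverse right_diff_distrib)
  finally have "f / zdiff = cz (1 / 2) * (\<Sum>n\<in>Poly_Mapping.keys g. cz (Poly_Mapping.lookup g n) * ((zz powi n - zz powi (- n)) / zdiff))"
    by (metis (no_types, lifting) sum.cong sum_divide_distrib times_divide_eq_right)
  also have "\<dots> \<in> Laur" by (intro Laur_closed Laur_sum zdiff_powi)
  finally show ?thesis using assms by (simp add: Sym_def zinv.divide)
qed

lemma Sym_closed [intro, simp]: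
  "x \<in> Sym \<Longrightarrow> y \<in> Sym \<Longrightarrow> x + y \<in> Sym"
  "x \<in> Sym \<Longrightarrow> y \<in> Sym \<Longrightarrow> x - y \<in> Sym"
  "x \<in> Sym \<Longrightarrow> y \<in> Sym \<Longrightarrow> x * y \<in> Sym"
  "cz c \<in> Sym" "0 \<in> Sym" "1 \<in> Sym"
  by (auto simp: Sym_def zinv.add zinv.diff zinv.mult)

section \<open>Degrees and triangular bases of symmetric Laurent polynomials\<close>

definition ldeg :: "(int \<Rightarrow>\<^sub>0 'f::field) \<Rightarrow> nat \<Rightarrow> bool" where
  "ldeg f n \<longleftrightarrow> f \<in> symL \<and> Poly_Mapping.lookup f (int n) \<noteq> 0 \<and> (\<forall>m>int n. Poly_Mapping.lookup f m = 0)"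

lemma lookup_single_mult:
  "Poly_Mapping.lookup (Poly_Mapping.single k c * f) (n::int) = c * Poly_Mapping.lookup f (n - k)"
proof -
  have "Poly_Mapping.single k c * f =
        (\<Sum>m\<in>Poly_Mapping.keys f. Poly_Mapping.single (k + m) (c * Poly_Mapping.lookup f m))"
    by (subst (1) poly_mapping_sum_single[of f, symmetric]) (simp only: sum_distrib_left mult_single)
  also have "Poly_Mapping.lookup \<dots> n = (\<Sum>m\<in>Poly_Mapping.keys f. if m = n - k then c * Poly_Mapping.lookup f m else 0)"
    unfolding lookup_sum lookup_single by (rule sum.cong) (auto simp: when_def)
  also have "\<dots> = c * Poly_Mapping.lookup f (n - k)" by (simp add: in_keys_iff)
  finally show ?thesis .
qed

lemma symL_closed [intro, simp]:
  "f \<in> symL \<Longrightarrow> g \<in> symL \<Longrightarrow> f + g \<in> symL" "f \<in> symL \<Longrightarrow> g \<in> symL \<Longrightarrow> f - g \<in> symL"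
  "f \<in> symL \<Longrightarrow> g \<in> symL \<Longrightarrow> f * g \<in> symL"
  "f \<in> symL \<Longrightarrow> Poly_Mapping.single 0 c * f \<in> symL" "0 \<in> symL" "1 \<in> symL"
  by (auto simp flip: lz_in_Sym_iff simp: lz.add lz.mult lz.diff)

lemma symL_sum: "(\<And>x. x \<in> A \<Longrightarrow> f x \<in> symL) \<Longrightarrow> sum f A \<in> symL"
  by (induction A rule: infinite_finite_induct) auto

lemma symL_bound:
  assumes "f \<in> symL"
  obtains n where "\<forall>m\<ge>int n. Poly_Mapping.lookup f m = 0"
proof -
  define n where "n = Suc (nat (Max (insert 0 (Poly_Mapping.keys f))))"
  have "Poly_Mapping.lookup f m = 0" if "m \<ge> int n" for m
  proof (rule ccontr)
    assume "Poly_Mapping.lookup f m \<noteq> 0"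
    hence "m \<le> Max (insert 0 (Poly_Mapping.keys f))" by (intro Max_ge) (auto simp: in_keys_iff)
    thus False using that by (simp add: n_def)
  qed
  thus ?thesis using that by blast
qed

text \<open>Elimination from the top degree; negative exponents follow by symmetry. The bound
  \<open>n\<close> is strict, so \<open>n = 0\<close> forces \<open>f = 0\<close>.\<close>

lemma symL_span:
  assumes p: "\<And>j. ldeg (p j) j" and "f \<in> symL" "\<forall>m\<ge>int n. Poly_Mapping.lookup f m = 0"
  shows "\<exists>c. f = (\<Sum>j<n. Poly_Mapping.single 0 (c j) * p j)"
  using assms(2,3)
proof (induction n arbitrary: f)
  case 0
  have "Poly_Mapping.lookup f m = 0" for m
  proof (cases "m \<ge> 0")
    case False
    hence "Poly_Mapping.lookup f (- m) = 0" using 0 by simp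
    thus ?thesis using 0(1) by (simp add: symL_def)
  qed (use 0 in simp)
  hence "f = 0" by (intro poly_mapping_eqI) simp
  thus ?case by simp
next
  case (Suc n)
  define x where "x = Poly_Mapping.lookup f (int n) / Poly_Mapping.lookup (p n) (int n)"
  define g where "g = f - Poly_Mapping.single 0 x * p n"
  have pn: "p n \<in> symL" "Poly_Mapping.lookup (p n) (int n) \<noteq> 0" "\<forall>m>int n. Poly_Mapping.lookup (p n) m = 0"
    using p[of n] by (auto simp: ldeg_def)
  have "g \<in> symL" using Suc.prems pn by (auto simp: g_def)
  moreover have "Poly_Mapping.lookup g m = 0" if "m \<ge> int n" for m
    using that Suc.prems(2) pn by (cases "m = int n") (auto simp: g_def lookup_minus lookup_single_mult x_def)
  ultimately obtain c where c: "g = (\<Sum>j<n. Poly_Mapping.single 0 (c j) * p j)" using Suc.IH by blast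
  have "f = (\<Sum>j<Suc n. Poly_Mapping.single 0 ((c(n := x)) j) * p j)"
    using c by (simp add: g_def algebra_simps)
  thus ?case by blast
qed

lemma symL_indep:
  assumes p: "\<And>j. ldeg (p j) j" and "(\<Sum>j<n. Poly_Mapping.single 0 (c j) * p j) = 0" "j < n"
  shows "c j = 0"
  using assms(2,3)
proof (induction n)
  case (Suc n)
  have z: "Poly_Mapping.lookup (p j) (int n) = 0" if "j < n" for j
    using p[of j] that by (auto simp: ldeg_def)
  have "0 = Poly_Mapping.lookup (\<Sum>j<Suc n. Poly_Mapping.single 0 (c j) * p j) (int n)"
    using Suc.prems by simp
  also have "\<dots> = c n * Poly_Mapping.lookup (p n) (int n)"
    by (simp add: lookup_add lookup_sum lookup_single_mult z)
  finally have n: "c n = 0" using p[of n] by (simp add: ldeg_def)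
  with Suc show ?case by (cases "j = n") auto
qed simp


section \<open>The Askey--Wilson operator\<close>

definition klin :: "('f::field poly fract \<Rightarrow> 'f poly fract) \<Rightarrow> bool" where
  "klin F \<longleftrightarrow> (\<forall>x y. F (x + y) = F x + F y) \<and> (\<forall>c x. F (cz c * x) = cz c * F x)"

lemma klin_add: "klin F \<Longrightarrow> F (x + y) = F x + F y"
  and klin_scale: "klin F \<Longrightarrow> F (cz c * x) = cz c * F x"
  by (simp_all add: klin_def)

lemma klin_0 [simp]: "klin F \<Longrightarrow> F 0 = 0"
  using klin_scale[of F 0 0] by simp

lemma klin_diff: "klin F \<Longrightarrow> F (x - y) = F x - F y"
  using klin_add[of F "x - y" y] by simp

lemma klin_sum: "klin F \<Longrightarrow> F (sum f A) = (\<Sum>x\<in>A. F (f x))"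
  by (induction A rule: infinite_finite_induct) (auto simp: klin_add)

lemma klin_comp: "klin F \<Longrightarrow> klin G \<Longrightarrow> klin (\<lambda>x. F (G x))"
  by (simp add: klin_def)

lemma klin_cmult: "klin F \<Longrightarrow> klin (\<lambda>x. cz c * F x)"
  by (simp add: klin_def algebra_simps)

lemma klin_plus: "klin F \<Longrightarrow> klin G \<Longrightarrow> klin (\<lambda>x. F x + G x)"
  by (simp add: klin_def algebra_simps)

lemma klin_ident: "klin (\<lambda>x. x)"
  by (simp add: klin_def)

lemma klin_zscale: "\<alpha> \<noteq> 0 \<Longrightarrow> klin (zscale \<alpha>)"
proof -
  assume a: "\<alpha> \<noteq> 0"
  then interpret field_homo "zscale \<alpha>" by (rule field_homo_zscale)
  show ?thesis using a by (simp add: klin_def add mult zscale_cz)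
qed

text \<open>Common shape of the elementary operators. For symmetric \<open>f\<close> the second term
  is the reflection of the first, whence the numerator is antisymmetric.\<close>

definition Dop :: "'f::field \<Rightarrow> 'f poly fract \<Rightarrow> 'f poly fract \<Rightarrow> 'f poly fract" where
  "Dop r M f = (M * zscale r f - zinv M * zscale (inverse r) f) / zdiff"

lemma klin_Dop: "r \<noteq> 0 \<Longrightarrow> klin (Dop r M)"
  using klin_zscale[of r] klin_zscale[of "inverse r"]
  by (simp add: klin_def Dop_def field_simps)

lemma Dop_Sym:
  fixes r :: "'f::field_char_0"
  assumes "r \<noteq> 0" "M \<in> Laur" "f \<in> Sym"
  shows "Dop r M f \<in> Sym"
proof -
  have f: "f \<in> Laur" "zinv f = f" using assms by (auto simp: Sym_def)
  show ?thesis unfolding Dop_def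
    by (rule antisym_div_zdiff)
       (use assms f in \<open>auto simp: zinv.diff zinv.mult zinv_zscale inverse_inverse_eq\<close>)
qed

text \<open>Up to normalisation the Askey--Wilson divided difference operator: it lowers the degree
  and multiplies all four parameters by \<open>r\<close>. \<open>Sminus\<close> goes in the opposite
  direction, and \<open>Eop\<close> moves a factor \<open>r\<close> from the pair \<open>a\<close>,
  \<open>b\<close> to the pair \<open>c\<close>, \<open>d\<close>.\<close>

definition Splus :: "'f::field \<Rightarrow> 'f poly fract \<Rightarrow> 'f poly fract" where
  "Splus r = Dop r 1"

definition Sminus :: "'f::field \<Rightarrow> 'f \<Rightarrow> 'f \<Rightarrow> 'f \<Rightarrow> 'f \<Rightarrow> 'f poly fract \<Rightarrow> 'f poly fract" where
  "Sminus r a b c d = Dop r ((1 - cz a * zz) * (1 - cz b * zz) * (1 - cz c * zz) * (1 - cz d * zz) *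
     (inverse zz * inverse zz))"

definition Eop :: "'f::field \<Rightarrow> 'f \<Rightarrow> 'f \<Rightarrow> 'f poly fract \<Rightarrow> 'f poly fract" where
  "Eop r a b = Dop r ((1 - cz a * zz) * (1 - cz b * zz) * inverse zz)"

text \<open>
  The second order \<open>q\<close>-difference operator of Askey and Wilson.  In this factored form its commutation
  with \<^term>\<open>Splus\<close> and \<^term>\<open>Sminus\<close> is computed on the triangular basis of the products
  \<open>(az, a/z; q)\<^sub>k\<close>, denoted \<open>ebas\<close> below.
\<close>

definition Lop :: "'f::field \<Rightarrow> 'f \<Rightarrow> 'f \<Rightarrow> 'f \<Rightarrow> 'f \<Rightarrow> 'f poly fract \<Rightarrow> 'f poly fract" where
  "Lop r a b c d f = cz (inverse r) * Sminus r a b c d (Splus r f) + cz (1 + a * b * c * d / r ^ 2) * f"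

definition ebas :: "'f::field \<Rightarrow> 'f \<Rightarrow> nat \<Rightarrow> 'f poly fract" where
  "ebas r a k = (\<Prod>j<k. (1 - cz (a * r ^ (2 * j)) * zz) * (1 - cz (a * r ^ (2 * j)) * inverse zz))"

text \<open>With \<open>q = r^2\<close> and \<open>X = abcd\<close> this is the Askey--Wilson
  eigenvalue \<open>q^(-n) + abcd q^(n-1)\<close>. The index is an integer because a shift may lower
  a degree below zero.\<close>

definition lam :: "'f::field \<Rightarrow> 'f \<Rightarrow> int \<Rightarrow> 'f" where
  "lam r X n = r powi (- 2 * n) + X * r powi (2 * n - 2)"

text \<open>Off-diagonal entry of \<open>Lop\<close> in the basis \<open>ebas\<close>, leading from
  index \<open>k + 1\<close> to \<open>k\<close>.\<close>

definition mu :: "'f::field \<Rightarrow> 'f \<Rightarrow> 'f \<Rightarrow> 'f \<Rightarrow> 'f \<Rightarrow> nat \<Rightarrow> 'f" where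
  "mu r a b c d k = - (inverse (r ^ (2 * Suc k)) - 1) *
     (1 - a * b * r ^ (2 * k)) * (1 - a * c * r ^ (2 * k)) * (1 - a * d * r ^ (2 * k))"

lemma ebas_Suc: "ebas r a (Suc k) =
    ebas r a k * ((1 - cz (a * r ^ (2 * k)) * zz) * (1 - cz (a * r ^ (2 * k)) * inverse zz))"
  by (simp add: ebas_def)

lemma ebas_0 [simp]: "ebas r a 0 = 1"
  by (simp add: ebas_def)

lemma zinv_ebas [simp]: "zinv (ebas r a k) = ebas r a k"
  by (simp add: ebas_def zinv.prod zinv.mult zinv.diff zinv.inverse mult.commute)

lemma ebas_Laur: "ebas r a k \<in> Laur"
  unfolding ebas_def by (intro Laur_prod Laur_closed)

lemma ebas_Sym: "ebas r a k \<in> Sym"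
  by (simp add: Sym_def ebas_Laur)

definition le :: "'f::field \<Rightarrow> 'f \<Rightarrow> nat \<Rightarrow> (int \<Rightarrow>\<^sub>0 'f)" where
  "le r a k = (\<Prod>j<k. (1 - Poly_Mapping.single 1 (a * r ^ (2 * j))) * (1 - Poly_Mapping.single (-1) (a * r ^ (2 * j))))"

lemma lz_le: "lz (le r a k) = ebas r a k"
  by (simp add: le_def ebas_def lz.prod lz.mult lz.diff power_int_minus)

lemma ldeg_le:
  assumes "a \<noteq> 0" "r \<noteq> 0"
  shows "ldeg (le r a k) k"
proof (induction k)
  case 0
  show ?case by (auto simp: ldeg_def le_def lookup_one when_def)
next
  case (Suc k)
  define x where "x = a * r ^ (2 * k)"
  have x: "x \<noteq> 0" using assms by (simp add: x_def)
  have eq: "le r a (Suc k) = Poly_Mapping.single 0 (1 + x ^ 2) * le r a k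
      - Poly_Mapping.single 1 x * le r a k - Poly_Mapping.single (-1) x * le r a k"
  proof -
    have "(1 - Poly_Mapping.single 1 x) * (1 - Poly_Mapping.single (-1) x) =
        Poly_Mapping.single (0::int) (1 + x ^ 2) - Poly_Mapping.single 1 x - Poly_Mapping.single (-1) x"
      by (simp add: algebra_simps mult_single single_add power2_eq_square)
    moreover have "le r a (Suc k) = (1 - Poly_Mapping.single 1 x) * (1 - Poly_Mapping.single (-1) x) * le r a k"
      by (simp only: le_def x_def prod.lessThan_Suc mult_ac)
    ultimately show ?thesis by (simp only: left_diff_distrib)
  qed
  have "lz (le r a (Suc k)) \<in> Sym" by (simp add: lz_le ebas_Sym)
  hence "le r a (Suc k) \<in> symL" by (simp add: lz_in_Sym_iff)
  thus ?case using Suc x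
    by (auto simp: ldeg_def eq lookup_minus lookup_single_mult)
qed

lemma Sym_span_ebas:
  assumes "a \<noteq> 0" "r \<noteq> 0" "f \<in> Sym"
  obtains n c where "f = (\<Sum>j<n. cz (c j) * ebas r a j)"
proof -
  obtain g where g: "f = lz g" "g \<in> symL" using assms(3) by (auto simp: Sym_eq)
  obtain n where "\<forall>m\<ge>int n. Poly_Mapping.lookup g m = 0" by (rule symL_bound[OF g(2)])
  then obtain c where c: "g = (\<Sum>j<n. Poly_Mapping.single 0 (c j) * le r a j)"
    using symL_span[of "le r a" g n] ldeg_le assms g by blast
  show ?thesis
    by (rule that) (simp add: g(1) c lz.sum lz.mult lz_le)
qed

text \<open>Reduces every operator identity on symmetric Laurent polynomials to the basis
  \<open>ebas\<close>, on which all the operators are at most bidiagonal.\<close>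

lemma klin_eq_on_Sym:
  assumes "a \<noteq> 0" "r \<noteq> 0" "klin F" "klin G" "\<And>k. F (ebas r a k) = G (ebas r a k)" "f \<in> Sym"
  shows "F f = G f"
proof -
  obtain n c where "f = (\<Sum>j<n. cz (c j) * ebas r a j)" by (rule Sym_span_ebas[OF assms(1,2,6)])
  thus ?thesis using assms by (simp add: klin_sum klin_scale)
qed

text \<open>This identity and the next two are what remains of the action on a basis element once
  the common product is split off. Here \<open>w\<close> is \<open>1/z\<close>, \<open>R'\<close> is
  the inverse of \<open>R\<close>, and \<open>Q\<close> will be \<open>r ^ (2 * k)\<close>.\<close>

lemma Splus_identity:
  fixes z :: "'a::field"
  assumes "z * w = 1" "R * R' = 1"
  shows "(1 - A * R * Q * z) * (1 - A * R' * w) - (1 - A * R * Q * w) * (1 - A * R' * z) =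
         A * R' * (1 - R * R * Q) * (z - w)"
proof -
  have w: "w = inverse z" "z \<noteq> 0" and R: "R' = inverse R" "R \<noteq> 0"
    using assms by (metis inverse_unique mult_zero_left zero_neq_one)+
  show ?thesis using w(2) R(2) unfolding w R by (simp add: field_simps)
qed

lemma Eop_identity:
  fixes z :: "'a::field"
  assumes "z * w = 1"
  shows "(1 - B * z) * w * ((1 - A * Q * z) * E) - (1 - B * w) * z * ((1 - A * Q * w) * E) =
      (A * B * Q - 1) * E * (z - w)"
proof -
  have w: "w = inverse z" "z \<noteq> 0"
    using assms by (metis inverse_unique mult_zero_left zero_neq_one)+
  show ?thesis using w(2) unfolding w by (simp add: field_simps)
qed

lemma Sminus_identity:
  fixes z :: "'a::field"
  assumes "z * w = 1"
  shows "A * ((1 - B * z) * (1 - C * z) * (1 - D * z) * (w * w) * (1 - A * z) -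
      (1 - B * w) * (1 - C * w) * (1 - D * w) * (z * z) * (1 - A * w)) =
      ((1 - A * B * C * D) * ((1 - A * z) * (1 - A * w)) - (1 - A * B) * (1 - A * C) * (1 - A * D)) * (z - w)"
proof -
  have w: "w = inverse z" "z \<noteq> 0"
    using assms by (metis inverse_unique mult_zero_left zero_neq_one)+
  show ?thesis using w(2) unfolding w by (simp add: field_simps)
qed

text \<open>\<open>r\<close> plays the part of the square root of \<open>q\<close> and is not a root
  of unity. It will be instantiated with \<open>q_root ^ N\<close>.\<close>

locale q_shift =
  fixes r :: "'f::field_char_0"
  assumes r_nz [simp]: "r \<noteq> 0" and r_powi: "\<And>n::int. r powi n = 1 \<Longrightarrow> n = 0"
begin

interpretation up: field_homo "zscale r" by (rule field_homo_zscale) simp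
interpretation dn: field_homo "zscale (inverse r)" by (rule field_homo_zscale) simp

lemma up_zz [simp]: "zscale r zz = cz r * zz" and up_cz [simp]: "zscale r (cz x) = cz x"
  by (simp_all add: zscale_zz zscale_cz)

lemma zscale_inverse_Sym: "zinv f = f \<Longrightarrow> zscale (inverse r) f = zinv (zscale r f)"
  by (simp add: zinv_zscale)

lemma r_pow_neq_1: "k > 0 \<Longrightarrow> r ^ k \<noteq> 1"
  using r_powi[of "int k"] by auto

lemma klin_Splus: "klin (Splus r)" and klin_Sminus: "klin (Sminus r a b c d)" and klin_Eop: "klin (Eop r a b)"
  by (simp_all add: Splus_def Sminus_def Eop_def klin_Dop)

lemma klin_Lop: "klin (Lop r a b c d)"
  unfolding Lop_def by (intro klin_plus klin_cmult klin_comp[OF klin_Sminus klin_Splus] klin_ident)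

lemma Splus_Sym: "f \<in> Sym \<Longrightarrow> Splus r f \<in> Sym"
  and Sminus_Sym: "f \<in> Sym \<Longrightarrow> Sminus r a b c d f \<in> Sym"
  and Eop_Sym: "f \<in> Sym \<Longrightarrow> Eop r a b f \<in> Sym"
  unfolding Splus_def Sminus_def Eop_def by (intro Dop_Sym Laur_closed; simp)+

lemma Lop_Sym: "f \<in> Sym \<Longrightarrow> Lop r a b c d f \<in> Sym"
  unfolding Lop_def by (intro Sym_closed Splus_Sym Sminus_Sym)

lemma up_factor:
  "zscale r (1 - cz x * zz) = 1 - cz (x * r) * zz"
  "zscale r (1 - cz x * inverse zz) = 1 - cz (x / r) * inverse zz"
  by (simp_all add: up.diff up.mult up.inverse cz.mult cz.divide cz.inverse divide_inverse mult_ac)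

text \<open>Scaling by \<open>r\<close> turns the factors at \<open>a q^j\<close> into a factor in
  \<open>z\<close> at \<open>a r q^j\<close> and one in \<open>1/z\<close> at
  \<open>a r q^(j-1)\<close>. Regrouping to \<open>ebas r (a * r) k\<close> leaves the last of the
  former and the first of the latter.\<close>

lemma up_ebas_Suc:
  "zscale r (ebas r a (Suc k)) =
     ebas r (a * r) k * ((1 - cz (a * r * r ^ (2 * k)) * zz) * (1 - cz (a / r) * inverse zz))"
proof (induction k)
  case 0
  show ?case
    by (simp add: ebas_Suc up.mult up.diff up.inverse cz.mult cz.divide divide_inverse cz.inverse mult_ac)
next
  case (Suc k)
  have "zscale r (ebas r a (Suc (Suc k))) = zscale r (ebas r a (Suc k)) *
     ((1 - cz (a * r * r ^ (2 * Suc k)) * zz) * (1 - cz (a * r * r ^ (2 * k)) * inverse zz))"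
  proof -
    have 1: "a * r ^ (2 * Suc k) * r = a * r * r ^ (2 * Suc k)" "a * r ^ (2 * Suc k) / r = a * r * r ^ (2 * k)"
      by simp_all
    show ?thesis by (simp only: ebas_Suc[of _ _ "Suc k"] up.mult up_factor 1)
  qed
  thus ?case unfolding Suc by (simp only: ebas_Suc[of r "a * r" k] mult_ac)
qed

text \<open>The opposite regrouping: the factor \<open>1 - az\<close> is the missing partner of
  \<open>1 - a/z\<close>, and the factor with \<open>z\<close> at \<open>a q^k\<close> is the
  surplus.\<close>

lemma up_ebas:
  "(1 - cz a * zz) * zscale r (ebas r (a * r) k) = (1 - cz (a * r ^ (2 * k)) * zz) * ebas r a k"
proof (induction k)
  case (Suc k)
  have "zscale r (ebas r (a * r) (Suc k)) = zscale r (ebas r (a * r) k) *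
     ((1 - cz (a * r ^ (2 * Suc k)) * zz) * (1 - cz (a * r ^ (2 * k)) * inverse zz))"
  proof -
    have 1: "a * r * r ^ (2 * k) * r = a * r ^ (2 * Suc k)" "a * r * r ^ (2 * k) / r = a * r ^ (2 * k)"
      by simp_all
    show ?thesis by (simp only: ebas_Suc up.mult up_factor 1)
  qed
  hence "(1 - cz a * zz) * zscale r (ebas r (a * r) (Suc k)) =
     ((1 - cz a * zz) * zscale r (ebas r (a * r) k)) *
     ((1 - cz (a * r ^ (2 * Suc k)) * zz) * (1 - cz (a * r ^ (2 * k)) * inverse zz))"
    by (simp only: mult.assoc)
  also have "\<dots> = (1 - cz (a * r ^ (2 * Suc k)) * zz) * ebas r a (Suc k)"
    unfolding Suc ebas_Suc[of _ a k] by (simp only: mult_ac)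
  finally show ?case .
qed (simp)

lemma Splus_1 [simp]: "Splus r 1 = 0"
  by (simp add: Splus_def Dop_def)

lemma Dop_alt: "zinv f = f \<Longrightarrow> Dop r M f = (M * zscale r f - zinv (M * zscale r f)) / zdiff"
  by (simp add: Dop_def zinv.mult zscale_inverse_Sym)

lemma Splus_ebas:
  "Splus r (ebas r a (Suc k)) = cz (a / r * (1 - r ^ (2 * Suc k))) * ebas r (a * r) k"
proof -
  define w where "w = inverse (zz :: 'f poly fract)"
  have zd: "zz - w = zdiff" by (simp add: w_def zdiff_def)
  define A Q R R' where AQ: "A = cz a" "Q = cz (r ^ (2 * k))" "R = cz r" "R' = cz (inverse r)"
  have rel: "zz * w = 1" "R * R' = 1"
    unfolding w_def AQ by (simp_all flip: cz.mult)
  have 1: "cz (a * r * r ^ (2 * k)) = A * R * Q" "cz (a / r) = A * R'"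
    "cz (a / r * (1 - r ^ (2 * Suc k))) = A * R' * (1 - R * R * Q)"
    by (simp_all add: AQ cz.mult cz.diff divide_inverse mult_ac)
  have "(1 - A * R * Q * zz) * (1 - A * R' * w) - (1 - A * R * Q * w) * (1 - A * R' * zz) =
        A * R' * (1 - R * R * Q) * (zz - w)"
    using rel by (rule Splus_identity)
  note 2 = this
  have zi: "zinv zz = w" "zinv w = zz" "zinv A = A" "zinv Q = Q" "zinv R = R" "zinv R' = R'"
    by (simp_all add: w_def AQ zinv.inverse)
  let ?E = "ebas r (a * r) k"
  have "Splus r (ebas r a (Suc k)) =
     (?E * ((1 - A * R * Q * zz) * (1 - A * R' * w)) - ?E * ((1 - A * R * Q * w) * (1 - A * R' * zz))) / zdiff"
    unfolding Splus_def Dop_alt[OF zinv_ebas] up_ebas_Suc 1 mult_1 w_def[symmetric]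
    by (simp only: zinv.mult zinv.diff zinv.one zi zinv_ebas)
  also have "\<dots> = A * R' * (1 - R * R * Q) * ?E"
    unfolding right_diff_distrib[symmetric] 2 zd by simp
  finally show ?thesis unfolding 1 .
qed

lemma Eop_ebas:
  "Eop r a b (ebas r (a * r) k) = cz (a * b * r ^ (2 * k) - 1) * ebas r a k"
proof -
  define w where "w = inverse (zz :: 'f poly fract)"
  have zd: "zz - w = zdiff" by (simp add: w_def zdiff_def)
  define A B Q where AQ: "A = cz a" "B = cz b" "Q = cz (r ^ (2 * k))"
  have zw: "zz * w = 1" by (simp add: w_def)
  have zi: "zinv zz = w" "zinv w = zz" "zinv A = A" "zinv B = B" "zinv Q = Q"
    by (simp_all add: w_def AQ zinv.inverse)
  let ?E = "ebas r a k"
  have "(1 - A * zz) * (1 - B * zz) * w * zscale r (ebas r (a * r) k) =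
        (1 - B * zz) * w * ((1 - cz a * zz) * zscale r (ebas r (a * r) k))"
    by (simp add: AQ mult_ac)
  also have "\<dots> = (1 - B * zz) * w * ((1 - A * Q * zz) * ?E)"
    unfolding up_ebas AQ by (simp only: cz.mult)
  finally have 1: "(1 - A * zz) * (1 - B * zz) * w * zscale r (ebas r (a * r) k) = \<dots>" .
  have 2: "(1 - B * zz) * w * ((1 - A * Q * zz) * ?E) - (1 - B * w) * zz * ((1 - A * Q * w) * ?E) =
      (A * B * Q - 1) * ?E * (zz - w)"
    by (rule Eop_identity[OF zw])
  have "Eop r a b (ebas r (a * r) k) = ((1 - B * zz) * w * ((1 - A * Q * zz) * ?E) -
      (1 - B * w) * zz * ((1 - A * Q * w) * ?E)) / zdiff"
    unfolding Eop_def w_def[symmetric] AQ(1,2)[symmetric] Dop_alt[OF zinv_ebas] 1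
    by (simp only: zinv.mult zinv.diff zinv.one zi zinv_ebas)
  also have "\<dots> = (A * B * Q - 1) * ?E"
    unfolding 2 zd by simp
  finally show ?thesis by (simp add: AQ cz.mult cz.diff)
qed

text \<open>Beside the common product there remains a symmetric factor, which is written in terms of
  \<open>1\<close> and \<open>(1 - \<alpha> z) (1 - \<alpha>/z)\<close>; the latter extends
  \<open>ebas r a k\<close> to index \<open>k + 1\<close>.\<close>

lemma Sminus_ebas:
  fixes k :: nat
  assumes "a \<noteq> 0"
  defines "\<alpha> \<equiv> a * r ^ (2 * k)"
  shows "Sminus r a b c d (ebas r (a * r) k) = cz ((1 - \<alpha> * b * c * d) / \<alpha>) * ebas r a (Suc k)
     - cz ((1 - \<alpha> * b) * (1 - \<alpha> * c) * (1 - \<alpha> * d) / \<alpha>) * ebas r a k"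
proof -
  define w where "w = inverse (zz :: 'f poly fract)"
  have zd: "zz - w = zdiff" by (simp add: w_def zdiff_def)
  define A B C D where AQ: "A = cz \<alpha>" "B = cz b" "C = cz c" "D = cz d"
  have A0: "A \<noteq> 0" using assms by (simp add: AQ \<alpha>_def)
  have zw: "zz * w = 1" by (simp add: w_def)
  have zi: "zinv zz = w" "zinv w = zz" "zinv A = A" "zinv B = B" "zinv C = C" "zinv D = D"
    by (simp_all add: w_def AQ zinv.inverse)
  define E where "E = ebas r a k"
  have "(1 - cz a * zz) * (1 - B * zz) * (1 - C * zz) * (1 - D * zz) * (w * w) * zscale r (ebas r (a * r) k) =
        (1 - B * zz) * (1 - C * zz) * (1 - D * zz) * (w * w) * ((1 - cz a * zz) * zscale r (ebas r (a * r) k))"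
    by (simp only: mult_ac)
  also have "\<dots> = (1 - B * zz) * (1 - C * zz) * (1 - D * zz) * (w * w) * ((1 - A * zz) * E)"
    unfolding up_ebas AQ \<alpha>_def E_def ..
  finally have 1: "(1 - cz a * zz) * (1 - B * zz) * (1 - C * zz) * (1 - D * zz) * (w * w) * zscale r (ebas r (a * r) k) = \<dots>" .
  have 2: "A * ((1 - B * zz) * (1 - C * zz) * (1 - D * zz) * (w * w) * (1 - A * zz) -
      (1 - B * w) * (1 - C * w) * (1 - D * w) * (zz * zz) * (1 - A * w)) =
      ((1 - A * B * C * D) * ((1 - A * zz) * (1 - A * w)) - (1 - A * B) * (1 - A * C) * (1 - A * D)) * (zz - w)"
    by (rule Sminus_identity[OF zw])
  have num: "Sminus r a b c d (ebas r (a * r) k) =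
     ((1 - B * zz) * (1 - C * zz) * (1 - D * zz) * (w * w) * ((1 - A * zz) * E) -
      (1 - B * w) * (1 - C * w) * (1 - D * w) * (zz * zz) * ((1 - A * w) * E)) / (zz - w)"
    unfolding Sminus_def w_def[symmetric] AQ(2,3,4)[symmetric] Dop_alt[OF zinv_ebas] 1 zd
    by (simp only: zinv.mult zinv.diff zinv.one zi zinv_ebas E_def)
  have distr: "(x - y) * t * E = (x * E - y * E) * t" for x y t
    by (simp add: algebra_simps)
  from num have "Sminus r a b c d (ebas r (a * r) k) * zdiff =
     ((1 - B * zz) * (1 - C * zz) * (1 - D * zz) * (w * w) * ((1 - A * zz) * E) -
      (1 - B * w) * (1 - C * w) * (1 - D * w) * (zz * zz) * ((1 - A * w) * E))"
    unfolding zd by simp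
  hence "A * Sminus r a b c d (ebas r (a * r) k) * (zz - w) =
     A * ((1 - B * zz) * (1 - C * zz) * (1 - D * zz) * (w * w) * (1 - A * zz) -
      (1 - B * w) * (1 - C * w) * (1 - D * w) * (zz * zz) * (1 - A * w)) * E"
    unfolding zd mult.assoc[of A] by (simp only: mult.assoc left_diff_distrib)
  also have "\<dots> = ((1 - A * B * C * D) * ((1 - A * zz) * (1 - A * w)) * E - (1 - A * B) * (1 - A * C) * (1 - A * D) * E) * (zz - w)"
    unfolding 2 by (rule distr)
  also have "(1 - A * zz) * (1 - A * w) = (1 - cz (a * r ^ (2 * k)) * zz) * (1 - cz (a * r ^ (2 * k)) * inverse zz)"
    by (simp add: AQ \<alpha>_def w_def)
  finally have "A * Sminus r a b c d (ebas r (a * r) k) =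
      (1 - A * B * C * D) * ebas r a (Suc k) - (1 - A * B) * (1 - A * C) * (1 - A * D) * E"
    unfolding zd by (simp add: ebas_Suc E_def mult_ac)
  hence "A * Sminus r a b c d (ebas r (a * r) k) / A =
      ((1 - A * B * C * D) * ebas r a (Suc k) - (1 - A * B) * (1 - A * C) * (1 - A * D) * E) / A"
    by (rule arg_cong)
  hence "Sminus r a b c d (ebas r (a * r) k) =
      (1 - A * B * C * D) / A * ebas r a (Suc k) - (1 - A * B) * (1 - A * C) * (1 - A * D) / A * E"
    unfolding nonzero_mult_div_cancel_left[OF A0]
    by (subst (asm) diff_divide_distrib) (simp only: times_divide_eq_left)
  thus ?thesis by (simp only: AQ E_def cz.mult cz.diff cz.divide cz.one)
qed

lemma lam_nat: "lam r X (int k) = inverse (r ^ (2 * k)) + X / r ^ 2 * r ^ (2 * k)"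
  by (simp add: lam_def power_int_diff power_int_minus power_int_mult power_mult)

lemma Lop_ebas_0: "Lop r a b c d 1 = cz (lam r (a * b * c * d) 0)"
  using lam_nat[of "a * b * c * d" 0] by (simp add: Lop_def klin_0[OF klin_Sminus])

lemma Lop_ebas_Suc:
  assumes "a \<noteq> 0"
  shows "Lop r a b c d (ebas r a (Suc k)) =
     cz (lam r (a * b * c * d) (int (Suc k))) * ebas r a (Suc k) + cz (mu r a b c d k) * ebas r a k"
proof -
  define x where "x = r ^ (2 * k)"
  have x: "x \<noteq> 0" by (simp add: x_def)
  have rx: "r ^ (2 * Suc k) = r ^ 2 * x" by (simp add: x_def power2_eq_square)
  define s where "s = inverse r * (a / r * (1 - r ^ (2 * Suc k)))"
  define p1 where "p1 = (1 - a * x * b * c * d) / (a * x)"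
  define p2 where "p2 = (1 - a * x * b) * (1 - a * x * c) * (1 - a * x * d) / (a * x)"
  have "Lop r a b c d (ebas r a (Suc k)) =
     cz (s * p1 + (1 + a * b * c * d / r ^ 2)) * ebas r a (Suc k) + cz (- (s * p2)) * ebas r a k"
    unfolding Lop_def Splus_ebas klin_scale[OF klin_Sminus] Sminus_ebas[OF assms] s_def p1_def p2_def x_def
    by (simp only: cz.add cz.mult cz.uminus) (simp add: algebra_simps)
  moreover have "s * p1 + (1 + a * b * c * d / r ^ 2) = lam r (a * b * c * d) (int (Suc k))"
    unfolding lam_nat rx s_def p1_def using x assms by (simp add: field_simps power2_eq_square)
  moreover have "- (s * p2) = mu r a b c d k"
    unfolding mu_def rx s_def p2_def x_def[symmetric] using x assms by (simp add: field_simps power2_eq_square)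
  ultimately show ?thesis by simp
qed

text \<open>Both operators are bidiagonal on \<open>ebas\<close>, so only scalars have to be
  compared. The factor \<open>r^2\<close> arises because the product of the parameters is multiplied
  by \<open>r^4\<close> while the degree drops by one.\<close>

lemma Lop_Splus:
  assumes "a \<noteq> 0" "f \<in> Sym"
  shows "Lop r (a * r) (b * r) (c * r) (d * r) (Splus r f) = cz (r ^ 2) * Splus r (Lop r a b c d f)"
proof (rule klin_eq_on_Sym[OF assms(1) r_nz _ _ _ assms(2)])
  let ?L' = "Lop r (a * r) (b * r) (c * r) (d * r)"
  show "klin (\<lambda>f. ?L' (Splus r f))" "klin (\<lambda>f. cz (r ^ 2) * Splus r (Lop r a b c d f))"
    by (intro klin_cmult klin_comp[OF klin_Lop klin_Splus] klin_comp[OF klin_Splus klin_Lop])+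
  have ar: "a * r \<noteq> 0" using assms by simp
  have S: "Splus r (cz x) = 0" for x using klin_scale[OF klin_Splus, of x 1] by simp
  fix k
  show "?L' (Splus r (ebas r a k)) = cz (r ^ 2) * Splus r (Lop r a b c d (ebas r a k))"
  \<comment> \<open>For the indices \<open>0\<close> and \<open>1\<close> some of the lower basis
    elements are missing.\<close>
  proof (cases k)
    case 0
    thus ?thesis by (simp add: Lop_ebas_0 S klin_0[OF klin_Lop])
  next
    case k: (Suc k')
    show ?thesis
    proof (cases k')
      case 0
      have "lam r (a * r * (b * r) * (c * r) * (d * r)) 0 = r ^ 2 * lam r (a * b * c * d) 1"
        using lam_nat[of "a * r * (b * r) * (c * r) * (d * r)" 0] lam_nat[of "a * b * c * d" 1]
        by (simp add: field_simps power2_eq_square)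
      note 1 = this
      define t where "t = a / r * (1 - r ^ 2)"
      have t: "Splus r (ebas r a (Suc 0)) = cz t * 1"
        using Splus_ebas[of a 0] by (simp add: t_def power2_eq_square)
      have L: "Lop r a b c d (ebas r a (Suc 0)) =
          cz (lam r (a * b * c * d) 1) * ebas r a (Suc 0) + cz (mu r a b c d 0 * 1)"
        using Lop_ebas_Suc[OF assms(1), of b c d 0] by simp
      show ?thesis
        unfolding k 0 L t klin_scale[OF klin_Lop] Lop_ebas_0 1 klin_add[OF klin_Splus] S klin_scale[OF klin_Splus]
        by (simp add: cz.mult)
    next
      case k': (Suc j)
      define x where "x = r ^ (2 * j)"
      have x: "x \<noteq> 0" by (simp add: x_def)
      have rx: "r ^ (2 * Suc (Suc j)) = r ^ 4 * x" "r ^ (2 * Suc j) = r ^ 2 * x"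
        by (simp_all add: x_def power2_eq_square power4_eq_xxxx)
      define s where "s = a / r * (1 - r ^ (2 * Suc (Suc j)))"
      define s' where "s' = a / r * (1 - r ^ (2 * Suc j))"
      have 1: "lam r (a * r * (b * r) * (c * r) * (d * r)) (int (Suc j)) =
               r ^ 2 * lam r (a * b * c * d) (int (Suc (Suc j)))"
        unfolding lam_nat rx using x by (simp add: field_simps power2_eq_square power4_eq_xxxx)
      have 2: "s * mu r (a * r) (b * r) (c * r) (d * r) j = r ^ 2 * (mu r a b c d (Suc j) * s')"
        unfolding mu_def rx s_def s'_def x_def[symmetric] using x
        by (simp add: field_simps power2_eq_square power4_eq_xxxx)
      have "?L' (Splus r (ebas r a k)) =
          cz (s * lam r (a * r * (b * r) * (c * r) * (d * r)) (int (Suc j))) * ebas r (a * r) (Suc j) +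
          cz (s * mu r (a * r) (b * r) (c * r) (d * r) j) * ebas r (a * r) j"
        unfolding k k' Splus_ebas klin_scale[OF klin_Lop] Lop_ebas_Suc[OF ar] s_def
        by (simp only: cz.mult distrib_left mult.assoc)
      also have "\<dots> = cz (r ^ 2) * Splus r (Lop r a b c d (ebas r a k))"
        unfolding 1 2 unfolding k k' Lop_ebas_Suc[OF assms(1)] klin_add[OF klin_Splus] klin_scale[OF klin_Splus]
          Splus_ebas s_def s'_def
        by (simp only: cz.mult distrib_left mult_ac)
      finally show ?thesis .
    qed
  qed
qed

text \<open>No new computation: \<open>Sminus\<close> after \<open>Splus\<close> is an affine
  function of \<open>Lop\<close>, hence commutes with it, and the images under \<open>Splus\<close>
  exhaust the basis for \<open>a r\<close>.\<close>

lemma Lop_Sminus: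
  assumes "a \<noteq> 0" "g \<in> Sym"
  shows "Lop r a b c d (Sminus r a b c d g) =
         cz (inverse (r ^ 2)) * Sminus r a b c d (Lop r (a * r) (b * r) (c * r) (d * r) g)"
proof (rule klin_eq_on_Sym[OF _ r_nz _ _ _ assms(2)])
  let ?L = "Lop r a b c d" and ?L' = "Lop r (a * r) (b * r) (c * r) (d * r)" and ?S = "Sminus r a b c d"
  show "a * r \<noteq> 0" using assms by simp
  show "klin (\<lambda>g. ?L (?S g))" "klin (\<lambda>g. cz (inverse (r ^ 2)) * ?S (?L' g))"
    by (intro klin_cmult klin_comp[OF klin_Lop klin_Sminus] klin_comp[OF klin_Sminus klin_Lop])+
  have SS: "?S (Splus r f) = cz r * (?L f - cz (1 + a * b * c * d / r ^ 2) * f)" for f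
  proof -
    have "cz r * (cz (inverse r) * ?S (Splus r f)) = ?S (Splus r f)"
      by (simp add: mult.assoc[symmetric] flip: cz.mult)
    thus ?thesis by (simp add: Lop_def)
  qed
  have "?L (?S (Splus r f)) = cz (inverse (r ^ 2)) * ?S (?L' (Splus r f))" if "f \<in> Sym" for f
  proof -
    have "cz (inverse (r ^ 2)) * ?S (?L' (Splus r f)) = ?S (Splus r (?L f))"
      unfolding Lop_Splus[OF assms(1) that] klin_scale[OF klin_Sminus]
      by (simp add: mult.assoc[symmetric] flip: cz.mult)
    also have "\<dots> = ?L (?S (Splus r f))"
      unfolding SS klin_scale[OF klin_Lop] klin_diff[OF klin_Lop] ..
    finally show ?thesis ..
  qed
  note SL = this
  fix k
  \<comment> \<open>Nonzero because \<open>r\<close> is not a root of unity, so the basis element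
    can be pulled back through \<open>Splus\<close>.\<close>
  define s where "s = a / r * (1 - r ^ (2 * Suc k))"
  have s: "s \<noteq> 0" using assms r_pow_neq_1[of "2 * Suc k"] by (simp add: s_def del: power_Suc)
  have e: "ebas r (a * r) k = cz (inverse s) * Splus r (ebas r a (Suc k))"
    unfolding Splus_ebas s_def[symmetric] using s by (simp add: mult.assoc[symmetric] flip: cz.mult)
  show "?L (?S (ebas r (a * r) k)) = cz (inverse (r ^ 2)) * ?S (?L' (ebas r (a * r) k))"
    unfolding e klin_scale[OF klin_Lop] klin_scale[OF klin_Sminus] SL[OF ebas_Sym]
    by (simp only: mult.left_commute)
qed

text \<open>The product of the parameters is the same on both sides, hence so are the eigenvalues,
  and no factor appears. Only the off-diagonal entries need to be matched.\<close>

lemma Lop_Eop: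
  assumes "a \<noteq> 0" "f \<in> Sym"
  shows "Lop r a b (c * r) (d * r) (Eop r a b f) = Eop r a b (Lop r (a * r) (b * r) c d f)"
proof (rule klin_eq_on_Sym[OF _ r_nz _ _ _ assms(2)])
  let ?L' = "Lop r a b (c * r) (d * r)" and ?L = "Lop r (a * r) (b * r) c d" and ?E = "Eop r a b"
  show ar: "a * r \<noteq> 0" using assms by simp
  show "klin (\<lambda>f. ?L' (?E f))" "klin (\<lambda>f. ?E (?L f))"
    by (intro klin_comp[OF klin_Lop klin_Eop] klin_comp[OF klin_Eop klin_Lop])+
  have X: "a * b * (c * r) * (d * r) = a * r * (b * r) * c * d" by simp
  fix k
  show "?L' (?E (ebas r (a * r) k)) = ?E (?L (ebas r (a * r) k))"
  proof (cases k)
    case 0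
    have E: "?E (cz x) = cz x * ?E 1" for x using klin_scale[OF klin_Eop, of a b x 1] by simp
    have E1: "?E 1 = cz (a * b - 1) * 1" using Eop_ebas[of a b 0] by simp
    show ?thesis
      unfolding 0 ebas_0 Lop_ebas_0 E E1 klin_scale[OF klin_Lop] X by (simp only: mult_1_right mult_1_left mult.commute)
  next
    case k: (Suc j)
    define x where "x = r ^ (2 * j)"
    have x: "x \<noteq> 0" by (simp add: x_def)
    have rx: "r ^ (2 * Suc j) = r ^ 2 * x" by (simp_all add: x_def power2_eq_square)
    have m: "(a * b * r ^ (2 * Suc j) - 1) * mu r a b (c * r) (d * r) j =
          mu r (a * r) (b * r) c d j * (a * b * r ^ (2 * j) - 1)"
      unfolding mu_def rx x_def[symmetric] using x by (simp add: field_simps power2_eq_square)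
    have "?L' (?E (ebas r (a * r) k)) =
        cz ((a * b * r ^ (2 * Suc j) - 1) * lam r (a * b * (c * r) * (d * r)) (int (Suc j))) * ebas r a (Suc j)
      + cz ((a * b * r ^ (2 * Suc j) - 1) * mu r a b (c * r) (d * r) j) * ebas r a j"
      unfolding k Eop_ebas klin_scale[OF klin_Lop] Lop_ebas_Suc[OF assms(1)]
      by (simp only: cz.mult distrib_left mult.assoc)
    also have "\<dots> = ?E (?L (ebas r (a * r) k))"
      unfolding m X unfolding k Lop_ebas_Suc[OF ar] klin_add[OF klin_Eop] klin_scale[OF klin_Eop] Eop_ebas
      by (simp only: cz.mult distrib_left mult_ac)
    finally show ?thesis .
  qed
qed

section \<open>Eigenvalues and eigenfunctions\<close>

definition gen :: "'f \<Rightarrow> bool" where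
  "gen X \<longleftrightarrow> (\<forall>k::int. X \<noteq> r powi k)"

lemma r_powi_eq_iff: "r powi m = r powi n \<longleftrightarrow> m = n"
proof
  assume "r powi m = r powi n"
  hence "r powi (m - n) = 1" by (simp add: power_int_diff)
  thus "m = n" using r_powi by force
qed auto

text \<open>The difference of two eigenvalues factors, and \<open>gen\<close> excludes the vanishing
  of the second factor. Negative indices are covered as well.\<close>

lemma lam_inj:
  assumes "gen X" "lam r X i = lam r X j"
  shows "i = j"
proof -
  have "(r powi (2 * j) - r powi (2 * i)) * (r powi (- 2 * i - 2 * j) - X * r powi (-2)) =
        lam r X i - lam r X j"
    by (simp add: lam_def algebra_simps flip: power_int_add)
  hence "(r powi (2 * j) - r powi (2 * i)) * (r powi (- 2 * i - 2 * j) - X * r powi (-2)) = 0"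
    using assms by simp
  moreover have "r powi (- 2 * i - 2 * j) - X * r powi (-2) \<noteq> 0"
  proof
    assume "r powi (- 2 * i - 2 * j) - X * r powi (-2) = 0"
    hence "X = r powi (- 2 * i - 2 * j) * r powi 2" by (simp add: power_int_minus field_simps)
    hence "X = r powi (- 2 * i - 2 * j + 2)" by (simp add: power_int_add)
    thus False using assms(1) unfolding gen_def by blast
  qed
  ultimately show ?thesis using r_powi_eq_iff by auto
qed

end

text \<open>Back substitution for an eigenvector of a bidiagonal matrix, starting from the
  coefficient \<open>1\<close> at index \<open>n\<close>. The resulting sum is the terminating basic
  hypergeometric series of the Askey--Wilson polynomials.\<close>

definition awC :: "'f::field \<Rightarrow> 'f \<Rightarrow> 'f \<Rightarrow> 'f \<Rightarrow> 'f \<Rightarrow> nat \<Rightarrow> nat \<Rightarrow> 'f" where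
  "awC r a b c d n k = (\<Prod>j\<in>{k..<n}. mu r a b c d j / (lam r (a * b * c * d) (int n) - lam r (a * b * c * d) (int j)))"

definition awS :: "'f::field \<Rightarrow> 'f \<Rightarrow> 'f \<Rightarrow> 'f \<Rightarrow> 'f \<Rightarrow> nat \<Rightarrow> (int \<Rightarrow>\<^sub>0 'f)" where
  "awS r a b c d n = (\<Sum>k\<le>n. Poly_Mapping.single 0 (awC r a b c d n k) * le r a k)"

definition awp :: "'f::field \<Rightarrow> 'f \<Rightarrow> 'f \<Rightarrow> 'f \<Rightarrow> 'f \<Rightarrow> nat \<Rightarrow> (int \<Rightarrow>\<^sub>0 'f)" where
  "awp r a b c d n = Poly_Mapping.single 0 (inverse (Poly_Mapping.lookup (awS r a b c d n) (int n))) * awS r a b c d n"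

context q_shift
begin

lemma ldeg_awS:
  assumes "a \<noteq> 0"
  shows "ldeg (awS r a b c d n) n"
proof -
  note l = ldeg_le[OF assms r_nz, unfolded ldeg_def]
  have "awS r a b c d n \<in> symL"
    unfolding awS_def by (intro symL_sum symL_closed) (use l in auto)
  moreover have "Poly_Mapping.lookup (awS r a b c d n) m =
      (\<Sum>k\<le>n. awC r a b c d n k * Poly_Mapping.lookup (le r a k) m)" for m
    by (simp add: awS_def lookup_sum lookup_single_mult)
  moreover have "(\<Sum>k\<le>n. awC r a b c d n k * Poly_Mapping.lookup (le r a k) (int n)) =
       (\<Sum>k\<le>n. if k = n then Poly_Mapping.lookup (le r a n) (int n) else 0)"
    by (rule sum.cong) (use l in \<open>auto simp: awC_def\<close>)
  moreover have "(\<Sum>k\<le>n. awC r a b c d n k * Poly_Mapping.lookup (le r a k) m) = 0" if "m > int n" for m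
    using l that by (intro sum.neutral) auto
  ultimately show ?thesis using l by (simp add: ldeg_def)
qed

lemma awp_props:
  assumes "a \<noteq> 0"
  shows "ldeg (awp r a b c d n) n" "Poly_Mapping.lookup (awp r a b c d n) (int n) = 1"
  using ldeg_awS[OF assms, of b c d n] by (auto simp: awp_def ldeg_def lookup_single_mult)

lemma Lop_awp:
  assumes "a \<noteq> 0" "gen (a * b * c * d)"
  shows "Lop r a b c d (lz (awp r a b c d n)) = cz (lam r (a * b * c * d) (int n)) * lz (awp r a b c d n)"
proof -
  define l where "l k = lam r (a * b * c * d) (int k)" for k
  define C where "C = awC r a b c d n"
  define G where "G k = (case k of 0 \<Rightarrow> 0 | Suc j \<Rightarrow> cz (C k * mu r a b c d j) * ebas r a j)" for k
  have S: "lz (awS r a b c d n) = (\<Sum>k\<le>n. cz (C k) * ebas r a k)"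
    by (simp add: awS_def lz.sum lz.mult lz_le C_def)
  have e: "cz (C k) * Lop r a b c d (ebas r a k) = cz (C k * l k) * ebas r a k + G k" for k
    using Lop_ebas_Suc[OF assms(1)]
    by (cases k) (simp_all add: G_def l_def Lop_ebas_0 cz.mult distrib_left mult.assoc)
  \<comment> \<open>The recurrence behind \<open>awC\<close>: the off-diagonal contribution at
    \<open>k\<close> makes up for the difference between the diagonal entries at \<open>n\<close>
    and \<open>k\<close>.\<close>
  have C: "C (Suc k) * mu r a b c d k = C k * (l n - l k)" if "k < n" for k
  proof -
    have "l n - l k \<noteq> 0" using lam_inj[OF assms(2), of "int n" "int k"] that by (auto simp: l_def)
    moreover have "C k = mu r a b c d k / (l n - l k) * C (Suc k)"
      unfolding C_def awC_def l_def using that by (simp add: prod.atLeast_Suc_lessThan)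
    ultimately show ?thesis by simp
  qed
  have "(\<Sum>k\<le>n. G k) = (\<Sum>k<n. G (Suc k))"
    by (subst sum.atMost_shift) (simp add: G_def)
  also have "\<dots> = (\<Sum>k<n. cz (C k * (l n - l k)) * ebas r a k)"
    by (rule sum.cong) (simp_all add: G_def C)
  also have "\<dots> = (\<Sum>k\<le>n. cz (C k * (l n - l k)) * ebas r a k)"
    by (simp flip: lessThan_Suc_atMost)
  finally have "Lop r a b c d (lz (awS r a b c d n)) = cz (l n) * lz (awS r a b c d n)"
    unfolding S klin_sum[OF klin_Lop] klin_scale[OF klin_Lop] e sum.distrib
    by (simp add: sum_distrib_left sum.distrib[symmetric] cz.mult cz.diff algebra_simps)
  thus ?thesis
    by (simp add: awp_def lz.mult klin_scale[OF klin_Lop] l_def mult.left_commute)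
qed

text \<open>In the expansion by \<open>awp\<close>, separation of eigenvalues kills all coefficients
  except the one at \<open>j\<close>. For negative \<open>j\<close> there is none, in accordance
  with the convention that such polynomials are zero.\<close>

lemma Lop_eigen_unique:
  assumes a: "a \<noteq> 0" and X: "gen (a * b * c * d)" and f: "f \<in> Sym"
    and eig: "Lop r a b c d f = cz (lam r (a * b * c * d) j) * f"
  shows "j < 0 \<Longrightarrow> f = 0" and "j \<ge> 0 \<Longrightarrow> \<exists>\<kappa>. f = cz \<kappa> * lz (awp r a b c d (nat j))"
proof -
  define l where "l j = lam r (a * b * c * d) j" for j
  obtain g where g: "f = lz g" "g \<in> symL" using f by (auto simp: Sym_eq)
  obtain n where n: "\<forall>m\<ge>int n. Poly_Mapping.lookup g m = 0" by (rule symL_bound[OF g(2)])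
  note ld = awp_props(1)[OF a, of b c d]
  obtain x where x: "g = (\<Sum>i<n. Poly_Mapping.single 0 (x i) * awp r a b c d i)"
    using symL_span[OF ld g(2) n] by blast
  have fx: "f = (\<Sum>i<n. cz (x i) * lz (awp r a b c d i))"
    by (simp add: g(1) x lz.sum lz.mult)
  have "(\<Sum>i<n. Poly_Mapping.single 0 (x i * (l (int i) - l j)) * awp r a b c d i) = 0"
  proof -
    have "lz (\<Sum>i<n. Poly_Mapping.single 0 (x i * (l (int i) - l j)) * awp r a b c d i) =
          Lop r a b c d f - cz (l j) * f"
      unfolding fx klin_sum[OF klin_Lop] klin_scale[OF klin_Lop] Lop_awp[OF a X] l_def[symmetric] lz.sum
        lz.mult lz_single power_int_0_right sum_distrib_left sum_subtractf[symmetric]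
      by (rule sum.cong) (simp_all add: cz.mult cz.diff algebra_simps)
    thus ?thesis using eig by (simp add: l_def)
  qed
  hence 0: "x i * (l (int i) - l j) = 0" if "i < n" for i
    using symL_indep[OF ld, of "\<lambda>i. x i * (l (int i) - l j)" n i] that by blast
  have x0: "x i = 0" if "i < n" "int i \<noteq> j" for i
    using 0[OF that(1)] lam_inj[OF X, of "int i" j] that by (auto simp: l_def)
  show "f = 0" if "j < 0"
    unfolding fx using x0 that by (intro sum.neutral) auto
  assume j: "j \<ge> 0"
  have "f = (\<Sum>i<n. if i = nat j then cz (x i) * lz (awp r a b c d i) else 0)"
    unfolding fx by (rule sum.cong) (use x0 j in auto)
  also have "\<dots> = cz (if nat j < n then x (nat j) else 0) * lz (awp r a b c d (nat j))"
    by (auto simp: sum.delta)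
  finally show "\<exists>\<kappa>. f = cz \<kappa> * lz (awp r a b c d (nat j))" by blast
qed

end

lemma lookup_map_0: "f 0 = 0 \<Longrightarrow> Poly_Mapping.lookup (Poly_Mapping.map f p) k = f (Poly_Mapping.lookup p k)"
  by (simp add: map.rep_eq when_def)

lemma map_single_0: "f 0 = 0 \<Longrightarrow> Poly_Mapping.map f (Poly_Mapping.single k x) = Poly_Mapping.single k (f x)"
  by (rule poly_mapping_eqI) (simp add: lookup_map_0 lookup_single when_def)

lemma ring_homo_map:
  assumes "field_homo \<rho>"
  shows "ring_homo (Poly_Mapping.map \<rho> :: (int \<Rightarrow>\<^sub>0 'f::field) \<Rightarrow> (int \<Rightarrow>\<^sub>0 'g::field))"
proof -
  interpret field_homo \<rho> by fact
  have a: "Poly_Mapping.map \<rho> (f + g) = Poly_Mapping.map \<rho> f + Poly_Mapping.map \<rho> g" for f g :: "int \<Rightarrow>\<^sub>0 'f"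
    by (rule poly_mapping_eqI) (simp add: lookup_map_0 lookup_add add)
  show ?thesis
  proof
    show "Poly_Mapping.map \<rho> (f * g) = Poly_Mapping.map \<rho> f * Poly_Mapping.map \<rho> g" for f g :: "int \<Rightarrow>\<^sub>0 'f"
      by (rule multiplicative_on_single[OF a]) (simp add: mult_single map_single_0 mult)
    show "Poly_Mapping.map \<rho> (1 :: int \<Rightarrow>\<^sub>0 'f) = 1"
      by (rule poly_mapping_eqI) (simp add: lookup_map_0 lookup_one when_def)
  qed (rule a)
qed

text \<open>\<open>awp\<close> is given by rational expressions in its parameters, so a field
  embedding can be applied to the parameters instead. A replacement of parameters is computed in
  this way.\<close>

lemma map_awp:
  assumes "field_homo \<rho>"
  shows "Poly_Mapping.map \<rho> (awp r a b c d n) = awp (\<rho> r) (\<rho> a) (\<rho> b) (\<rho> c) (\<rho> d) n"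
proof -
  interpret field_homo \<rho> by fact
  interpret M: ring_homo "Poly_Mapping.map \<rho> :: (int \<Rightarrow>\<^sub>0 'a) \<Rightarrow> _"
    by (rule ring_homo_map) fact
  note s = map_single_0[of \<rho>, OF zero]
  have le: "Poly_Mapping.map \<rho> (le r a k) = le (\<rho> r) (\<rho> a) k" for k
    by (simp add: le_def M.prod M.mult M.diff s mult power)
  have lam: "\<rho> (lam r x k) = lam (\<rho> r) (\<rho> x) k" for k x
    by (simp add: lam_def add mult powi)
  have mu: "\<rho> (mu r a b c d k) = mu (\<rho> r) (\<rho> a) (\<rho> b) (\<rho> c) (\<rho> d) k" for k
    by (simp add: mu_def add mult power diff uminus inverse)
  have "\<rho> (awC r a b c d n k) = awC (\<rho> r) (\<rho> a) (\<rho> b) (\<rho> c) (\<rho> d) n k" for k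
    by (simp add: awC_def prod divide mu lam diff mult)
  hence S: "Poly_Mapping.map \<rho> (awS r a b c d n) = awS (\<rho> r) (\<rho> a) (\<rho> b) (\<rho> c) (\<rho> d) n"
    by (simp add: awS_def M.sum M.mult s le)
  have "\<rho> (Poly_Mapping.lookup (awS r a b c d n) k) =
        Poly_Mapping.lookup (awS (\<rho> r) (\<rho> a) (\<rho> b) (\<rho> c) (\<rho> d) n) k" for k
    unfolding S[symmetric] by (simp add: lookup_map_0)
  thus ?thesis by (simp add: awp_def M.mult s S inverse)
qed


section \<open>Symmetries of the weight\<close>

text \<open>Exponents are integers and coefficients are extended by zero, so that they can be
  evaluated at reflected exponents outside the quadrant.\<close>

definition cf :: "'k::comm_ring_1 fps fps \<Rightarrow> int \<times> int \<Rightarrow> 'k" where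
  "cf f = (\<lambda>(i, j). if i \<ge> 0 \<and> j \<ge> 0 then fps_nth (fps_nth f (nat j)) (nat i) else 0)"

lemma cf_add: "cf (f + g) p = cf f p + cf g p"
  and cf_diff: "cf (f - g) p = cf f p - cf g p"
  and cf_0 [simp]: "cf 0 p = 0"
  by (auto simp: cf_def split: prod.splits)

lemma cf_nonzeroD: "cf f p \<noteq> 0 \<Longrightarrow> 0 \<le> fst p \<and> 0 \<le> snd p"
  by (cases p) (auto simp: cf_def split: if_splits)

lemma cf_neg: "i < 0 \<or> j < 0 \<Longrightarrow> cf f (i, j) = 0"
  by (auto simp: cf_def)

text \<open>Any finite set containing the contributing exponents may serve as range of summation,
  unlike the rectangle in the usual product formula, which a reflection would not preserve.\<close>

lemma cf_mult:
  assumes "finite B" "\<And>p'. cf f p' \<noteq> 0 \<Longrightarrow> cf g (p - p') \<noteq> 0 \<Longrightarrow> p' \<in> B"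
  shows "cf (f * g) p = (\<Sum>p'\<in>B. cf f p' * cf g (p - p'))"
proof (cases p)
  case p: (Pair i j)
  let ?S = "{p'. cf f p' \<noteq> 0 \<and> cf g (p - p') \<noteq> 0}"
  have sub: "?S \<subseteq> {0..i} \<times> {0..j}"
    by (auto simp: p dest!: cf_nonzeroD)
  have "?S \<subseteq> B" using assms by auto
  hence 1: "(\<Sum>p'\<in>B. cf f p' * cf g (p - p')) = (\<Sum>p'\<in>?S. cf f p' * cf g (p - p'))"
    using assms(1) by (intro sum.mono_neutral_right) auto
  have 2: "(\<Sum>p'\<in>{0..i} \<times> {0..j}. cf f p' * cf g (p - p')) = (\<Sum>p'\<in>?S. cf f p' * cf g (p - p'))"
    using sub by (intro sum.mono_neutral_right) auto
  show ?thesis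
  proof (cases "i \<ge> 0 \<and> j \<ge> 0")
    case False
    hence "{0..i} \<times> {0..j} = {}" by auto
    with 1 2 False show ?thesis by (auto simp: p cf_def)
  next
    case True
    have "cf (f * g) p = (\<Sum>k=0..nat j. \<Sum>l=0..nat i. cf f (int l, int k) * cf g (i - int l, j - int k))"
    proof -
      have e: "fps_nth (fps_nth f k) l * fps_nth (fps_nth g (nat j - k)) (nat i - l) =
            cf f (int l, int k) * cf g (i - int l, j - int k)"
        if "k \<in> {0..nat j}" "l \<in> {0..nat i}" for k l
      proof -
        have "i - int l \<ge> 0" "j - int k \<ge> 0" using that True by auto
        moreover have "nat (i - int l) = nat i - l" "nat (j - int k) = nat j - k" by auto
        ultimately show ?thesis by (simp add: cf_def)
      qed
      have "cf (f * g) p = (\<Sum>k=0..nat j. \<Sum>l=0..nat i. fps_nth (fps_nth f k) l * fps_nth (fps_nth g (nat j - k)) (nat i - l))"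
        using True by (simp add: p cf_def fps_mult_nth fps_sum_nth)
      also have "\<dots> = (\<Sum>k=0..nat j. \<Sum>l=0..nat i. cf f (int l, int k) * cf g (i - int l, j - int k))"
        by (intro sum.cong refl e)
      finally show ?thesis .
    qed
    also have "\<dots> = (\<Sum>(k, l)\<in>{0..nat j} \<times> {0..nat i}. cf f (int l, int k) * cf g (i - int l, j - int k))"
      by (rule sum.cartesian_product)
    also have "\<dots> = (\<Sum>p'\<in>{0..i} \<times> {0..j}. cf f p' * cf g (p - p'))"
      by (rule sum.reindex_bij_witness[where i = "\<lambda>(l, k). (nat k, nat l)" and j = "\<lambda>(k, l). (int l, int k)"])
         (use True in \<open>auto simp: p le_nat_iff\<close>)
    finally show ?thesis using 1 2 by simp
  qed
qed

lemma finite_cf_supp: "finite {p'. cf f p' \<noteq> 0 \<and> cf g (p - p') \<noteq> 0}"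
proof (rule finite_subset)
  show "{p'. cf f p' \<noteq> 0 \<and> cf g (p - p') \<noteq> 0} \<subseteq> {0..fst p} \<times> {0..snd p}"
    by (auto dest!: cf_nonzeroD)
qed auto

lemma cf_mult': "cf (f * g) p = (\<Sum>p' | cf f p' \<noteq> 0 \<and> cf g (p - p') \<noteq> 0. cf f p' * cf g (p - p'))"
  by (rule cf_mult[OF finite_cf_supp]) auto

definition bimonom :: "'k::comm_ring_1 \<Rightarrow> nat \<Rightarrow> nat \<Rightarrow> 'k fps fps" where
  "bimonom \<alpha> i j = fps_const (fps_const \<alpha> * fps_X ^ i) * fps_X ^ j"

lemma cf_bimonom: "cf (bimonom \<alpha> i j) p = (if p = (int i, int j) then \<alpha> else 0)"
  by (cases p) (auto simp: cf_def bimonom_def fps_X_power_nth nat_eq_iff)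

lemma bimonom_mult: "bimonom \<alpha> i j * bimonom \<beta> k l = bimonom (\<alpha> * \<beta>) (i + k) (j + l)"
proof -
  have "bimonom \<alpha> i j * bimonom \<beta> k l = fps_const (fps_const \<alpha> * fps_X ^ i) * fps_const (fps_const \<beta> * fps_X ^ k) *
      (fps_X ^ j * fps_X ^ l)"
    by (simp only: bimonom_def mult_ac)
  also have "\<dots> = bimonom (\<alpha> * \<beta>) (i + k) (j + l)"
    by (simp add: bimonom_def power_add mult_ac flip: fps_const_mult)
  finally show ?thesis .
qed

lemma bimonom_1: "bimonom 1 0 0 = 1"
  by (simp add: bimonom_def)

lemma bimonom_power: "bimonom \<alpha> i j ^ n = bimonom (\<alpha> ^ n) (n * i) (n * j)"
  by (induction n) (simp_all add: bimonom_1 bimonom_mult)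

lemma cf_1: "cf 1 p = (if p = (0, 0) then 1 else 0)"
  using cf_bimonom[of 1 0 0 p] by (simp add: bimonom_1)

lemma cf_bimonom_mult: "cf (bimonom \<alpha> i j * f) p = \<alpha> * cf f (p - (int i, int j))"
  by (subst cf_mult[of "{(int i, int j)}"]) (auto simp: cf_bimonom split: if_splits)

abbreviation qq :: "'k::comm_ring_1 fps fps" where "qq \<equiv> bimonom 1 2 2"

text \<open>The \<open>k\<close>-th factor differs from \<open>1\<close> only in degrees at least
  \<open>2 k\<close> of the outer variable. Coefficients of the partial products become stationary,
  which is convergence in the topology of formal power series.\<close>

lemma
  fixes x :: "'k::idom fps fps"
  assumes x: "cf x (0, 0) = 0"
  shows qp_nth: "j \<le> n \<Longrightarrow> fps_nth (qpochhammer_inf x qq) j = fps_nth (\<Prod>k\<le>n. 1 - x * qq ^ k) j"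
    and qp_00: "cf (qpochhammer_inf x qq) (0, 0) = 1"
proof -
  define F where "F n = (\<Prod>k\<le>n. 1 - x * qq ^ k)" for n
  have qn: "fps_nth (f * qq ^ Suc n) j = 0" if "j \<le> n" for f :: "'k fps fps" and n j
  proof -
    have "qq ^ Suc n = fps_const (fps_X ^ (Suc n * 2)) * fps_X ^ (Suc n * 2)"
      unfolding bimonom_power unfolding bimonom_def by simp
    hence "f * qq ^ Suc n = (f * fps_const (fps_X ^ (Suc n * 2))) * fps_X ^ (Suc n * 2)"
      unfolding mult.assoc by (rule arg_cong)
    thus ?thesis using that by (simp only: fps_X_power_mult_right_nth) simp
  qed
  have step: "fps_nth (F (Suc n)) j = fps_nth (F n) j" if "j \<le> n" for n j
  proof -
    have "F (Suc n) = F n - (F n * x) * qq ^ Suc n" unfolding F_def by (simp add: algebra_simps)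
    thus ?thesis using qn[OF that, of "F n * x"] by simp
  qed
  have stab: "fps_nth (F n) j = fps_nth (F j) j" if "j \<le> n" for n j
    using that by (induction n rule: dec_induct) (auto simp: step)
  define p where "p = Abs_fps (\<lambda>j. fps_nth (F j) j)"
  have pn: "fps_nth p j = fps_nth (F n) j" if "j \<le> n" for j n using stab[OF that] by (simp add: p_def)
  have lim: "(\<lambda>n. \<Prod>i\<le>n. 1 - x * qq ^ (i + 0)) \<longlonglongrightarrow> p"
    unfolding tendsto_fps_iff
  proof
    fix j
    show "\<forall>\<^sub>F n in sequentially. fps_nth (\<Prod>i\<le>n. 1 - x * qq ^ (i + 0)) j = fps_nth p j"
      using eventually_ge_at_top[of j] by eventually_elim (simp add: F_def[symmetric] pn)
  qed
  have p00: "cf p (0, 0) = 1"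
    using x by (simp add: cf_def p_def F_def)
  \<comment> \<open>The predicate \<open>has_prod\<close> requires a nonzero limit.\<close>
  hence "p \<noteq> 0" by auto
  hence "(\<lambda>k. 1 - x * qq ^ k) has_prod p"
    using lim unfolding has_prod_def raw_has_prod_def by simp
  hence "prodinf (\<lambda>k. 1 - x * qq ^ k) = p" using has_prod_unique by metis
  hence q: "qpochhammer_inf x qq = p" by (simp add: qpochhammer_inf_def)
  show "cf (qpochhammer_inf x qq) (0, 0) = 1" using p00 q by simp
  show "j \<le> n \<Longrightarrow> fps_nth (qpochhammer_inf x qq) j = fps_nth (\<Prod>k\<le>n. 1 - x * qq ^ k) j"
    unfolding q using pn by (simp add: F_def)
qed

lemma cf_mult_00: "cf (f * g) (0, 0) = cf f (0, 0) * cf g (0, 0)"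
  by (simp add: cf_def)

lemma qp_rec:
  fixes x :: "'k::idom fps fps"
  assumes x: "cf x (0, 0) = 0"
  shows "qpochhammer_inf x qq = (1 - x) * qpochhammer_inf (x * qq) qq"
proof (rule fps_ext)
  fix j
  have x': "cf (x * qq) (0, 0) = 0" using x by (simp add: cf_mult_00)
  have "fps_nth (qpochhammer_inf x qq) j = fps_nth (\<Prod>k\<le>Suc j. 1 - x * qq ^ k) j"
    by (rule qp_nth[OF x]) simp
  also have "(\<Prod>k\<le>Suc j. 1 - x * qq ^ k) = (1 - x) * (\<Prod>k\<le>j. 1 - (x * qq) * qq ^ k)"
    by (subst prod.atMost_Suc_shift) (simp add: mult.assoc)
  also have "fps_nth \<dots> j = (\<Sum>i=0..j. fps_nth (1 - x) i * fps_nth (qpochhammer_inf (x * qq) qq) (j - i))"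
    unfolding fps_mult_nth by (intro sum.cong refl) (simp add: qp_nth[OF x', of _ j])
  also have "\<dots> = fps_nth ((1 - x) * qpochhammer_inf (x * qq) qq) j"
    by (simp only: fps_mult_nth)
  finally show "fps_nth (qpochhammer_inf x qq) j = fps_nth ((1 - x) * qpochhammer_inf (x * qq) qq) j" .
qed

lemma fps_right_inverse_unit:
  fixes D :: "'k::field fps fps"
  assumes "cf D (0, 0) = 1"
  shows "D * inverse D = 1"
proof -
  have "fps_nth (fps_nth D 0) 0 \<noteq> 0" using assms by (simp add: cf_def)
  hence "fps_nth D 0 * inverse (fps_nth D 0) = 1" by (simp add: inverse_mult_eq_1')
  thus ?thesis using fps_right_inverse[of D "inverse (fps_nth D 0)"]
    by (simp add: fps_inverse_def)
qed

text \<open>Without constant term, \<open>H\<close> has total order at least one, hence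
  \<open>H ^ n\<close> at least \<open>n\<close>.\<close>

lemma cf_power_low:
  assumes "cf H (0, 0) = 0" "fst p + snd p < int n"
  shows "cf (f * H ^ n) p = 0"
  using assms(2)
proof (induction n arbitrary: p)
  case 0
  thus ?case by (cases p) (auto simp: cf_def)
next
  case (Suc n)
  have "cf (f * H ^ Suc n) p = cf ((f * H ^ n) * H) p" by (simp add: mult_ac)
  also have "\<dots> = 0"
  proof (subst cf_mult', rule sum.neutral, rule ballI)
    fix p' assume "p' \<in> {p'. cf (f * H ^ n) p' \<noteq> 0 \<and> cf H (p - p') \<noteq> 0}"
    hence 1: "cf (f * H ^ n) p' \<noteq> 0" and 2: "cf H (p - p') \<noteq> 0" by auto
    have "fst p' + snd p' \<ge> int n" using Suc.IH[of p'] 1 by force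
    moreover have "0 \<le> fst (p - p') \<and> 0 \<le> snd (p - p')" by (rule cf_nonzeroD[OF 2])
    moreover have "p - p' \<noteq> (0, 0)" using 2 assms(1) by metis
    hence "fst (p - p') \<noteq> 0 \<or> snd (p - p') \<noteq> 0" by (metis prod.collapse)
    ultimately have False using Suc.prems by auto
    thus "cf (f * H ^ n) p' * cf H (p - p') = 0" ..
  qed
  finally show ?case .
qed

text \<open>
  The argument of \<^const>\<open>cf\<close> is the pair of exponents of \<open>z\<close> and \<open>y\<close>.  The substitutions \<open>z \<mapsto> 1/z\<close> and
  \<open>z \<mapsto> q/z\<close> are linear involutions of exponents fixing \<open>(2, 2)\<close>, the exponents of \<open>q\<close>.
\<close>

locale reflection =
  fixes \<tau> :: "int \<times> int \<Rightarrow> int \<times> int"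
  assumes \<tau>_diff: "\<tau> (p - p') = \<tau> p - \<tau> p'" and \<tau>_\<tau> [simp]: "\<tau> (\<tau> p) = p" and \<tau>_qq: "\<tau> (2, 2) = (2, 2)"
begin

definition Inv :: "'k::comm_ring_1 fps fps \<Rightarrow> bool" where
  "Inv f \<longleftrightarrow> (\<forall>p. cf f (\<tau> p) = cf f p)"

lemma \<tau>_0: "\<tau> 0 = 0"
  using \<tau>_diff[of 0 0] by simp

lemma \<tau>_00 [simp]: "\<tau> (0, 0) = (0, 0)"
  using \<tau>_0 by (simp add: zero_prod_def)

lemma \<tau>_add: "\<tau> (p + p') = \<tau> p + \<tau> p'"
proof -
  have "\<tau> (p - (0 - p')) = \<tau> p - (\<tau> 0 - \<tau> p')" by (simp only: \<tau>_diff)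
  thus ?thesis by (simp add: \<tau>_0)
qed

lemma \<tau>_eq_iff: "\<tau> p = p' \<longleftrightarrow> p = \<tau> p'" by auto

text \<open>\<open>\<tau>\<close> is additive and so permutes the terms of the convolution.\<close>

lemma Inv_mult:
  assumes "Inv f" "Inv g"
  shows "Inv (f * g)"
  unfolding Inv_def
proof
  fix p
  have inv: "cf f (\<tau> p) = cf f p" "cf g (\<tau> p) = cf g p" for p using assms unfolding Inv_def by blast+
  have "cf (f * g) (\<tau> p) = (\<Sum>p' | cf f p' \<noteq> 0 \<and> cf g (\<tau> p - p') \<noteq> 0. cf f p' * cf g (\<tau> p - p'))"
    by (rule cf_mult')
  also have "\<dots> = (\<Sum>p' | cf f p' \<noteq> 0 \<and> cf g (p - p') \<noteq> 0. cf f p' * cf g (p - p'))"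
  proof (rule sum.reindex_bij_witness[where i = \<tau> and j = \<tau>])
    show "\<tau> p' \<in> {p'. cf f p' \<noteq> 0 \<and> cf g (p - p') \<noteq> 0}"
      if "p' \<in> {p'. cf f p' \<noteq> 0 \<and> cf g (\<tau> p - p') \<noteq> 0}" for p'
      using that inv(1)[of p'] inv(2)[of "p - \<tau> p'"] by (auto simp: \<tau>_diff)
    show "\<tau> p' \<in> {p'. cf f p' \<noteq> 0 \<and> cf g (\<tau> p - p') \<noteq> 0}"
      if "p' \<in> {p'. cf f p' \<noteq> 0 \<and> cf g (p - p') \<noteq> 0}" for p'
      using that inv(1)[of p'] inv(2)[of "p - p'"] by (auto simp: \<tau>_diff)
    show "cf f (\<tau> p') * cf g (p - \<tau> p') = cf f p' * cf g (\<tau> p - p')"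
      if "p' \<in> {p'. cf f p' \<noteq> 0 \<and> cf g (\<tau> p - p') \<noteq> 0}" for p'
      using inv(1)[of p'] inv(2)[of "p - \<tau> p'"] by (simp add: \<tau>_diff)
  qed auto
  also have "\<dots> = cf (f * g) p" by (rule cf_mult'[symmetric])
  finally show "cf (f * g) (\<tau> p) = cf (f * g) p" .
qed

lemma Inv_1: "Inv 1"
  unfolding Inv_def cf_1 \<tau>_eq_iff[of _ "(0, 0)"] \<tau>_00 by simp

lemma Inv_0: "Inv 0"
  by (simp add: Inv_def)

lemma Inv_add: "Inv f \<Longrightarrow> Inv g \<Longrightarrow> Inv (f + g)" and Inv_diff: "Inv f \<Longrightarrow> Inv g \<Longrightarrow> Inv (f - g)"
  unfolding Inv_def cf_add cf_diff by simp_all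

lemma Inv_prod: "(\<And>x. x \<in> A \<Longrightarrow> Inv (f x)) \<Longrightarrow> Inv (prod f A)"
  by (induction A rule: infinite_finite_induct) (auto simp: Inv_1 Inv_mult)

lemma Inv_power: "Inv f \<Longrightarrow> Inv (f ^ n)"
  by (induction n) (auto simp: Inv_1 Inv_mult)

lemma Inv_sum: "(\<And>x. x \<in> A \<Longrightarrow> Inv (f x)) \<Longrightarrow> Inv (sum f A)"
  by (induction A rule: infinite_finite_induct) (auto simp: Inv_add Inv_0)

lemma cf_bimonom_\<tau>: "\<tau> (int i, int j) = (int i', int j') \<Longrightarrow> cf (bimonom \<alpha> i j) (\<tau> p) = cf (bimonom \<alpha> i' j') p"
  unfolding cf_bimonom \<tau>_eq_iff[of p "(int i, int j)"] by simp

lemma Inv_bimonom_fixed: "\<tau> (int i, int j) = (int i, int j) \<Longrightarrow> Inv (bimonom \<alpha> i j)"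
  unfolding Inv_def using cf_bimonom_\<tau> by metis

lemma Inv_bimonom_pair: 
  assumes "\<tau> (int i, int j) = (int i', int j')"
  shows "Inv (bimonom \<alpha> i j + bimonom \<alpha> i' j')"
proof -
  have "\<tau> (int i', int j') = (int i, int j)" using assms \<tau>_\<tau> by metis
  thus ?thesis
    unfolding Inv_def cf_add using cf_bimonom_\<tau>[OF assms] cf_bimonom_\<tau>[of i' j' i j] by (metis add.commute)
qed

text \<open>The two monomials are exchanged by \<open>\<tau>\<close> while \<open>q\<close> is
  fixed, so for each \<open>k\<close> the product of the two \<open>k\<close>-th factors is
  invariant.\<close>

lemma Inv_qp_pair:
  fixes \<alpha> :: "'k::idom"
  assumes \<tau>: "\<tau> (int i, int j) = (int i', int j')" and nz: "(i, j) \<noteq> (0, 0)"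
  shows "Inv (qpochhammer_inf (bimonom \<alpha> i j) qq * qpochhammer_inf (bimonom \<alpha> i' j') qq)"
proof -
  let ?x = "bimonom \<alpha> i j" and ?y = "bimonom \<alpha> i' j'"
  have nz': "(i', j') \<noteq> (0, 0)"
  proof
    assume "(i', j') = (0, 0)"
    hence "\<tau> (int i, int j) = (0, 0)" using \<tau> by simp
    hence "(int i, int j) = (0, 0)" unfolding \<tau>_eq_iff by simp
    thus False using nz by simp
  qed
  have x0: "cf ?x (0, 0) = 0" and y0: "cf ?y (0, 0) = 0" using nz nz' by (auto simp: cf_bimonom)
  have kq: "\<tau> (int k * 2, int k * 2) = (int k * 2, int k * 2)" for k
  proof (induction k)
    case (Suc k)
    have e: "(int (Suc k) * 2, int (Suc k) * 2) = (int k * 2, int k * 2) + (2, 2)" by simp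
    show ?case unfolding e \<tau>_add Suc \<tau>_qq ..
  qed simp
  have fac: "Inv ((1 - ?x * qq ^ k) * (1 - ?y * qq ^ k))" for k
  proof -
    have "(1 - ?x * qq ^ k) * (1 - ?y * qq ^ k) =
      1 - (bimonom \<alpha> i j + bimonom \<alpha> i' j') * qq ^ k + bimonom (\<alpha> * \<alpha>) (i + i') (j + j') * (qq ^ k * qq ^ k)"
      by (simp add: algebra_simps flip: bimonom_mult)
    moreover have "Inv (qq ^ k :: 'k fps fps)"
      unfolding bimonom_power by (rule Inv_bimonom_fixed) (use kq in simp)
    moreover have "Inv (bimonom (\<alpha> * \<alpha>) (i + i') (j + j'))"
    proof (rule Inv_bimonom_fixed)
      have e: "(int (i + i'), int (j + j')) = (int i, int j) + (int i', int j')" by simp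
      have "\<tau> (int i', int j') = (int i, int j)" using \<tau> \<tau>_\<tau> by metis
      thus "\<tau> (int (i + i'), int (j + j')) = (int (i + i'), int (j + j'))"
        unfolding e \<tau>_add \<tau> by (simp add: add.commute)
    qed
    ultimately show ?thesis
      by (simp only:) (intro Inv_add Inv_diff Inv_1 Inv_mult Inv_bimonom_pair[OF \<tau>])
  qed
  show ?thesis unfolding Inv_def
  proof
    fix p
    \<comment> \<open>Large enough for the truncated products to give the right coefficients at both
      \<open>p\<close> and \<open>\<tau> p\<close>.\<close>
    define n where "n = nat (snd p) + nat (snd (\<tau> p))"
    define F where "F = (\<Prod>k\<le>n. 1 - ?x * qq ^ k) * (\<Prod>k\<le>n. 1 - ?y * qq ^ k)"
    have F: "Inv F" unfolding F_def prod.distrib[symmetric] by (rule Inv_prod) (rule fac)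
    have "fps_nth (qpochhammer_inf ?x qq * qpochhammer_inf ?y qq) m = fps_nth F m" if "m \<le> n" for m
      unfolding F_def fps_mult_nth
      by (rule sum.cong) (use that in \<open>simp_all add: qp_nth[OF x0, of _ n] qp_nth[OF y0, of _ n]\<close>)
    hence key: "cf (qpochhammer_inf ?x qq * qpochhammer_inf ?y qq) p' = cf F p'" if "snd p' \<le> int n" for p'
      using that by (cases p') (auto simp: cf_def nat_le_iff)
    have N: "x \<le> int (nat x)" "0 \<le> int (nat x)" for x by auto
    have b: "snd p \<le> int n" "snd (\<tau> p) \<le> int n"
      unfolding n_def of_nat_add using N[of "snd p"] N[of "snd (\<tau> p)"] by linarith+
    have "cf F (\<tau> p) = cf F p" using F unfolding Inv_def by blast
    thus "cf (qpochhammer_inf ?x qq * qpochhammer_inf ?y qq) (\<tau> p) =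
        cf (qpochhammer_inf ?x qq * qpochhammer_inf ?y qq) p"
      by (simp only: key[OF b(1)] key[OF b(2)])
  qed
qed

text \<open>\<open>f\<close> is \<open>M / D\<close> with \<open>D\<close> of constant term
  \<open>1\<close>, a geometric series of which every coefficient needs only a finite, invariant
  part. One cannot simply reflect the equation, since the reflection of a power series need not be
  one.\<close>

lemma Inv_cancel:
  fixes f :: "'k::idom fps fps"
  assumes "f * D = M" "Inv D" "Inv M" "cf D (0, 0) = 1"
  shows "Inv f"
  unfolding Inv_def
proof
  fix p
  define H where "H = 1 - D"
  \<comment> \<open>Exceeds the total degrees of \<open>p\<close> and \<open>\<tau> p\<close>, so
    that the remainder \<open>f * H ^ n\<close> contributes to neither coefficient.\<close>
  define n where "n = nat (fst p + snd p) + nat (fst (\<tau> p) + snd (\<tau> p)) + 1"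
  have f: "f = M * (\<Sum>k<n. H ^ k) + f * H ^ n" for n
  proof (induction n)
    case (Suc n)
    have fH: "f = M + f * H" using assms(1) by (simp add: H_def algebra_simps)
    have "f = M * (\<Sum>k<n. H ^ k) + (M + f * H) * H ^ n" using Suc fH by metis
    also have "\<dots> = M * (\<Sum>k<Suc n. H ^ k) + f * H ^ Suc n"
      by (simp add: distrib_left distrib_right mult.assoc add.assoc)
    finally show ?case .
  qed simp
  have H: "Inv H" "cf H (0, 0) = 0" using assms by (auto simp: H_def Inv_1 Inv_diff cf_diff cf_1)
  have I: "Inv (M * (\<Sum>k<n. H ^ k))" using assms H by (intro Inv_mult Inv_sum Inv_power)
  have key: "cf f p' = cf (M * (\<Sum>k<n. H ^ k)) p'" if "fst p' + snd p' < int n" for p'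
    by (subst f[of n]) (simp add: cf_add cf_power_low[OF H(2) that])
  have N: "x \<le> int (nat x)" "0 \<le> int (nat x)" for x by auto
  have b: "fst p + snd p < int n" "fst (\<tau> p) + snd (\<tau> p) < int n"
    unfolding n_def of_nat_add of_nat_1 using N[of "fst p + snd p"] N[of "fst (\<tau> p) + snd (\<tau> p)"] by linarith+
  have "cf (M * (\<Sum>k<n. H ^ k)) (\<tau> p) = cf (M * (\<Sum>k<n. H ^ k)) p"
    using I unfolding Inv_def by blast
  thus "cf f (\<tau> p) = cf f p" by (simp only: key[OF b(1)] key[OF b(2)])
qed

end

text \<open>\<open>z^i y^j\<close> stands for \<open>z^(i-j)\<close> times the \<open>j\<close>-th
  power of \<open>\<surd>q\<close>. Replacing \<open>z\<close> by \<open>1/z\<close> keeps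
  \<open>j\<close> and negates \<open>i - j\<close>; replacing \<open>z\<close> by
  \<open>q/z\<close>, which is \<open>refl_w\<close>, negates \<open>i - j\<close> and keeps
  \<open>i\<close>.\<close>

interpretation refl_z: reflection "\<lambda>(i, j). (2 * j - i, j)"
  by unfold_locales auto

interpretation refl_w: reflection "\<lambda>(i, j). (i, 2 * i - j)"
  by unfold_locales auto

text \<open>Collects the terms \<open>z^i y^j\<close> with \<open>i - j = n\<close> into a power
  series in \<open>\<surd>q\<close>.\<close>

definition Bil :: "'k::comm_ring_1 fps fps \<Rightarrow> int \<Rightarrow> 'k fps" where
  "Bil f n = Abs_fps (\<lambda>j. cf f (n + int j, int j))"

lemma Bil_nth [simp]: "fps_nth (Bil f n) j = cf f (n + int j, int j)"
  by (simp add: Bil_def)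

lemma Bil_add: "Bil (f + g) n = Bil f n + Bil g n" and Bil_diff: "Bil (f - g) n = Bil f n - Bil g n"
  by (rule fps_ext; simp add: cf_add cf_diff)+

lemma Bil_bimonom: "Bil (bimonom \<alpha> i j * f) n = fps_const \<alpha> * (fps_X ^ j * Bil f (n - int i + int j))"
proof (rule fps_ext)
  fix t
  show "fps_nth (Bil (bimonom \<alpha> i j * f) n) t = fps_nth (fps_const \<alpha> * (fps_X ^ j * Bil f (n - int i + int j))) t"
  proof (cases "t < j")
    case True
    thus ?thesis by (simp add: cf_bimonom_mult fps_X_power_mult_nth cf_neg)
  next
    case False
    hence e: "(n - int i + int j + int (t - j), int (t - j)) = (n + int t, int t) - (int i, int j)"
      by (simp add: of_nat_diff)
    have "fps_nth (fps_const \<alpha> * (fps_X ^ j * Bil f (n - int i + int j))) t =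
        \<alpha> * cf f (n - int i + int j + int (t - j), int (t - j))"
      using False by (simp only: fps_mult_left_const_nth fps_X_power_mult_nth if_False Bil_nth)
    thus ?thesis by (simp only: Bil_nth cf_bimonom_mult e)
  qed
qed

lemma weight_coeff_eq: "weight_coeff n = Bil weight_series n"
  by (rule fps_ext) (simp add: weight_coeff_def cf_def)

abbreviation qp :: "'k::idom \<Rightarrow> nat \<Rightarrow> nat \<Rightarrow> 'k fps fps" where
  "qp \<alpha> i j \<equiv> qpochhammer_inf (bimonom \<alpha> i j) qq"

lemma qp_bimonom_00: "(i, j) \<noteq> (0, 0) \<Longrightarrow> cf (qp \<alpha> i j) (0, 0) = 1"
  by (rule qp_00) (auto simp: cf_bimonom)

lemma qp_bimonom_rec: "(i, j) \<noteq> (0, 0) \<Longrightarrow> qp \<alpha> i j = (1 - bimonom \<alpha> i j) * qp \<alpha> (i + 2) (j + 2)"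
  by (subst qp_rec) (auto simp: cf_bimonom bimonom_mult)

text \<open>The exponents follow from \<open>z y = \<surd>q\<close>: as \<open>coef_c\<close> is
  \<open>c / \<surd>q\<close>, the monomial \<open>c z\<close> has exponents \<open>(2, 1)\<close>
  and \<open>c / z\<close> has \<open>(0, 1)\<close>, whereas \<open>a q / z\<close> has
  \<open>(1, 2)\<close>.\<close>

definition weight_den :: "ratfun4 fps fps" where
  "weight_den = qp coef_a 1 0 * qp coef_b 1 0 * qp coef_c 2 1 * qp coef_d 2 1 *
                qp coef_a 1 2 * qp coef_b 1 2 * qp coef_c 0 1 * qp coef_d 0 1"

lemma weight_series_eq: "weight_series = qp 1 2 0 * qp 1 0 2 * inverse weight_den"
proof -
  have z: "fps_const fps_X = bimonom (1::ratfun4) 1 0" and y: "fps_X = bimonom (1::ratfun4) 0 1"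
    and C: "fps_const (fps_const x) = bimonom x 0 0" for x :: ratfun4
    by (simp_all add: bimonom_def)
  have e: "bimonom 1 1 0 * bimonom 1 0 1 = bimonom (1::ratfun4) 1 1" "bimonom 1 1 1 ^ 2 = (qq :: ratfun4 fps fps)"
    "bimonom 1 1 0 ^ 2 = bimonom (1::ratfun4) 2 0" "bimonom 1 0 1 ^ 2 = bimonom (1::ratfun4) 0 2"
    by (simp_all add: bimonom_mult bimonom_power)
  have c: "bimonom x 0 0 * bimonom 1 1 0 = bimonom x 1 0" "bimonom x 0 0 * bimonom 1 1 1 = bimonom x 1 1"
    "bimonom x 1 1 * bimonom 1 1 0 = bimonom x 2 1" "bimonom x 1 1 * bimonom 1 0 1 = bimonom x 1 2"
    "bimonom x 0 0 * bimonom 1 0 1 = bimonom x 0 1" for x :: ratfun4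
    unfolding bimonom_mult by (simp_all only: mult_1_right add_0 add_0_right one_add_one)
  show ?thesis
    unfolding weight_series_def Let_def weight_den_def z unfolding y C e c ..
qed


section \<open>The constant term functional\<close>

lemma weight_den_00: "cf weight_den (0, 0) = 1"
  by (simp add: weight_den_def cf_mult_00 qp_bimonom_00)

lemma weight_den_inverse: "weight_den * inverse weight_den = 1"
  by (rule fps_right_inverse_unit[OF weight_den_00])

text \<open>The weight without the factor \<open>1 - z^2\<close>. Removing also the denominators
  \<open>1 - az\<close> and \<open>1 - bz\<close> gives \<open>weight_E\<close>, symmetric under
  \<open>z -> 1/z\<close>. The weight times \<open>(1 - c/z) (1 - d/z)\<close>, divided by
  \<open>1 - q/z^2\<close>, is \<open>weight_G\<close>, symmetric under
  \<open>z -> q/z\<close>.\<close>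

definition weight_V :: "ratfun4 fps fps" where
  "weight_V = qp 1 4 2 * qp 1 0 2 * inverse weight_den"

definition weight_E :: "ratfun4 fps fps" where
  "weight_E = (1 - bimonom coef_a 1 0) * (1 - bimonom coef_b 1 0) * weight_V"

definition weight_G :: "ratfun4 fps fps" where
  "weight_G = qp 1 2 0 * qp 1 2 4 * ((1 - bimonom coef_c 0 1) * (1 - bimonom coef_d 0 1) * inverse weight_den)"

lemma qp_bimonom_rec':
  "(i, j) \<noteq> (0, 0) \<Longrightarrow> i' = i + 2 \<Longrightarrow> j' = j + 2 \<Longrightarrow> qp \<alpha> i j = (1 - bimonom \<alpha> i j) * qp \<alpha> i' j'"
  using qp_bimonom_rec by blast

lemma weight_series_V: "weight_series = (1 - bimonom 1 2 0) * weight_V"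
proof -
  have "qp (1::ratfun4) 2 0 = (1 - bimonom 1 2 0) * qp 1 4 2"
    by (rule qp_bimonom_rec') simp_all
  thus ?thesis by (simp only: weight_series_eq weight_V_def mult_ac)
qed

lemma weight_series_G:
  "(1 - bimonom coef_c 0 1) * (1 - bimonom coef_d 0 1) * weight_series = (1 - bimonom 1 0 2) * weight_G"
proof -
  have "qp (1::ratfun4) 0 2 = (1 - bimonom 1 0 2) * qp 1 2 4"
    by (rule qp_bimonom_rec') simp_all
  thus ?thesis by (simp only: weight_series_eq weight_G_def mult_ac)
qed

lemma Inv_weight_E: "refl_z.Inv weight_E"
proof -
  \<comment> \<open>The denominators that survive, grouped into pairs exchanged by the reflection;
    the same is done for \<open>z -> q/z\<close> in the next lemma.\<close>
  define D where "D = (qp coef_a 3 2 * qp coef_a 1 2) * (qp coef_b 3 2 * qp coef_b 1 2) *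
    (qp coef_c 2 1 * qp coef_c 0 1) * (qp coef_d 2 1 * qp coef_d 0 1)"
  have ab: "qp x 1 0 = (1 - bimonom x 1 0) * qp x 3 2" for x :: ratfun4
    by (rule qp_bimonom_rec') simp_all
  have "weight_den = (1 - bimonom coef_a 1 0) * (1 - bimonom coef_b 1 0) * D"
    unfolding weight_den_def D_def ab by (simp only: mult_ac)
  moreover have "weight_E * D = qp 1 4 2 * qp 1 0 2 * (((1 - bimonom coef_a 1 0) * (1 - bimonom coef_b 1 0) * D) * inverse weight_den)"
    by (simp only: weight_E_def weight_V_def mult_ac)
  ultimately have "weight_E * D = qp 1 4 2 * qp 1 0 2 * (weight_den * inverse weight_den)"
    by simp
  hence "weight_E * D = qp 1 4 2 * qp 1 0 2" by (simp only: weight_den_inverse mult_1_right)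
  thus ?thesis
  proof (rule refl_z.Inv_cancel)
    show "refl_z.Inv D" unfolding D_def by (intro refl_z.Inv_mult refl_z.Inv_qp_pair) auto
    show "refl_z.Inv (qp (1::ratfun4) 4 2 * qp 1 0 2)" by (rule refl_z.Inv_qp_pair) auto
    show "cf D (0, 0) = 1" by (simp add: D_def cf_mult_00 qp_bimonom_00)
  qed
qed

lemma Inv_weight_G: "refl_w.Inv weight_G"
proof -
  define D where "D = (qp coef_a 1 0 * qp coef_a 1 2) * (qp coef_b 1 0 * qp coef_b 1 2) *
    (qp coef_c 2 1 * qp coef_c 2 3) * (qp coef_d 2 1 * qp coef_d 2 3)"
  have cd: "qp x 0 1 = (1 - bimonom x 0 1) * qp x 2 3" for x :: ratfun4
    by (rule qp_bimonom_rec') simp_all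
  have "weight_den = (1 - bimonom coef_c 0 1) * (1 - bimonom coef_d 0 1) * D"
    unfolding weight_den_def D_def cd by (simp only: mult_ac)
  moreover have "weight_G * D = qp 1 2 0 * qp 1 2 4 * (((1 - bimonom coef_c 0 1) * (1 - bimonom coef_d 0 1) * D) * inverse weight_den)"
    by (simp only: weight_G_def mult_ac)
  ultimately have "weight_G * D = qp 1 2 0 * qp 1 2 4 * (weight_den * inverse weight_den)"
    by simp
  hence "weight_G * D = qp 1 2 0 * qp 1 2 4" by (simp only: weight_den_inverse mult_1_right)
  thus ?thesis
  proof (rule refl_w.Inv_cancel)
    show "refl_w.Inv D" unfolding D_def by (intro refl_w.Inv_mult refl_w.Inv_qp_pair) auto
    show "refl_w.Inv (qp (1::ratfun4) 2 0 * qp 1 2 4)" by (rule refl_w.Inv_qp_pair) auto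
    show "cf D (0, 0) = 1" by (simp add: D_def cf_mult_00 qp_bimonom_00)
  qed
qed

lemma weight_E_00: "cf weight_E (0, 0) = 1"
proof -
  have "cf (inverse weight_den) (0, 0) = 1"
    using arg_cong[OF weight_den_inverse, of "\<lambda>f. cf f (0, 0)"]
    by (simp add: cf_mult_00 weight_den_00 cf_1)
  thus ?thesis
    by (simp add: weight_E_def weight_V_def cf_mult_00 qp_bimonom_00 cf_diff cf_1 cf_bimonom)
qed

definition bV :: "int \<Rightarrow> ratfun4 fps" where "bV = Bil weight_V"
definition bW :: "int \<Rightarrow> ratfun4 fps" where "bW = Bil weight_series"
definition bE :: "int \<Rightarrow> ratfun4 fps" where "bE = Bil weight_E"
definition bG :: "int \<Rightarrow> ratfun4 fps" where "bG = Bil weight_G"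

lemma Bil_1_minus_bimonom: "Bil ((1 - bimonom \<alpha> i j) * f) n = Bil f n - fps_const \<alpha> * (fps_X ^ j * Bil f (n - int i + int j))"
  by (simp add: left_diff_distrib Bil_diff Bil_bimonom)

lemma bW_V: "bW n = bV n - bV (n - 2)"
  by (simp add: bW_def bV_def weight_series_V Bil_1_minus_bimonom)

lemma bE_V: "bE n = bV n - fps_const (coef_a + coef_b) * bV (n - 1) + fps_const (coef_a * coef_b) * bV (n - 2)"
  unfolding bE_def bV_def weight_E_def mult.assoc Bil_1_minus_bimonom
  by (simp add: algebra_simps flip: fps_const_add fps_const_mult)

lemma bE_minus: "bE (- n) = bE n"
proof (rule fps_ext)
  fix j
  have "cf weight_E ((\<lambda>(i, j). (2 * j - i, j)) (n + int j, int j)) = cf weight_E (n + int j, int j)"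
    using Inv_weight_E unfolding refl_z.Inv_def by blast
  thus "fps_nth (bE (- n)) j = fps_nth (bE n) j" by (simp add: bE_def algebra_simps)
qed

lemma bG_W: "bG n - fps_X ^ 2 * bG (n + 2) =
    bW n - fps_const (coef_c + coef_d) * (fps_X * bW (n + 1)) + fps_const (coef_c * coef_d) * (fps_X ^ 2 * bW (n + 2))"
proof -
  have "bG n - fps_X ^ 2 * bG (n + 2) = Bil ((1 - bimonom 1 0 2) * weight_G) n"
    by (simp add: bG_def Bil_1_minus_bimonom)
  also have "\<dots> = Bil ((1 - bimonom coef_c 0 1) * (1 - bimonom coef_d 0 1) * weight_series) n"
    by (simp only: weight_series_G)
  also have "\<dots> = bW n - fps_const (coef_c + coef_d) * (fps_X * bW (n + 1)) + fps_const (coef_c * coef_d) * (fps_X ^ 2 * bW (n + 2))"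
    unfolding mult.assoc Bil_1_minus_bimonom bW_def
    by (simp add: algebra_simps power2_eq_square flip: fps_const_add fps_const_mult)
  finally show ?thesis .
qed

text \<open>Replacing \<open>z\<close> by \<open>q/z\<close> multiplies the coefficient of
  \<open>z^n\<close> by \<open>q^n\<close>, here \<open>fps_X ^ (2 * n)\<close>. For
  \<open>j < 2 * n\<close> the reflected exponent lies outside the quadrant.\<close>

lemma bG_minus: "bG (- int n) = fps_X ^ (2 * n) * bG (int n)"
proof (rule fps_ext)
  fix j
  have I: "cf weight_G ((\<lambda>(i, j). (i, 2 * i - j)) p) = cf weight_G p" for p
    using Inv_weight_G unfolding refl_w.Inv_def by blast
  show "fps_nth (bG (- int n)) j = fps_nth (fps_X ^ (2 * n) * bG (int n)) j"
  proof (cases "j < 2 * n")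
    case True
    thus ?thesis using I[of "(int j - int n, int j)"] by (simp add: bG_def fps_X_power_mult_nth cf_neg)
  next
    case False
    have "(\<lambda>(i, j). (i, 2 * i - j)) (- int n + int j, int j) = (int n + int (j - 2 * n), int (j - 2 * n))"
      using False by (simp add: of_nat_diff)
    thus ?thesis using I[of "(- int n + int j, int j)"] False
      by (simp add: bG_def fps_X_power_mult_nth)
  qed
qed

text \<open>At \<open>\<surd>q = 0\<close> no negative powers of \<open>z\<close> remain, and by
  symmetry under \<open>z -> 1/z\<close> no positive ones either.\<close>

lemma bE_nth_0: "fps_nth (bE n) 0 = (if n = 0 then 1 else 0)"
proof -
  have neg: "fps_nth (bE n) 0 = 0" if "n < 0" for n using that by (simp add: bE_def cf_neg)
  show ?thesis
  proof (cases n "0::int" rule: linorder_cases)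
    case greater
    thus ?thesis using neg[of "- n"] by (simp add: bE_minus)
  qed (simp_all add: neg, simp add: bE_def weight_E_00)
qed

text \<open>Realises \<open>\<surd>q = u^N\<close> and passes to the field in which the pairing
  takes its values.\<close>

definition toF :: "nat \<Rightarrow> ratfun4 fps \<Rightarrow> ratfun4 fls" where
  "toF N f = fps_to_fls (fps_compose f (fps_X ^ N))"

lemma ring_homo_toF: "N > 0 \<Longrightarrow> ring_homo (toF N)"
  by unfold_locales
     (simp_all add: toF_def fps_compose_add_distrib fps_compose_mult_distrib fls_times_fps_to_fls)

lemma toF_const: "toF N (fps_const c) = fls_const c"
  by (simp add: toF_def)

lemma toF_X: "N > 0 \<Longrightarrow> toF N fps_X = fls_X ^ N"
  by (simp add: toF_def fps_to_fls_power)

definition wV :: "nat \<Rightarrow> int \<Rightarrow> ratfun4 fls" where "wV N n = toF N (bV n)"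
definition wW :: "nat \<Rightarrow> int \<Rightarrow> ratfun4 fls" where "wW N n = toF N (bW n)"
definition wE :: "nat \<Rightarrow> int \<Rightarrow> ratfun4 fls" where "wE N n = toF N (bE n)"
text \<open>The factor \<open>1 - q/z^2\<close> is put back, so that this is the coefficient
  sequence of the weight times \<open>(1 - c/z) (1 - d/z)\<close>.\<close>

definition wG :: "nat \<Rightarrow> int \<Rightarrow> ratfun4 fls" where "wG N n = toF N (bG n - fps_X ^ 2 * bG (n + 2))"

lemma field_homo_embed: "field_homo (embed N)"
  unfolding embed_def by (rule field_homo_rat_eval[OF lin_indep_embed])

lemma fls_const_power: "fls_const (x ^ n) = fls_const (x::'a::comm_ring_1) ^ n"
  by (induction n) (simp_all flip: fls_const_mult_const)

lemma ring_homo_fls_const: "ring_homo (fls_const :: 'a::comm_ring_1 \<Rightarrow> _)"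
  by unfold_locales (simp_all add: fls_plus_const fls_const_mult_const)

lemma embed_gens:
  "embed N par_a = fls_const coef_a" "embed N par_b = fls_const coef_b"
  "embed N par_c = fls_const coef_c * fls_X ^ N" "embed N par_d = fls_const coef_d * fls_X ^ N"
  "embed N q_root = fls_X"
proof -
  interpret E: field_homo "embed N" by (rule field_homo_embed)
  interpret K: ring_homo "fls_const :: ratfun4 \<Rightarrow> _" by (rule ring_homo_fls_const)
  note g = rat_eval_sqrt_mab[OF lin_indep_embed, of N, folded embed_def]
    rat_eval_par_b[OF lin_indep_embed, of N, folded embed_def]
    rat_eval_sqrt_mcd[OF lin_indep_embed, of N, folded embed_def]
    rat_eval_par_d[OF lin_indep_embed, of N, folded embed_def]
  show "embed N par_b = fls_const coef_b" "embed N par_d = fls_const coef_d * fls_X ^ N" by (fact g)+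
  show "embed N q_root = fls_X"
    by (rule rat_eval_q_root[OF lin_indep_embed, of N, folded embed_def])
  have "embed N par_a * embed N par_b = fls_const coef_a * embed N par_b"
  proof -
    have "par_a * par_b = - (sqrt_mab ^ 2)" by (simp add: par_a_def)
    hence "embed N (par_a * par_b) = - (fls_const (coef_sab ^ 2))"
      by (simp only: E.uminus E.power g fls_const_power)
    hence "embed N par_a * embed N par_b = - (fls_const (coef_sab ^ 2))"
      by (simp only: E.mult)
    moreover have "coef_sab ^ 2 = - (coef_a * coef_b)" by (simp add: coef_a_def)
    ultimately show ?thesis
      by (simp only: g K.mult K.uminus minus_minus)
  qed
  thus "embed N par_a = fls_const coef_a" by simp
  have "embed N par_c * embed N par_d = fls_const coef_c * fls_X ^ N * embed N par_d"
  proof -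
    have "par_c * par_d = - (sqrt_mcd ^ 2)" by (simp add: par_c_def)
    hence "embed N (par_c * par_d) = - ((fls_const coef_scd * fls_X ^ N) ^ 2)"
      by (simp only: E.uminus E.power g)
    hence "embed N par_c * embed N par_d = - (fls_const (coef_scd ^ 2) * (fls_X ^ N * fls_X ^ N))"
      by (simp only: E.mult fls_const_power power_mult_distrib) (simp only: power2_eq_square)
    moreover have "coef_scd ^ 2 = - (coef_c * coef_d)" by (simp add: coef_c_def)
    ultimately show ?thesis
      by (simp only: g K.mult K.uminus minus_minus mult_minus_left mult_minus_right mult_ac)
  qed
  thus "embed N par_c = fls_const coef_c * fls_X ^ N" by simp
qed

lemma wW_V: "wW N n = wV N n - wV N (n - 2)" if "N > 0"
proof -
  interpret ring_homo "toF N" by (rule ring_homo_toF) fact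
  show ?thesis by (simp add: wW_def wV_def bW_V diff)
qed

lemma wE_V: "wE N n = wV N n - embed N (par_a + par_b) * wV N (n - 1) + embed N (par_a * par_b) * wV N (n - 2)"
  if "N > 0"
proof -
  interpret ring_homo "toF N" by (rule ring_homo_toF) fact
  interpret E: field_homo "embed N" by (rule field_homo_embed)
  show ?thesis
    by (simp add: wE_def wV_def bE_V diff add mult toF_const E.add E.mult embed_gens fls_plus_const fls_const_mult_const)
qed

lemma wE_minus: "wE N (- n) = wE N n"
  by (simp add: wE_def bE_minus)

lemma wG_W: "wG N n = wW N n - embed N (par_c + par_d) * wW N (n + 1) + embed N (par_c * par_d) * wW N (n + 2)"
  if "N > 0"
proof -
  interpret ring_homo "toF N" by (rule ring_homo_toF) fact
  interpret E: field_homo "embed N" by (rule field_homo_embed)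
  interpret K: ring_homo "fls_const :: ratfun4 \<Rightarrow> _" by (rule ring_homo_fls_const)
  have "wG N n = wW N n - fls_const (coef_c + coef_d) * (fls_X ^ N * wW N (n + 1)) +
      fls_const (coef_c * coef_d) * ((fls_X ^ N) ^ 2 * wW N (n + 2))"
    by (simp add: wG_def wW_def bG_W diff add mult toF_const toF_X[OF that] power)
  thus ?thesis
    by (simp only: E.add E.mult embed_gens K.add K.mult power2_eq_square distrib_right distrib_left mult_ac)
qed

text \<open>Under \<open>z -> q/z\<close> the series \<open>weight_G\<close> is fixed while
  \<open>1 - q/z^2\<close> is multiplied by \<open>- z^2/q\<close>. Hence the series is odd up to a
  monomial.\<close>

lemma wG_minus: "wG N (- m) = - (embed N (q_root powi (2 * int N * (m - 1))) * wG N (m - 2))" if N: "N > 0"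
proof -
  interpret ring_homo "toF N" by (rule ring_homo_toF) fact
  interpret E: field_homo "embed N" by (rule field_homo_embed)
  define R where "R = (fls_X ^ N :: ratfun4 fls)"
  have R0: "R \<noteq> 0" by (simp add: R_def)
  define g where "g n = toF N (bG n)" for n
  have G: "wG N n = g n - R ^ 2 * g (n + 2)" for n
    by (simp add: wG_def g_def diff mult power toF_X[OF N] R_def)
  have gn: "g (- int n) = R powi (2 * int n) * g (int n)" for n
    by (simp add: g_def bG_minus mult power toF_X[OF N] R_def[symmetric] power_int_mult)
       (simp add: power_mult)
  have g: "g (- n) = R powi (2 * n) * g n" for n
  proof (cases n)
    case (nonneg k)
    thus ?thesis using gn[of k] by simp
  next
    case (neg k)
    define K where "K = int (Suc k)"
    have "R powi (- 2 * K) * R powi (2 * K) = 1"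
      using R0 by (subst power_int_add[symmetric]) simp_all
    moreover have "g (- K) = R powi (2 * K) * g K" unfolding K_def by (rule gn)
    ultimately have "R powi (- 2 * K) * g (- K) = g K" by (simp add: mult.assoc[symmetric])
    thus ?thesis using neg by (simp add: K_def add.commute)
  qed
  have "embed N (q_root powi (2 * int N * (m - 1))) = R powi (2 * (m - 1))"
  proof -
    have "R powi (2 * (m - 1)) = (fls_X powi int N) powi (2 * (m - 1))" by (simp add: R_def)
    also have "\<dots> = fls_X powi (int N * (2 * (m - 1)))" by (rule power_int_mult[symmetric])
    also have "int N * (2 * (m - 1)) = 2 * int N * (m - 1)" by (simp only: mult_ac)
    finally show ?thesis unfolding E.powi embed_gens ..
  qed
  moreover have "wG N (- m) = - (R powi (2 * (m - 1)) * wG N (m - 2))"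
  proof -
    have "g (- m + 2) = R powi (2 * (m - 2)) * g (m - 2)" using g[of "m - 2"] by simp
    moreover have "R powi (2 * m) = R powi (2 * (m - 1)) * R ^ 2"
      using power_int_add[of R "2 * (m - 1)" 2] R0 by (simp add: algebra_simps)
    moreover have "R ^ 2 * R powi (2 * (m - 2)) = R powi (2 * (m - 1))"
      using power_int_add[of R 2 "2 * (m - 2)"] R0 by (simp add: algebra_simps)
    ultimately show ?thesis unfolding G g by (simp add: algebra_simps)
  qed
  ultimately show ?thesis by simp
qed

text \<open>Constant term of \<open>f\<close> times the formal series with coefficients
  \<open>B\<close>. Only \<open>f\<close> is finite, so no product of two series infinite in both
  directions is ever formed.\<close>

definition phi :: "nat \<Rightarrow> (int \<Rightarrow> ratfun4 fls) \<Rightarrow> laurent \<Rightarrow> ratfun4 fls" where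
  "phi N B f = (\<Sum>n\<in>Poly_Mapping.keys f. embed N (Poly_Mapping.lookup f n) * B (- n))"

lemma ct_weight_phi: "ct_weight N f = phi N (wW N) f"
  by (simp add: ct_weight_def phi_def wW_def toF_def bW_def weight_coeff_eq)

lemma phi_superset:
  assumes "finite A" "Poly_Mapping.keys f \<subseteq> A"
  shows "phi N B f = (\<Sum>n\<in>A. embed N (Poly_Mapping.lookup f n) * B (- n))"
proof -
  interpret E: field_homo "embed N" by (rule field_homo_embed)
  show ?thesis unfolding phi_def
    by (rule sum.mono_neutral_left) (use assms in \<open>auto simp: in_keys_iff\<close>)
qed

lemma phi_add: "phi N B (f + g) = phi N B f + phi N B g"
proof -
  interpret E: field_homo "embed N" by (rule field_homo_embed)
  let ?A = "Poly_Mapping.keys f \<union> Poly_Mapping.keys g"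
  have "phi N B (f + g) = (\<Sum>n\<in>?A. embed N (Poly_Mapping.lookup (f + g) n) * B (- n))"
    by (rule phi_superset) (use keys_add[of f g] in auto)
  also have "\<dots> = phi N B f + phi N B g"
    by (subst (1 2) phi_superset[of ?A]) (auto simp: lookup_add E.add distrib_right sum.distrib)
  finally show ?thesis .
qed

lemma phi_0 [simp]: "phi N B 0 = 0"
  by (simp add: phi_def)

lemma phi_uminus: "phi N B (- f) = - phi N B f"
  using phi_add[of N B f "- f"] by (simp add: eq_neg_iff_add_eq_0 add.commute)

lemma phi_diff: "phi N B (f - g) = phi N B f - phi N B g"
  using phi_add[of N B f "- g"] by (simp add: phi_uminus)

lemma phi_sum: "phi N B (sum f A) = (\<Sum>x\<in>A. phi N B (f x))"
  by (rule additive_sum) (rule phi_add)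

lemma phi_single_mult: "phi N B (Poly_Mapping.single k c * f) = embed N c * phi N (\<lambda>n. B (n - k)) f"
proof -
  interpret E: field_homo "embed N" by (rule field_homo_embed)
  let ?A = "(\<lambda>n. n + k) ` Poly_Mapping.keys f"
  have "phi N B (Poly_Mapping.single k c * f) =
      (\<Sum>n\<in>?A. embed N (Poly_Mapping.lookup (Poly_Mapping.single k c * f) n) * B (- n))"
  proof (rule phi_superset)
    show "Poly_Mapping.keys (Poly_Mapping.single k c * f) \<subseteq> ?A"
      by (auto simp: in_keys_iff lookup_single_mult image_iff intro!: bexI[of _ "_ - k"])
  qed auto
  also have "\<dots> = (\<Sum>n\<in>Poly_Mapping.keys f. embed N c * (embed N (Poly_Mapping.lookup f n) * B (- n - k)))"
  proof (subst sum.reindex)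
    have "- (n + k) = - n - k" for n by simp
    thus "sum ((\<lambda>n. embed N (Poly_Mapping.lookup (Poly_Mapping.single k c * f) n) * B (- n)) \<circ> (\<lambda>n. n + k))
        (Poly_Mapping.keys f) = (\<Sum>n\<in>Poly_Mapping.keys f. embed N c * (embed N (Poly_Mapping.lookup f n) * B (- n - k)))"
      by (simp only: comp_def lookup_single_mult E.mult mult.assoc add_diff_cancel_right')
  qed (simp add: inj_on_def)
  finally show ?thesis by (simp add: phi_def sum_distrib_left)
qed

lemma phi_fun_add: "phi N (\<lambda>n. B n + B' n) f = phi N B f + phi N B' f"
  and phi_fun_diff: "phi N (\<lambda>n. B n - B' n) f = phi N B f - phi N B' f"
  and phi_fun_mult: "phi N (\<lambda>n. x * B n) f = x * phi N B f"
  by (simp_all add: phi_def distrib_left right_diff_distrib sum.distrib sum_subtractf sum_distrib_left mult_ac)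

abbreviation lrev :: "laurent \<Rightarrow> laurent" where "lrev \<equiv> Poly_Mapping.map_key uminus"
abbreviation lconst :: "ratfun5 \<Rightarrow> laurent" where "lconst \<equiv> Poly_Mapping.single 0"
abbreviation lX :: laurent where "lX \<equiv> Poly_Mapping.single 1 1"
abbreviation lY :: laurent where "lY \<equiv> Poly_Mapping.single (-1) 1"

lemma lXY: "lX * lY = 1"
  by (simp add: mult_single)

lemma ring_homo_lrev: "ring_homo lrev"
proof
  show "lrev (f + g) = lrev f + lrev g" for f g
    by (rule poly_mapping_eqI) (simp add: lookup_add)
  have "lz (lrev (f * g)) = lz (lrev f * lrev g)" for f g
    by (simp only: zinv_lz[symmetric] lz.mult zinv.mult)
  thus "lrev (f * g) = lrev f * lrev g" for f g by (simp only: lz_eq_iff)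
  show "lrev 1 = 1" by (rule poly_mapping_eqI) (simp add: lookup_one when_def)
qed

lemma lrev_gens [simp]: "lrev (lconst c) = lconst c" "lrev lX = lY" "lrev lY = lX"
  by (rule poly_mapping_eqI; auto simp: lookup_single when_def)+

lemma phi_lrev: "(\<And>n. B (- n) = B n) \<Longrightarrow> phi N B (lrev f) = phi N B f"
proof -
  assume B: "\<And>n. B (- n) = B n"
  have "phi N B (lrev f) = (\<Sum>n\<in>uminus ` Poly_Mapping.keys f. embed N (Poly_Mapping.lookup (lrev f) n) * B (- n))"
    by (rule phi_superset) (auto simp: in_keys_iff image_iff intro!: bexI[of _ "- _"])
  also have "\<dots> = phi N B f"
    by (subst sum.reindex) (auto simp: B phi_def)
  finally show ?thesis .
qed

definition lN :: laurent where
  "lN = (1 - lconst par_a * lX) * (1 - lconst par_b * lX) * (1 - lconst par_c * lX) * (1 - lconst par_d * lX) * (lY * lY)"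

lemma phi_W: "N > 0 \<Longrightarrow> phi N (wW N) f = phi N (wV N) ((1 - lX * lX) * f)"
proof -
  assume N: "N > 0"
  interpret E: field_homo "embed N" by (rule field_homo_embed)
  have "(1 - lX * lX) * f = f - Poly_Mapping.single 2 1 * f" by (simp add: left_diff_distrib mult_single)
  moreover have "wW N = (\<lambda>n. wV N n - wV N (n - 2))" by (rule ext) (rule wW_V[OF N])
  ultimately show ?thesis by (simp add: phi_diff phi_single_mult phi_fun_diff)
qed

lemma phi_E: "N > 0 \<Longrightarrow> phi N (wV N) ((1 - lconst par_a * lX) * (1 - lconst par_b * lX) * f) = phi N (wE N) f"
proof -
  assume N: "N > 0"
  interpret E: field_homo "embed N" by (rule field_homo_embed)
  have "(1 - lconst par_a * lX) * (1 - lconst par_b * lX) * f =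
      f - Poly_Mapping.single 1 (par_a + par_b) * f + Poly_Mapping.single 2 (par_a * par_b) * f"
    by (simp add: mult_single algebra_simps single_add)
  moreover have "wE N = (\<lambda>n. wV N n - embed N (par_a + par_b) * wV N (n - 1) + embed N (par_a * par_b) * wV N (n - 2))"
    by (rule ext) (rule wE_V[OF N])
  ultimately show ?thesis
    by (simp add: phi_diff phi_add phi_single_mult phi_fun_diff phi_fun_add phi_fun_mult)
qed

lemma phi_G: "N > 0 \<Longrightarrow> phi N (wW N) ((1 - lconst par_c * lY) * (1 - lconst par_d * lY) * f) = phi N (wG N) f"
proof -
  assume N: "N > 0"
  interpret E: field_homo "embed N" by (rule field_homo_embed)
  have "(1 - lconst par_c * lY) * (1 - lconst par_d * lY) * f =
      f - Poly_Mapping.single (-1) (par_c + par_d) * f + Poly_Mapping.single (-2) (par_c * par_d) * f"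
    by (simp add: mult_single algebra_simps single_add)
  moreover have "wG N = (\<lambda>n. wW N n - embed N (par_c + par_d) * wW N (n + 1) + embed N (par_c * par_d) * wW N (n + 2))"
    by (rule ext) (rule wG_W[OF N])
  ultimately show ?thesis
    by (simp add: phi_diff phi_add phi_single_mult phi_fun_diff phi_fun_add phi_fun_mult)
qed

text \<open>The assumption says that \<open>lrev B\<close> is invariant under
  \<open>z -> q/z\<close>. Since \<open>z\<close> goes to \<open>q/z\<close> and the series of
  \<open>wG\<close> is multiplied by \<open>- z^2/q\<close>, the product changes sign under a
  substitution that preserves constant terms.\<close>

lemma phi_G_antisym:
  assumes N: "N > 0"
    and B: "\<And>n. Poly_Mapping.lookup B (- n) = q_root powi (- 2 * int N * n) * Poly_Mapping.lookup B n"
  shows "phi N (wG N) (lX * lrev B) = 0"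
proof -
  interpret E: field_homo "embed N" by (rule field_homo_embed)
  define b where "b n = embed N (Poly_Mapping.lookup B n)" for n
  define u where "u n = embed N (q_root powi (2 * int N * n))" for n
  define A where "A = {n. Poly_Mapping.lookup B n \<noteq> 0 \<or> Poly_Mapping.lookup B (- n) \<noteq> 0}"
  have "A \<subseteq> Poly_Mapping.keys B \<union> uminus ` Poly_Mapping.keys B"
  proof
    fix n assume n: "n \<in> A"
    show "n \<in> Poly_Mapping.keys B \<union> uminus ` Poly_Mapping.keys B"
    proof (cases "Poly_Mapping.lookup B n = 0")
      case True
      hence "- n \<in> Poly_Mapping.keys B" using n by (simp add: A_def in_keys_iff)
      hence "- (- n) \<in> uminus ` Poly_Mapping.keys B" by (rule imageI)
      thus ?thesis by simp
    qed (simp add: in_keys_iff)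
  qed
  hence A: "finite A" by (rule finite_subset) simp
  have A': "- n \<in> A \<longleftrightarrow> n \<in> A" for n by (auto simp: A_def)
  have b: "b (- n) = u (- n) * b n" for n using B[of n] by (simp add: b_def u_def E.mult)
  have uu: "u (- n) * u n = 1" for n
    by (simp add: u_def power_int_minus flip: E.mult)
  have "phi N (wG N) (lX * lrev B) = (\<Sum>n\<in>A. b (- n) * wG N (- n - 1))"
    unfolding phi_single_mult
    by (subst phi_superset[of A]) (use A in \<open>auto simp: A_def b_def in_keys_iff\<close>)
  also have "\<dots> = (\<Sum>n\<in>A. b n * wG N (n - 1))"
    by (rule sum.reindex_bij_witness[where i = uminus and j = uminus]) (simp_all add: A')
  finally have T: "phi N (wG N) (lX * lrev B) = (\<Sum>n\<in>A. b n * wG N (n - 1))" .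
  have "(\<Sum>n\<in>A. b (- n) * wG N (- n - 1)) = (\<Sum>n\<in>A. - (b n * wG N (n - 1)))"
  proof (rule sum.cong)
    fix n
    have "wG N (- n - 1) = - (u n * wG N (n - 1))"
      using wG_minus[OF N, of "n + 1"] by (simp add: u_def)
    hence "b (- n) * wG N (- n - 1) = - ((u (- n) * u n) * (b n * wG N (n - 1)))"
      unfolding b by (simp only: mult_minus_right mult_ac)
    thus "b (- n) * wG N (- n - 1) = - (b n * wG N (n - 1))" by (simp only: uu mult_1)
  qed simp
  hence "phi N (wG N) (lX * lrev B) = - phi N (wG N) (lX * lrev B)"
    using T \<open>(\<Sum>n\<in>A. b (- n) * wG N (- n - 1)) = (\<Sum>n\<in>A. b n * wG N (n - 1))\<close> by (simp add: sum_negf)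
  thus ?thesis by simp
qed

text \<open>
  Division by \<open>z - 1/z\<close> is absorbed by the factor \<open>1 - z\<^sup>2\<close> of the weight.  After one of the two terms is
  reflected by \<open>z \<mapsto> 1/z\<close>, the reflection of \<open>B\<close>, which is invariant under \<open>z \<mapsto> q/z\<close>, is paired with
  a series that is odd under this substitution.
\<close>

lemma ct_weight_vanish:
  assumes N: "N > 0"
    and B: "\<And>n. Poly_Mapping.lookup B (- n) = q_root powi (- 2 * int N * n) * Poly_Mapping.lookup B n"
    and F: "(lX - lY) * F = lN * B - lrev (lN * B)"
  shows "ct_weight N F = 0"
proof -
  interpret R: ring_homo lrev by (rule ring_homo_lrev)
  interpret E: field_homo "embed N" by (rule field_homo_embed)
  define a b c d where "a = lconst par_a" "b = lconst par_b" "c = lconst par_c" "d = lconst par_d"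
  note abcd = this
  have r: "lrev a = a" "lrev b = b" "lrev c = c" "lrev d = d" by (simp_all add: abcd)
  let ?x = lX and ?y = lY
  \<comment> \<open>Chosen so that the factors \<open>(1 - az) (1 - bz)\<close> split off, which
    turns the functional into the one of \<open>weight_E\<close>.\<close>
  define g where "g = (1 - c * ?x) * (1 - d * ?x) * (- (?y * B))"
  have rg: "lrev g = (1 - c * ?y) * (1 - d * ?y) * (- (?x * lrev B))"
    by (simp add: g_def R.mult R.diff R.uminus r)
  have xy: "?x * ?y = 1" by (rule lXY)
  have rN: "lrev lN = (1 - a * ?y) * (1 - b * ?y) * (1 - c * ?y) * (1 - d * ?y) * (?x * ?x)"
    by (simp add: lN_def R.mult R.diff abcd)
  have N': "lN = (1 - a * ?x) * (1 - b * ?x) * (1 - c * ?x) * (1 - d * ?x) * (?y * ?y)"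
    by (simp add: lN_def abcd)
  define P where "P = (1 - c * ?x) * (1 - d * ?x) * ((1 - a * ?x) * (1 - b * ?x))"
  define Q where "Q = (1 - c * ?y) * (1 - d * ?y)"
  have "(1 - ?x * ?x) * F = - (?x * ((?x - ?y) * F))"
    using xy by (simp add: algebra_simps)
  also have "\<dots> = - (?x * (lN * B)) + ?x * (lrev lN * lrev B)"
    unfolding F R.mult by (simp add: algebra_simps)
  also have "?x * (lN * B) = P * B * ((?x * ?y) * ?y)"
    unfolding N' P_def by (simp only: mult_ac)
  also have "?x * (lrev lN * lrev B) = Q * (?x * lrev B) * ((?x * (1 - a * ?y)) * (?x * (1 - b * ?y)))"
    unfolding rN Q_def by (simp only: mult_ac)
  also have "(?x * (1 - a * ?y)) * (?x * (1 - b * ?y)) = (?x - a) * (?x - b)"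
  proof -
    have "?x * (1 - a * ?y) = ?x - a * (?x * ?y)" for a by (simp add: algebra_simps)
    thus ?thesis by (simp only: xy mult_1_right)
  qed
  also have "- (P * B * ((?x * ?y) * ?y)) = (1 - a * ?x) * (1 - b * ?x) * g"
    unfolding xy P_def g_def by (simp only: mult_1 mult_minus_right mult_ac)
  finally have F1: "(1 - ?x * ?x) * F = (1 - a * ?x) * (1 - b * ?x) * g + Q * (?x * lrev B) * ((?x - a) * (?x - b))" .
  \<comment> \<open>The reflected first term cancels the second up to this difference. Its factor
    \<open>1 - z^2\<close> restores the full weight, after which the factors with \<open>c\<close>
    and \<open>d\<close> lead to the odd functional.\<close>
  have br: "(?x - a) * (?x - b) - (1 - a * ?x) * (1 - b * ?x) = - ((1 - a * b) * (1 - ?x * ?x))"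
    by (simp add: algebra_simps)
  have "ct_weight N F = phi N (wV N) ((1 - a * ?x) * (1 - b * ?x) * g) + phi N (wV N) (Q * (?x * lrev B) * ((?x - a) * (?x - b)))"
    unfolding ct_weight_phi phi_W[OF N] F1 phi_add ..
  also have "phi N (wV N) ((1 - a * ?x) * (1 - b * ?x) * g) = phi N (wV N) ((1 - a * ?x) * (1 - b * ?x) * lrev g)"
    unfolding abcd phi_E[OF N] by (rule phi_lrev[symmetric]) (rule wE_minus)
  also have "\<dots> = - phi N (wV N) (Q * (?x * lrev B) * ((1 - a * ?x) * (1 - b * ?x)))"
    unfolding phi_uminus[symmetric] rg Q_def by (rule arg_cong[of _ _ "phi N (wV N)"]) (simp only: mult_minus_right mult_ac)
  also have "- phi N (wV N) (Q * (?x * lrev B) * ((1 - a * ?x) * (1 - b * ?x))) + phi N (wV N) (Q * (?x * lrev B) * ((?x - a) * (?x - b))) =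
      phi N (wV N) (Q * (?x * lrev B) * ((?x - a) * (?x - b) - (1 - a * ?x) * (1 - b * ?x)))"
    unfolding right_diff_distrib phi_diff by simp
  also have "\<dots> = - phi N (wV N) ((1 - ?x * ?x) * (lconst (1 - par_a * par_b) * (Q * (?x * lrev B))))"
    unfolding br phi_uminus[symmetric]
    by (rule arg_cong[of _ _ "phi N (wV N)"]) (simp add: abcd mult_single single_diff mult_ac)
  also have "\<dots> = - (embed N (1 - par_a * par_b) * phi N (wG N) (?x * lrev B))"
    unfolding phi_W[OF N, symmetric] using phi_single_mult[of N "wW N" 0 "1 - par_a * par_b"]
    unfolding Q_def abcd phi_G[OF N, symmetric] by simp
  also have "\<dots> = 0" using phi_G_antisym[OF N B] by simp
  finally show ?thesis .
qed


section \<open>Askey--Wilson polynomials as eigenfunctions\<close>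

text \<open>At \<open>\<surd>q = 0\<close> the weight reduces to
  \<open>(1 - z^2) / ((1 - az) (1 - bz))\<close>; this is the recurrence of its
  coefficients.\<close>

lemma bW_rec: "fps_nth (bW n) 0 - (coef_a + coef_b) * fps_nth (bW (n - 1)) 0 + coef_a * coef_b * fps_nth (bW (n - 2)) 0 =
    (if n = 0 then 1 else 0) - (if n = 2 then 1 else 0)"
proof -
  have "bW n - fps_const (coef_a + coef_b) * bW (n - 1) + fps_const (coef_a * coef_b) * bW (n - 2) = bE n - bE (n - 2)"
    unfolding bW_V bE_V by (simp add: algebra_simps)
  from arg_cong[OF this, of "\<lambda>f. fps_nth f 0"] show ?thesis by (simp add: bE_nth_0)
qed

lemma bW_neg: "n < 0 \<Longrightarrow> fps_nth (bW n) 0 = 0"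
  by (simp add: bW_def cf_neg)

text \<open>The product is minus the square of an indeterminate.\<close>

lemma coef_ab_neq_1: "coef_a * coef_b \<noteq> 1"
proof
  assume "coef_a * coef_b = 1"
  hence "coef_sab * coef_sab = - 1" by (simp add: coef_a_def power2_eq_square)
  hence "to_fract ([:[:[:[:0, 1:]:]:]:] * [:[:[:[:0, 1:]:]:]:]) = to_fract (- 1 :: rat poly poly poly poly)"
    by (simp only: coef_sab_def to_fract_mult to_fract_uminus to_fract_1)
  hence "[:[:[:[:0, 1:]:]:]:] * [:[:[:[:0, 1:]:]:]:] = (- 1 :: rat poly poly poly poly)"
    by (simp only: to_fract_eq_iff)
  thus False by (simp add: one_pCons)
qed

lemma fls_times_low:
  fixes f :: "'a::comm_ring_1 fls"
  assumes "\<And>i. i < t \<Longrightarrow> fls_nth f i = 0"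
  shows "fls_nth (f * fps_to_fls g) t = fls_nth f t * fps_nth g 0"
proof -
  define h where "h = fls_regpart (fls_shift t f)"
  have f: "f = fls_shift (- t) (fps_to_fls h)"
  proof (rule fls_eqI)
    fix n show "fls_nth f n = fls_nth (fls_shift (- t) (fps_to_fls h)) n"
      using assms[of n] by (auto simp: h_def)
  qed
  have "f * fps_to_fls g = fls_shift (- t) (fps_to_fls (h * g))"
    by (subst f) (simp add: fls_times_fps_to_fls fls_shifted_times_simps)
  thus ?thesis by (subst f) simp
qed

lemma period_2_zero:
  fixes g :: "int \<Rightarrow> 'a::zero"
  assumes "\<And>m. g m = g (m - 2)" "\<And>m. m < M \<Longrightarrow> g m = 0"
  shows "g m = 0"
proof -
  have "g m = g (m - 2 * int k)" for k
  proof (induction k)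
    case (Suc k)
    have "m - 2 * int (Suc k) = m - 2 * int k - 2" by simp
    hence "g (m - 2 * int (Suc k)) = g (m - 2 * int k - 2)" by (rule arg_cong)
    also have "\<dots> = g m" by (simp only: Suc[symmetric] assms(1)[of "m - 2 * int k", symmetric])
    finally show ?case ..
  qed simp
  from this[of "nat (m - M) + 1"] show ?thesis using assms(2) by simp
qed

lemma symL_sym_lookup: "f \<in> symL \<Longrightarrow> Poly_Mapping.lookup f (- n) = Poly_Mapping.lookup f n"
  by (simp add: symL_def)

lemma phi_z_sym:
  "phi N B (f * z_sym m) = (\<Sum>n\<in>Poly_Mapping.keys f. embed N (Poly_Mapping.lookup f n) * (B (- n - int m) + B (- n + int m)))"
proof -
  interpret E: field_homo "embed N" by (rule field_homo_embed)
  have "f * z_sym m = Poly_Mapping.single (int m) 1 * f + Poly_Mapping.single (- int m) 1 * f"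
    by (simp add: z_sym_def algebra_simps)
  thus ?thesis
    by (simp add: phi_add phi_single_mult) (simp add: phi_def sum.distrib distrib_left)
qed

text \<open>
  By passing to lowest order coefficients in \<open>u\<close> the weight is replaced by its value at \<open>q = 0\<close>, whose
  expansion satisfies a recurrence of length two.
\<close>

lemma ct_weight_nondegenerate:
  assumes N: "N > 0" and f: "f \<in> symL" "f \<noteq> 0"
  shows "\<exists>m. ct_weight N (f * z_sym m) \<noteq> 0"
proof (rule ccontr)
  assume "\<not> ?thesis"
  hence 0: "ct_weight N (f * z_sym m) = 0" for m by blast
  interpret E: field_homo "embed N" by (rule field_homo_embed)
  let ?K = "Poly_Mapping.keys f"
  define e where "e n = embed N (Poly_Mapping.lookup f n)" for n
  have K: "?K \<noteq> {}" using f by (metis keys_eq_empty)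
  have e0: "e n = 0 \<longleftrightarrow> n \<notin> ?K" for n by (simp add: e_def in_keys_iff)
  have es: "e (- n) = e n" for n using symL_sym_lookup[OF f(1)] by (simp add: e_def)
  \<comment> \<open>The lowest order in \<open>u\<close> among the coefficients of \<open>f\<close>;
    at this order the weight contributes only its value at \<open>\<surd>q = 0\<close>.\<close>
  define t where "t = Min ((\<lambda>n. fls_subdegree (e n)) ` ?K)"
  have low: "fls_nth (e n) i = 0" if "i < t" for n i
  proof (cases "n \<in> ?K")
    case True
    hence "t \<le> fls_subdegree (e n)" unfolding t_def by (intro Min_le) auto
    thus ?thesis using that by (intro fls_eq0_below_subdegree) simp
  next
    case False
    thus ?thesis using e0[of n] by simp
  qed
  define c where "c n = fls_nth (e n) t" for n
  have c_supp: "c n = 0" if "n \<notin> ?K" for n using that e0[of n] by (simp add: c_def)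
  have cs: "c (- n) = c n" for n by (simp add: c_def es)
  have "t \<in> (\<lambda>n. fls_subdegree (e n)) ` ?K" unfolding t_def using K by (intro Min_in) auto
  then obtain n0 where n0: "n0 \<in> ?K" "t = fls_subdegree (e n0)" by auto
  have cn0: "c n0 \<noteq> 0" using n0 e0[of n0] by (simp add: c_def)
  define w where "w n = fps_nth (bW n) 0" for n
  define F where "F m = (\<Sum>n\<in>?K. c n * w (m - n))" for m
  have ew: "fls_nth (e n * wW N k) t = c n * w k" for n k
    unfolding wW_def toF_def using fls_times_low[of t "e n"] low N by (simp add: c_def w_def)
  \<comment> \<open>Pairing with the sum of \<open>z^m\<close> and \<open>z^(-m)\<close> sees only
    the even part of \<open>F\<close>.\<close>
  have FF: "F (- int m) + F (int m) = 0" for m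
  proof -
    have "0 = fls_nth (\<Sum>n\<in>?K. e n * (wW N (- n - int m) + wW N (- n + int m))) t"
      using 0[of m] by (simp add: ct_weight_phi phi_z_sym e_def)
    also have "\<dots> = (\<Sum>n\<in>?K. c n * w (- n - int m) + c n * w (- n + int m))"
      by (simp add: fls_nth_sum distrib_left ew)
    also have "\<dots> = F (- int m) + F (int m)"
    proof -
      have "- n - int m = - int m - n" "- n + int m = int m - n" for n by simp_all
      thus ?thesis by (simp only: F_def sum.distrib)
    qed
    finally show ?thesis by (rule sym)
  qed
  have F_anti: "F (- m) = - F m" for m
  proof (cases m)
    case (nonneg k)
    thus ?thesis using FF[of k] by (simp add: eq_neg_iff_add_eq_0)
  next
    case (neg k)
    thus ?thesis using FF[of "Suc k"] by (simp add: eq_neg_iff_add_eq_0 add.commute)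
  qed
  have rec: "F m - (coef_a + coef_b) * F (m - 1) + coef_a * coef_b * F (m - 2) = c m - c (m - 2)" for m
  proof -
    have "F m - (coef_a + coef_b) * F (m - 1) + coef_a * coef_b * F (m - 2) =
      (\<Sum>n\<in>?K. c n * (w (m - n) - (coef_a + coef_b) * w (m - n - 1) + coef_a * coef_b * w (m - n - 2)))"
      by (simp add: F_def sum_distrib_left sum_subtractf sum.distrib algebra_simps)
    also have "\<dots> = (\<Sum>n\<in>?K. (if n = m then c n else 0) - (if n = m - 2 then c n else 0))"
      unfolding w_def bW_rec by (rule sum.cong) auto
    also have "\<dots> = c m - c (m - 2)"
      by (simp add: sum_subtractf c_supp)
    finally show ?thesis .
  qed
  define M where "M = Min ?K"
  have M: "n \<ge> M" if "n \<in> ?K" for n unfolding M_def using that by (intro Min_le) auto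
  have F_neg: "F m = 0" if "m < M" for m
    unfolding F_def
  proof (rule sum.neutral, rule ballI)
    fix n assume "n \<in> ?K"
    hence "m - n < 0" using M[of n] that by linarith
    thus "c n * w (m - n) = 0" by (simp add: w_def bW_neg)
  qed
  have c_neg: "c m = 0" if "m < M" for m using that M[of m] c_supp[of m] by linarith
  \<comment> \<open>The recurrence is added to its image under \<open>m -> 2 - m\<close>.
    Antisymmetry of \<open>F\<close> and symmetry of \<open>c\<close> leave \<open>1 - ab\<close>
    times \<open>F m - F (m - 2)\<close>.\<close>
  have F_per: "F m = F (m - 2)" for m
  proof -
    have "F (- (m - 2)) - (coef_a + coef_b) * F (- (m - 1)) + coef_a * coef_b * F (- m) = c (- (m - 2)) - c (- m)"
      using rec[of "2 - m"] by (simp add: algebra_simps)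
    hence 2: "- F (m - 2) + (coef_a + coef_b) * F (m - 1) - coef_a * coef_b * F m = c (m - 2) - c m"
      unfolding F_anti cs by (simp add: algebra_simps)
    have "(1 - coef_a * coef_b) * (F m - F (m - 2)) =
      (F m - (coef_a + coef_b) * F (m - 1) + coef_a * coef_b * F (m - 2)) +
      (- F (m - 2) + (coef_a + coef_b) * F (m - 1) - coef_a * coef_b * F m)"
      by (simp add: algebra_simps)
    also have "\<dots> = 0" unfolding rec 2 by simp
    finally show ?thesis using coef_ab_neq_1 by simp
  qed
  have "F m = 0" for m by (rule period_2_zero[of F M]) (use F_per F_neg in auto)
  hence "c m = c (m - 2)" for m using rec[of m] by simp
  hence "c n0 = 0" by (rule period_2_zero[of c M]) (use c_neg in auto)
  thus False using cn0 by simp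
qed

context q_shift
begin

text \<open>
  \<open>B\<close> is the Casorati determinant of \<open>f\<close> and \<open>g\<close>, written with \<^term>\<open>Splus r\<close> in place of the shift so that
  it stays a Laurent polynomial.
\<close>

lemma wronskian:
  assumes fg: "f \<in> Sym" "g \<in> Sym"
    and ef: "Lop r a b c d f = cz l * f" and eg: "Lop r a b c d g = cz l' * g"
  defines "\<nu> \<equiv> (1 - cz a * zz) * (1 - cz b * zz) * (1 - cz c * zz) * (1 - cz d * zz) * (inverse zz * inverse zz)"
  shows "\<exists>B\<in>Laur. zscale (r ^ 2) (zinv B) = B \<and> zdiff * (cz ((l - l') * r) * f * g) = \<nu> * B - zinv (\<nu> * B)"
proof -
  interpret up: field_homo "zscale r" by (rule field_homo_zscale) simp
  interpret up2: field_homo "zscale (r ^ 2)" by (rule field_homo_zscale) simp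
  have i: "zinv f = f" "zinv g = g" "f \<in> Laur" "g \<in> Laur" using fg by (auto simp: Sym_def)
  define \<phi> where "\<phi> = Splus r f"
  define \<psi> where "\<psi> = Splus r g"
  have "\<phi> \<in> Sym" "\<psi> \<in> Sym" unfolding \<phi>_def \<psi>_def using fg by (intro Splus_Sym; simp)+
  hence j: "zinv \<phi> = \<phi>" "zinv \<psi> = \<psi>" "\<phi> \<in> Laur" "\<psi> \<in> Laur" by (auto simp: Sym_def)
  define B where "B = zscale r \<phi> * g - zscale r \<psi> * f"
  have BL: "B \<in> Laur" unfolding B_def using i j by (intro Laur_closed) auto
  define \<delta> where "\<delta> = zscale r zdiff"
  have d0: "\<delta> \<noteq> 0" by (simp add: \<delta>_def)
  \<comment> \<open>Hence \<open>B * \<delta>\<close> is \<open>f(qz) g(z) - g(qz) f(z)\<close>.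
    Under \<open>z -> 1/(qz)\<close> both this determinant and \<open>\<delta>\<close> change sign,
    so \<open>B\<close> is invariant.\<close>
  have S: "zscale r (Splus r h) * \<delta> = zscale (r ^ 2) h - h" for h
    by (simp add: Splus_def Dop_def \<delta>_def up.divide up.diff zscale_zscale power2_eq_square)
  have zB: "zinv B = zscale (inverse r) \<phi> * g - zscale (inverse r) \<psi> * f"
    by (simp add: B_def zinv.diff zinv.mult zinv_zscale i j)
  have Sm: "Sminus r a b c d h * zdiff = \<nu> * zscale r h - zinv \<nu> * zscale (inverse r) h" for h
    by (simp add: Sminus_def Dop_def \<nu>_def)
  define Y where "Y = 1 + a * b * c * d / r ^ 2"
  have Lr: "cz r * Lop r a b c d h = Sminus r a b c d (Splus r h) + cz r * (cz Y * h)" for h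
  proof -
    have "cz r * Lop r a b c d h = cz r * (cz (inverse r) * Sminus r a b c d (Splus r h)) + cz r * (cz Y * h)"
      unfolding Lop_def Y_def by (rule distrib_left)
    moreover have "cz r * (cz (inverse r) * y) = y" for y by (simp add: mult.assoc[symmetric] flip: cz.mult)
    ultimately show ?thesis by simp
  qed
  have "zdiff * (cz ((l - l') * r) * f * g) = zdiff * ((cz r * Lop r a b c d f) * g - (cz r * Lop r a b c d g) * f)"
    unfolding ef eg by (simp add: cz.mult cz.diff algebra_simps)
  also have "\<dots> = (Sminus r a b c d \<phi> * zdiff) * g - (Sminus r a b c d \<psi> * zdiff) * f"
    unfolding Lr \<phi>_def[symmetric] \<psi>_def[symmetric] by (simp add: algebra_simps)
  also have "\<dots> = \<nu> * B - zinv (\<nu> * B)"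
    unfolding Sm zinv.mult zB unfolding B_def by (simp add: algebra_simps)
  finally have main: "zdiff * (cz ((l - l') * r) * f * g) = \<nu> * B - zinv (\<nu> * B)" .
  have "zscale (r ^ 2) (zscale (inverse r) y) = zscale r y" for y
  proof -
    have "r ^ 2 * inverse r = r" by (simp add: power2_eq_square mult.assoc)
    thus ?thesis by (subst zscale_zscale) simp_all
  qed
  hence "zscale (r ^ 2) (zinv B) = zscale r \<phi> * zscale (r ^ 2) g - zscale r \<psi> * zscale (r ^ 2) f"
    unfolding zB by (simp add: up2.diff up2.mult)
  hence "zscale (r ^ 2) (zinv B) * \<delta> = (zscale r \<phi> * \<delta>) * zscale (r ^ 2) g - (zscale r \<psi> * \<delta>) * zscale (r ^ 2) f"
    by (simp only: left_diff_distrib right_diff_distrib mult_ac)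
  also have "\<dots> = (zscale r \<phi> * \<delta>) * g - (zscale r \<psi> * \<delta>) * f"
    unfolding \<phi>_def \<psi>_def S by (simp add: algebra_simps)
  also have "\<dots> = B * \<delta>" by (simp add: B_def algebra_simps)
  finally have "zscale (r ^ 2) (zinv B) = B" using d0 by simp
  thus ?thesis using BL main by blast
qed

end

lemma q_root_powi_eq_1: "q_root powi n = 1 \<Longrightarrow> n = 0"
  using gmon_eq_iff[of 1 "(0, 0, 0, 0, n)" "(0, 0, 0, 0, 0)"] by simp

lemma q_shift_q_root: "N > 0 \<Longrightarrow> q_shift (q_root ^ N)"
proof
  fix n :: int
  assume N: "N > 0" and "(q_root ^ N) powi n = 1"
  hence "q_root powi (int N * n) = 1" by (simp add: power_int_mult)
  thus "n = 0" using q_root_powi_eq_1 N by force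
qed simp

lemma par_prod: "par_a * q_root powi i * (par_b * q_root powi j) * (par_c * q_root powi k) * (par_d * q_root powi l) =
   gmon (2, 0, 2, 0, i + j + k + l)"
  by (simp add: par_a_def par_c_def power_int_add field_simps)

text \<open>The product of the parameters contains the indeterminate \<open>\<surd>(-ab)\<close>,
  which no power of \<open>q\<close> does.\<close>

lemma gen_par:
  assumes "N > 0"
  shows "q_shift.gen (q_root ^ N) (par_a * q_root powi i * (par_b * q_root powi j) * (par_c * q_root powi k) * (par_d * q_root powi l))"
proof -
  interpret q_shift "q_root ^ N" by (rule q_shift_q_root) fact
  show ?thesis unfolding gen_def par_prod
  proof (intro allI notI)
    fix n assume "gmon (2, 0, 2, 0, i + j + k + l) = (q_root ^ N) powi n"
    hence "gmon (2, 0, 2, 0, i + j + k + l) = of_rat 1 * gmon (0, 0, 0, 0, int N * n)"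
      by (simp add: power_int_mult)
    from gmon_eq_iff[OF _ this] show False by simp
  qed
qed

section \<open>Identification of the eigenfunctions with the orthogonal polynomials\<close>

definition PN :: "nat \<Rightarrow> nat \<Rightarrow> laurent" where
  "PN N = awp (q_root ^ N) par_a par_b par_c par_d"

context
  fixes N :: nat
  assumes N: "N > 0"
begin

interpretation q_shift "q_root ^ N" by (rule q_shift_q_root) (rule N)
interpretation E: field_homo "embed N" by (rule field_homo_embed)

abbreviation "rN \<equiv> q_root ^ N"
abbreviation "LN \<equiv> Lop rN par_a par_b par_c par_d"
abbreviation "lamN \<equiv> lam rN (par_a * par_b * par_c * par_d)"

lemma gen_par0: "gen (par_a * par_b * par_c * par_d)"
  using gen_par[OF N, of 0 0 0 0] by simp

lemma PN_eigen: "LN (lz (PN N n)) = cz (lamN (int n)) * lz (PN N n)"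
  unfolding PN_def by (rule Lop_awp) (simp_all add: gen_par0)

lemma PN_ldeg: "ldeg (PN N n) n" and PN_monic: "Poly_Mapping.lookup (PN N n) (int n) = 1"
  unfolding PN_def by (rule awp_props; simp)+

lemma PN_symL: "PN N n \<in> symL"
  using PN_ldeg[of n] by (simp add: ldeg_def)

lemma ct_weight_scale: "ct_weight N (Poly_Mapping.single 0 c * f) = embed N c * ct_weight N f"
  by (simp add: ct_weight_phi phi_single_mult)

lemma ct_weight_sum: "ct_weight N (sum f A) = (\<Sum>x\<in>A. ct_weight N (f x))"
  by (simp add: ct_weight_phi phi_sum)

text \<open>The Wronskian identity brings the product, times a nonzero multiple of the difference of
  eigenvalues, into the form whose constant term is annihilated by
  \<open>ct_weight_vanish\<close>.\<close>

lemma PN_orth: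
  assumes nm: "n \<noteq> m"
  shows "ct_weight N (PN N n * PN N m) = 0"
proof -
  define f where "f = lz (PN N n)"
  define g where "g = lz (PN N m)"
  have fg: "f \<in> Sym" "g \<in> Sym" by (simp_all add: f_def g_def lz_in_Sym_iff PN_symL)
  define x where "x = (lamN (int n) - lamN (int m)) * rN"
  define \<nu> where "\<nu> = lz lN"
  have nu: "\<nu> = (1 - cz par_a * zz) * (1 - cz par_b * zz) * (1 - cz par_c * zz) * (1 - cz par_d * zz) * (inverse zz * inverse zz)"
    by (simp add: \<nu>_def lN_def lz.mult lz.diff power_int_minus)
  obtain B where B: "B \<in> Laur" "zscale (rN ^ 2) (zinv B) = B" "zdiff * (cz x * f * g) = \<nu> * B - zinv (\<nu> * B)"
    using wronskian[OF fg PN_eigen[of n, folded f_def] PN_eigen[of m, folded g_def]]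
    unfolding x_def nu by blast
  then obtain Bl where Bl: "B = lz Bl" by (auto simp: Laur_def)
  have zd: "zdiff = lz (lX - lY)" by (simp add: zdiff_def lz.diff power_int_minus)
  have cx: "cz x = lz (Poly_Mapping.single 0 x)" by simp
  have "lz ((lX - lY) * (Poly_Mapping.single 0 x * (PN N n * PN N m))) = lz (lN * Bl - lrev (lN * Bl))"
    using B(3) unfolding f_def g_def \<nu>_def Bl zd cx
    by (simp only: lz.mult[symmetric] zinv_lz lz.diff[symmetric] mult.assoc)
  hence F: "(lX - lY) * (Poly_Mapping.single 0 x * (PN N n * PN N m)) = lN * Bl - lrev (lN * Bl)"
    by (simp only: lz_eq_iff)
  have "lz (Poly_Mapping.mapp (\<lambda>n x. x * (rN ^ 2) powi n) (lrev Bl)) = lz Bl"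
    using B(2) unfolding Bl zinv_lz by (subst (asm) zscale_lz) simp_all
  hence mp: "Poly_Mapping.mapp (\<lambda>n x. x * (rN ^ 2) powi n) (lrev Bl) = Bl" by (simp only: lz_eq_iff)
  \<comment> \<open>Invariance of \<open>B\<close> under \<open>z -> 1/(qz)\<close>, read off from
    the coefficients.\<close>
  have Bc: "Poly_Mapping.lookup Bl (- k) = q_root powi (- 2 * int N * k) * Poly_Mapping.lookup Bl k" for k
  proof -
    have "Poly_Mapping.lookup Bl (- k) = Poly_Mapping.lookup (Poly_Mapping.mapp (\<lambda>n x. x * (rN ^ 2) powi n) (lrev Bl)) (- k)"
      by (simp only: mp)
    also have "\<dots> = Poly_Mapping.lookup Bl k * (rN ^ 2) powi (- k)"
      by (simp add: lookup_mapp when_def in_keys_iff)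
    also have "(rN ^ 2) powi (- k) = q_root powi (- 2 * int N * k)"
    proof -
      have "rN ^ 2 = q_root powi (2 * int N)" by (simp add: power_mult power_int_mult mult.commute)
      thus ?thesis by (simp flip: power_int_mult)
    qed
    finally show ?thesis by (simp only: mult.commute)
  qed
  have "embed N x * ct_weight N (PN N n * PN N m) = 0"
    using ct_weight_vanish[OF N Bc F] by (simp add: ct_weight_scale)
  moreover have "x \<noteq> 0" using lam_inj[OF gen_par0, of "int n" "int m"] nm by (auto simp: x_def)
  ultimately show ?thesis by simp
qed

lemma ldeg_z_sym: "ldeg (z_sym j) j"
  by (auto simp: ldeg_def symL_def z_sym_def lookup_add lookup_single when_def)

lemma z_sym_span: "\<exists>c. z_sym m = (\<Sum>i<Suc m. Poly_Mapping.single 0 (c i) * PN N i)"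
  by (rule symL_span[OF PN_ldeg]) (use ldeg_z_sym[of m] in \<open>auto simp: ldeg_def\<close>)

lemma PN_z_sym_span: "\<exists>c. PN N m = (\<Sum>i<Suc m. Poly_Mapping.single 0 (c i) * z_sym i)"
  by (rule symL_span[OF ldeg_z_sym]) (use PN_ldeg[of m] in \<open>auto simp: ldeg_def\<close>)

lemma PN_z_sym_orth: "m < n \<Longrightarrow> ct_weight N (PN N n * z_sym m) = 0"
proof -
  assume mn: "m < n"
  obtain c where c: "z_sym m = (\<Sum>i<Suc m. Poly_Mapping.single 0 (c i) * PN N i)" using z_sym_span by blast
  have "PN N n * z_sym m = (\<Sum>i<Suc m. Poly_Mapping.single 0 (c i) * (PN N n * PN N i))"
    unfolding c sum_distrib_left by (simp only: mult_ac)
  also have "ct_weight N \<dots> = 0"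
    unfolding ct_weight_sum ct_weight_scale
    by (rule sum.neutral) (use mn PN_orth[of n] in auto)
  finally show ?thesis .
qed

text \<open>By orthogonality to all the others, a vanishing norm would make \<open>PN N n\<close>
  orthogonal to every symmetric Laurent polynomial, against nondegeneracy.\<close>

lemma PN_norm: "ct_weight N (PN N n * PN N n) \<noteq> 0"
proof
  assume 0: "ct_weight N (PN N n * PN N n) = 0"
  have "PN N n \<noteq> 0" using PN_monic[of n] by auto
  then obtain m where m: "ct_weight N (PN N n * z_sym m) \<noteq> 0"
    using ct_weight_nondegenerate[OF N PN_symL] by blast
  obtain c where c: "z_sym m = (\<Sum>i<Suc m. Poly_Mapping.single 0 (c i) * PN N i)" using z_sym_span by blast
  have "PN N n * z_sym m = (\<Sum>i<Suc m. Poly_Mapping.single 0 (c i) * (PN N n * PN N i))"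
    unfolding c sum_distrib_left by (simp only: mult_ac)
  also have "ct_weight N \<dots> = 0"
    unfolding ct_weight_sum ct_weight_scale
  proof (rule sum.neutral, rule ballI)
    fix i show "embed N (c i) * ct_weight N (PN N n * PN N i) = 0"
      using 0 PN_orth[of n i] by (cases "i = n") auto
  qed
  finally show False using m by simp
qed

lemma lin_indep_star': "field_homo field_star"
  unfolding field_star_def by (rule field_homo_rat_eval[OF lin_indep_star])

text \<open>Rational coefficients are fixed by the field involution and the exponents are symmetric,
  so the involution disappears from the conditions that define the polynomials.\<close>

lemma laurent_star_z_sym: "laurent_star (z_sym m) = z_sym m"
proof (rule poly_mapping_eqI)
  interpret S: field_homo field_star by (rule lin_indep_star')
  fix n
  have "Poly_Mapping.lookup (laurent_star f) n = field_star (Poly_Mapping.lookup f (- n))" for f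
  proof -
    have "Poly_Mapping.lookup (laurent_star f) n =
      (\<Sum>k\<in>Poly_Mapping.keys f. if k = - n then field_star (Poly_Mapping.lookup f k) else 0)"
      unfolding laurent_star_def lookup_sum lookup_single by (rule sum.cong) (auto simp: when_def)
    thus ?thesis by (simp add: in_keys_iff)
  qed
  thus "Poly_Mapping.lookup (laurent_star (z_sym m)) n = Poly_Mapping.lookup (z_sym m) n"
    by (auto simp: z_sym_def lookup_add lookup_single when_def S.add)
qed

lemma aw_pairing_z_sym: "aw_pairing N P (z_sym m) = ct_weight N (P * z_sym m)"
  by (simp add: aw_pairing_def laurent_star_z_sym)

lemma PN_0: "PN N 0 = 1"
proof -
  have "awS rN par_a par_b par_c par_d 0 = 1" by (simp add: awS_def awC_def le_def)
  thus ?thesis by (simp add: PN_def awp_def lookup_one)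
qed

lemma sym_laurent_symL: "sym_laurent = symL"
  by (simp add: sym_laurent_def symL_def)

text \<open>Uniqueness rests on the norms: the difference of two candidates lies in the span of the
  polynomials of lower degree and is orthogonal to each of them.\<close>

lemma askey_wilson_eq: "askey_wilson N n = PN N n"
  unfolding askey_wilson_def
proof (rule the_equality)
  have "\<exists>c. PN N n = z_sym n + (\<Sum>j<n. Poly_Mapping.single 0 (c j) * z_sym j)" if "n > 0"
  proof -
    have "\<exists>c. PN N n - z_sym n = (\<Sum>j<n. Poly_Mapping.single 0 (c j) * z_sym j)"
    proof (rule symL_span[OF ldeg_z_sym])
      show "PN N n - z_sym n \<in> symL"
        using PN_symL ldeg_z_sym[of n] by (intro symL_closed) (auto simp: ldeg_def)
      have "Poly_Mapping.lookup (z_sym n) (int n) = 1"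
        using that by (auto simp: z_sym_def lookup_add lookup_single when_def)
      thus "\<forall>m\<ge>int n. Poly_Mapping.lookup (PN N n - z_sym n) m = 0"
        using PN_ldeg[of n] ldeg_z_sym[of n] PN_monic[of n] by (auto simp: ldeg_def lookup_minus order.order_iff_strict)
    qed
    then obtain c where "PN N n - z_sym n = (\<Sum>j<n. Poly_Mapping.single 0 (c j) * z_sym j)" by blast
    hence "PN N n = z_sym n + (\<Sum>j<n. Poly_Mapping.single 0 (c j) * z_sym j)"
      by (simp only: diff_eq_eq add.commute)
    thus ?thesis by blast
  qed
  thus "PN N n \<in> sym_laurent \<and> (if n = 0 then PN N n = 1 else
     (\<exists>c. PN N n = z_sym n + (\<Sum>j<n. Poly_Mapping.single 0 (c j) * z_sym j)) \<and>
     (\<forall>m<n. aw_pairing N (PN N n) (z_sym m) = 0))"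
    by (cases "n = 0") (simp_all add: sym_laurent_symL PN_symL PN_0 aw_pairing_z_sym PN_z_sym_orth)
next
  fix Q
  assume Q: "Q \<in> sym_laurent \<and> (if n = 0 then Q = 1 else
     (\<exists>c. Q = z_sym n + (\<Sum>j<n. Poly_Mapping.single 0 (c j) * z_sym j)) \<and>
     (\<forall>m<n. aw_pairing N Q (z_sym m) = 0))"
  show "Q = PN N n"
  proof (cases "n = 0")
    case True
    thus ?thesis using Q by (simp add: PN_0)
  next
    case False
    hence Q': "\<exists>c. Q = z_sym n + (\<Sum>j<n. Poly_Mapping.single 0 (c j) * z_sym j)"
      "\<And>m. m < n \<Longrightarrow> ct_weight N (Q * z_sym m) = 0" "Q \<in> symL"
      using Q by (simp_all add: aw_pairing_z_sym sym_laurent_symL)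
    obtain c where c: "Q = z_sym n + (\<Sum>j<n. Poly_Mapping.single 0 (c j) * z_sym j)" using Q'(1) by blast
    define D where "D = Q - PN N n"
    have zs: "Poly_Mapping.lookup (z_sym j) m = 0" if "m > int j" for j m
      using ldeg_z_sym[of j] that by (auto simp: ldeg_def)
    have "Poly_Mapping.lookup (z_sym n) (int n) = 1"
      using False by (auto simp: z_sym_def lookup_add lookup_single when_def)
    hence "Poly_Mapping.lookup D m = 0" if "m \<ge> int n" for m
      using that PN_ldeg[of n] PN_monic[of n] zs
      by (cases "m = int n") (auto simp: D_def c lookup_minus lookup_add lookup_sum lookup_single_mult ldeg_def)
    moreover have "D \<in> symL" unfolding D_def using Q'(3) PN_symL by (rule symL_closed(2))
    ultimately obtain x where x: "D = (\<Sum>j<n. Poly_Mapping.single 0 (x j) * PN N j)"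
      using symL_span[OF PN_ldeg, of D n] by blast
    have Dz: "ct_weight N (D * z_sym m) = 0" if "m < n" for m
    proof -
      show ?thesis using Q'(2)[OF that] PN_z_sym_orth[OF that] by (simp add: D_def left_diff_distrib ct_weight_phi phi_diff)
    qed
    have "x i = 0" if i: "i < n" for i
    proof -
      obtain c where c: "PN N i = (\<Sum>j<Suc i. Poly_Mapping.single 0 (c j) * z_sym j)" using PN_z_sym_span by blast
      have "D * PN N i = (\<Sum>j<Suc i. Poly_Mapping.single 0 (c j) * (D * z_sym j))"
        unfolding c sum_distrib_left by (simp only: mult_ac)
      also have "ct_weight N \<dots> = 0"
        unfolding ct_weight_sum ct_weight_scale by (rule sum.neutral) (use Dz i in auto)
      finally have 0: "ct_weight N (D * PN N i) = 0" .
      have "D * PN N i = (\<Sum>j<n. Poly_Mapping.single 0 (x j) * (PN N j * PN N i))"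
        unfolding x sum_distrib_right by (simp only: mult_ac)
      also have "ct_weight N \<dots> = (\<Sum>j<n. if j = i then embed N (x i) * ct_weight N (PN N i * PN N i) else 0)"
        unfolding ct_weight_sum ct_weight_scale by (rule sum.cong) (use PN_orth in auto)
      also have "\<dots> = embed N (x i) * ct_weight N (PN N i * PN N i)" using i by simp
      finally show ?thesis using 0 PN_norm[of i] by simp
    qed
    hence "D = 0" unfolding x by (intro sum.neutral) auto
    thus ?thesis by (simp add: D_def)
  qed
qed

lemma askey_wilson_shifted_eq:
  "askey_wilson_shifted N h (of_nat n) =
     awp rN (par_a * q_pow N (h $ 1)) (par_b * q_pow N (h $ 2)) (par_c * q_pow N (h $ 3)) (par_d * q_pow N (h $ 4)) n"
proof -
  define \<rho> where "\<rho> = rat_eval par_a par_b par_c par_d q_root"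
  define \<rho>' where "\<rho>' = rat_eval (par_a * q_pow N (h $ 1)) (par_b * q_pow N (h $ 2))
              (par_c * q_pow N (h $ 3)) (par_d * q_pow N (h $ 4)) q_root"
  have i: "lin_indep_via of_rat (nat_mon par_a par_b par_c par_d q_root)"
    using lin_indep_par[of 0 0 0 0] by simp
  note i' = lin_indep_par[of "\<lfloor>2 * of_nat N * h $ 1\<rfloor>" "\<lfloor>2 * of_nat N * h $ 2\<rfloor>" "\<lfloor>2 * of_nat N * h $ 3\<rfloor>"
      "\<lfloor>2 * of_nat N * h $ 4\<rfloor>", folded q_pow_def]
  interpret R: field_homo \<rho> unfolding \<rho>_def by (rule field_homo_rat_eval[OF i])
  interpret R': field_homo \<rho>' unfolding \<rho>'_def by (rule field_homo_rat_eval[OF i'])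
  \<comment> \<open>The same formula with indeterminates in place of \<open>a\<close>,
    \<open>b\<close>, \<open>c\<close>, \<open>d\<close>. Evaluation at the original parameters
    gives \<open>PN N n\<close> and exhibits its preimage, which \<open>shift_params\<close> then
    evaluates at the shifted ones.\<close>
  define g where "g = awp rN sqrt_mab par_b sqrt_mcd par_d n"
  have g: "Poly_Mapping.map \<rho> g = PN N n"
    unfolding g_def map_awp[OF R.field_homo_axioms] PN_def
    by (simp add: R.power) (simp add: \<rho>_def rat_eval_sqrt_mab[OF i] rat_eval_par_b[OF i] rat_eval_sqrt_mcd[OF i]
        rat_eval_par_d[OF i] rat_eval_q_root[OF i])
  have g': "Poly_Mapping.map \<rho>' g = awp rN (par_a * q_pow N (h $ 1)) (par_b * q_pow N (h $ 2)) (par_c * q_pow N (h $ 3)) (par_d * q_pow N (h $ 4)) n"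
    unfolding g_def map_awp[OF R'.field_homo_axioms]
    by (simp add: R'.power) (simp add: \<rho>'_def rat_eval_sqrt_mab[OF i'] rat_eval_par_b[OF i'] rat_eval_sqrt_mcd[OF i']
        rat_eval_par_d[OF i'] rat_eval_q_root[OF i'])
  have "inj \<rho>" by (simp add: inj_on_def R.eq_iff)
  hence s: "shift_params N h (\<rho> y) = \<rho>' y" for y
    by (simp add: shift_params_def \<rho>_def[symmetric] \<rho>'_def[symmetric])
  have s0: "shift_params N h 0 = 0" using s[of 0] by simp
  have "Poly_Mapping.map (shift_params N h) (Poly_Mapping.map \<rho> g) = Poly_Mapping.map \<rho>' g"
    by (rule poly_mapping_eqI) (simp add: lookup_map_0 s0 s)
  thus ?thesis by (simp add: askey_wilson_shifted_def askey_wilson_eq g g')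
qed

end


section \<open>Difference operators and their leading coefficients\<close>

text \<open>Vanishing power sums vanish against every polynomial in the nodes; one with roots at all
  nodes but \<open>y i\<close> isolates \<open>w i\<close>.\<close>

lemma vandermonde_zero:
  fixes y :: "'i \<Rightarrow> 'a::field"
  assumes A: "finite A" and inj: "inj_on y A" and 0: "\<And>n::nat. (\<Sum>i\<in>A. w i * y i ^ n) = 0" and i: "i \<in> A"
  shows "w i = 0"
proof -
  have p: "(\<Sum>i\<in>A. w i * poly p (y i)) = 0" for p
  proof -
    have "(\<Sum>i\<in>A. w i * poly p (y i)) = (\<Sum>k\<le>degree p. coeff p k * (\<Sum>i\<in>A. w i * y i ^ k))"
      unfolding poly_altdef sum_distrib_left by (subst sum.swap) (simp add: mult_ac)
    thus ?thesis by (simp add: 0)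
  qed
  define q where "q = (\<Prod>j\<in>A - {i}. [:- y j, 1:])"
  have q: "poly q (y j) = 0 \<longleftrightarrow> j \<noteq> i" if "j \<in> A" for j
    using A inj i that by (auto simp: q_def poly_prod inj_on_def)
  have "0 = (\<Sum>j\<in>A. w j * poly q (y j))" by (simp add: p)
  also have "\<dots> = (\<Sum>j\<in>A. if j = i then w i * poly q (y i) else 0)"
    by (rule sum.cong) (use q in auto)
  also have "\<dots> = w i * poly q (y i)" using A i by simp
  finally show ?thesis using q[OF i] by auto
qed

lemma order_pcompose_scale:
  fixes p :: "'a::field poly"
  assumes "\<alpha> \<noteq> 0" "p \<noteq> 0"
  shows "order \<zeta> (pcompose p [:0, \<alpha>:]) = order (\<alpha> * \<zeta>) p"
proof -
  obtain g where g: "p = [:- (\<alpha> * \<zeta>), 1:] ^ order (\<alpha> * \<zeta>) p * g" "\<not> [:- (\<alpha> * \<zeta>), 1:] dvd g"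
    using order_decomp[OF assms(2)] by blast
  define n where "n = order (\<alpha> * \<zeta>) p"
  have g0: "poly g (\<alpha> * \<zeta>) \<noteq> 0" using g(2) by (simp add: poly_eq_0_iff_dvd)
  have pw: "pcompose (x ^ n) y = pcompose x y ^ n" for x y :: "'a poly" and n
    by (induction n) (simp_all add: pcompose_mult pcompose_1)
  have lin: "pcompose [:- (\<alpha> * \<zeta>), 1:] [:0, \<alpha>:] = Polynomial.smult \<alpha> [:- \<zeta>, 1:]"
    by (simp add: pcompose_pCons)
  have "pcompose p [:0, \<alpha>:] = Polynomial.smult (\<alpha> ^ n) ([:- \<zeta>, 1:] ^ n * pcompose g [:0, \<alpha>:])"
    by (subst g(1)) (simp only: n_def[symmetric] pcompose_mult pw lin smult_power mult_smult_left)
  moreover have "order \<zeta> ([:- \<zeta>, 1:] ^ n * pcompose g [:0, \<alpha>:]) = n"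
  proof -
    have "poly (pcompose g [:0, \<alpha>:]) \<zeta> \<noteq> 0" using g0 by (simp add: poly_pcompose mult.commute)
    hence "pcompose g [:0, \<alpha>:] \<noteq> 0" "order \<zeta> (pcompose g [:0, \<alpha>:]) = 0" by (auto intro: order_0I)
    thus ?thesis by (subst order_mult) (auto simp: order_power_n_n)
  qed
  ultimately show ?thesis using assms by (simp add: order_smult n_def)
qed

context q_shift
begin

definition Tn :: "int \<Rightarrow> 'f poly fract \<Rightarrow> 'f poly fract" where
  "Tn n = zscale (r powi n)"

lemma field_homo_Tn: "field_homo (Tn n)"
  unfolding Tn_def by (rule field_homo_zscale) simp

lemma Tn_simps [simp]:
  "Tn n (x + y) = Tn n x + Tn n y" "Tn n (x - y) = Tn n x - Tn n y" "Tn n (x * y) = Tn n x * Tn n y"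
  "Tn n (cz c) = cz c" "Tn n 0 = 0" "Tn n 1 = 1" "Tn n x = 0 \<longleftrightarrow> x = 0" "Tn n (x / y) = Tn n x / Tn n y"
  "Tn n (inverse x) = inverse (Tn n x)" "Tn 0 x = x" "Tn n zz = cz (r powi n) * zz"
  "Tn m (Tn n x) = Tn (m + n) x"
proof -
  interpret T: field_homo "Tn n" by (rule field_homo_Tn)
  show "Tn n (x + y) = Tn n x + Tn n y" "Tn n (x - y) = Tn n x - Tn n y" "Tn n (x * y) = Tn n x * Tn n y"
    "Tn n 0 = 0" "Tn n 1 = 1" "Tn n x = 0 \<longleftrightarrow> x = 0" "Tn n (x / y) = Tn n x / Tn n y" "Tn n (inverse x) = inverse (Tn n x)"
    by (simp_all add: T.add T.diff T.mult T.divide T.inverse)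
  show "Tn n (cz c) = cz c" "Tn 0 x = x" "Tn n zz = cz (r powi n) * zz" "Tn m (Tn n x) = Tn (m + n) x"
    by (simp_all add: Tn_def zscale_cz zscale_zz zscale_zscale power_int_add)
qed

lemma Tn_sum: "Tn n (sum f A) = (\<Sum>x\<in>A. Tn n (f x))"
  by (induction A rule: infinite_finite_induct) auto

lemma zinv_Tn: "zinv (Tn n x) = Tn (- n) (zinv x)"
  by (simp add: Tn_def zinv_zscale power_int_minus)

lemma zscale_Tn: "zscale r = Tn 1" "zscale (inverse r) = Tn (- 1)"
  by (simp_all add: Tn_def power_int_minus)

definition fsupp :: "(int \<Rightarrow> 'f poly fract) \<Rightarrow> bool" where
  "fsupp c \<longleftrightarrow> finite {n. c n \<noteq> 0}"

definition dop :: "(int \<Rightarrow> 'f poly fract) \<Rightarrow> 'f poly fract \<Rightarrow> 'f poly fract" where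
  "dop c = (\<lambda>f. \<Sum>n | c n \<noteq> 0. c n * Tn n f)"

definition DO :: "('f poly fract \<Rightarrow> 'f poly fract) set" where
  "DO = {S. \<exists>c. fsupp c \<and> S = dop c}"

lemma dop_superset: "finite A \<Longrightarrow> {n. c n \<noteq> 0} \<subseteq> A \<Longrightarrow> dop c f = (\<Sum>n\<in>A. c n * Tn n f)"
  unfolding dop_def by (rule sum.mono_neutral_left) auto

lemma fsupp_finite_superset: "finite A \<Longrightarrow> (\<And>n. n \<notin> A \<Longrightarrow> c n = 0) \<Longrightarrow> fsupp c"
  unfolding fsupp_def by (rule finite_subset[of _ A]) auto

lemma fsupp_add: "fsupp c \<Longrightarrow> fsupp c' \<Longrightarrow> fsupp (\<lambda>n. c n + c' n)"
  by (rule fsupp_finite_superset[of "{n. c n \<noteq> 0} \<union> {n. c' n \<noteq> 0}"]) (auto simp: fsupp_def)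

lemma fsupp_scale: "fsupp c \<Longrightarrow> fsupp (\<lambda>n. x * c n)"
  by (rule fsupp_finite_superset[of "{n. c n \<noteq> 0}"]) (auto simp: fsupp_def)

lemma dop_add: "fsupp c \<Longrightarrow> fsupp c' \<Longrightarrow> dop (\<lambda>n. c n + c' n) f = dop c f + dop c' f"
  by (subst (1 2 3) dop_superset[of "{n. c n \<noteq> 0} \<union> {n. c' n \<noteq> 0}"])
     (auto simp: fsupp_def distrib_right sum.distrib)

lemma dop_scale: "fsupp c \<Longrightarrow> dop (\<lambda>n. x * c n) f = x * dop c f"
  by (subst (1 2) dop_superset[of "{n. c n \<noteq> 0}"]) (auto simp: fsupp_def sum_distrib_left mult.assoc)

lemma klin_dop: "klin (dop c)"
  by (simp add: klin_def dop_def distrib_left sum.distrib sum_distrib_left mult.left_commute)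

lemma klin_DO: "S \<in> DO \<Longrightarrow> klin S"
  by (auto simp: DO_def klin_dop)

definition cconv :: "(int \<Rightarrow> 'f poly fract) \<Rightarrow> (int \<Rightarrow> 'f poly fract) \<Rightarrow> int \<Rightarrow> 'f poly fract" where
  "cconv c c' n = (\<Sum>i | c i \<noteq> 0. c i * Tn i (c' (n - i)))"

lemma
  assumes "fsupp c" "fsupp c'"
  shows fsupp_cconv: "fsupp (cconv c c')"
    and dop_comp: "dop c (dop c' f) = dop (cconv c c') f"
proof -
  let ?A = "{n. c n \<noteq> 0}" and ?B = "{n. c' n \<noteq> 0}"
  let ?C = "(\<lambda>(i, j). i + j) ` (?A \<times> ?B)"
  have fin: "finite ?A" "finite ?B" using assms by (auto simp: fsupp_def)
  have supp: "cconv c c' n = 0" if "n \<notin> ?C" for n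
    unfolding cconv_def
  proof (rule sum.neutral, rule ballI)
    fix i assume "i \<in> ?A"
    hence "n - i \<notin> ?B" using that by (force simp: image_iff)
    thus "c i * Tn i (c' (n - i)) = 0" by simp
  qed
  show "fsupp (cconv c c')" by (rule fsupp_finite_superset[of ?C]) (use fin supp in auto)
  have "dop (cconv c c') f = (\<Sum>n\<in>?C. cconv c c' n * Tn n f)"
    by (rule dop_superset) (use fin supp in blast)+
  also have "\<dots> = (\<Sum>i\<in>?A. \<Sum>n\<in>?C. c i * Tn i (c' (n - i)) * Tn n f)"
    unfolding cconv_def sum_distrib_right by (rule sum.swap)
  also have "\<dots> = (\<Sum>i\<in>?A. \<Sum>j\<in>?B. c i * Tn i (c' j) * Tn (i + j) f)"
  proof (rule sum.cong[OF refl])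
    fix i assume i: "i \<in> ?A"
    have "(\<Sum>n\<in>?C. c i * Tn i (c' (n - i)) * Tn n f) = (\<Sum>n\<in>(\<lambda>j. i + j) ` ?B. c i * Tn i (c' (n - i)) * Tn n f)"
    proof (rule sum.mono_neutral_right)
      show "\<forall>n\<in>?C - (\<lambda>j. i + j) ` ?B. c i * Tn i (c' (n - i)) * Tn n f = 0"
      proof
        fix n assume "n \<in> ?C - (\<lambda>j. i + j) ` ?B"
        hence "n - i \<notin> ?B" by (metis (no_types, lifting) DiffE add.commute diff_add_cancel imageI)
        thus "c i * Tn i (c' (n - i)) * Tn n f = 0" by simp
      qed
    qed (use fin i in auto)
    also have "\<dots> = (\<Sum>j\<in>?B. c i * Tn i (c' j) * Tn (i + j) f)"
      by (subst sum.reindex) (auto simp: inj_on_def)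
    finally show "(\<Sum>n\<in>?C. c i * Tn i (c' (n - i)) * Tn n f) = (\<Sum>j\<in>?B. c i * Tn i (c' j) * Tn (i + j) f)" .
  qed
  also have "\<dots> = dop c (dop c' f)"
    by (simp add: dop_def Tn_sum sum_distrib_left mult.assoc)
  finally show "dop c (dop c' f) = dop (cconv c c') f" ..
qed

lemma DO_I: "fsupp c \<Longrightarrow> (\<And>f. S f = dop c f) \<Longrightarrow> S \<in> DO"
  unfolding DO_def by blast

lemma DO_E: "S \<in> DO \<Longrightarrow> (\<And>c. fsupp c \<Longrightarrow> S = dop c \<Longrightarrow> thesis) \<Longrightarrow> thesis"
  unfolding DO_def by blast

lemma DO_comp:
  assumes "S \<in> DO" "S' \<in> DO"
  shows "(\<lambda>f. S (S' f)) \<in> DO"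
proof -
  obtain c c' where c: "fsupp c" "S = dop c" "fsupp c'" "S' = dop c'" using assms by (auto elim!: DO_E)
  show ?thesis by (rule DO_I[OF fsupp_cconv[OF c(1,3)]]) (simp only: c dop_comp[OF c(1,3)])
qed

lemma DO_add:
  assumes "S \<in> DO" "S' \<in> DO"
  shows "(\<lambda>f. S f + S' f) \<in> DO"
proof -
  obtain c c' where c: "fsupp c" "S = dop c" "fsupp c'" "S' = dop c'" using assms by (auto elim!: DO_E)
  show ?thesis by (rule DO_I[OF fsupp_add[OF c(1,3)]]) (simp only: c dop_add[OF c(1,3)])
qed

lemma DO_scale:
  assumes "S \<in> DO"
  shows "(\<lambda>f. x * S f) \<in> DO"
proof -
  obtain c where c: "fsupp c" "S = dop c" using assms by (auto elim!: DO_E)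
  show ?thesis by (rule DO_I[OF fsupp_scale[OF c(1)]]) (simp only: c dop_scale[OF c(1)])
qed

lemma fsupp_single: "fsupp (\<lambda>n. if n = k then x else 0)"
  by (rule fsupp_finite_superset[of "{k}"]) auto

lemma dop_single: "dop (\<lambda>n. if n = k then x else 0) f = x * Tn k f"
  by (subst dop_superset[of "{k}"]) auto

lemma DO_mult_Tn: "(\<lambda>f. x * Tn k f) \<in> DO"
  by (rule DO_I[OF fsupp_single]) (rule dop_single[symmetric])

lemma DO_id: "(\<lambda>f. f) \<in> DO"
  using DO_mult_Tn[of 1 0] by simp

lemma DO_zero: "(\<lambda>f. 0) \<in> DO"
  using DO_mult_Tn[of 0 0] by simp

lemma Sym_powi_sum: "zz ^ m + inverse zz ^ m \<in> (Sym :: 'f poly fract set)"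
proof -
  have "zz ^ m + inverse zz ^ m = (zz powi int m + zz powi (- int m) :: 'f poly fract)"
    by (simp add: power_int_minus power_inverse)
  also have "\<dots> \<in> Laur" by (intro Laur_closed)
  finally show ?thesis by (simp add: Sym_def zinv.add zinv.power zinv.inverse add.commute)
qed

lemma cz_zz_zz_neq_1: "cz x * zz * (cz y * zz) \<noteq> (1 :: 'f poly fract)"
proof
  assume a: "cz x * zz * (cz y * zz) = (1 :: 'f poly fract)"
  have "lz (Poly_Mapping.single 2 (x * y)) = cz x * zz * (cz y * zz)"
    by (simp add: cz.mult power2_eq_square mult_ac)
  also have "\<dots> = lz 1" using a by simp
  finally have "Poly_Mapping.single (2::int) (x * y) = 1" by (simp only: lz_eq_iff)
  from arg_cong[OF this, of "\<lambda>f. Poly_Mapping.lookup f 0"] show False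
    by (simp add: lookup_single when_def)
qed

text \<open>Already the functions \<open>z^m + z^(-m)\<close> suffice: the nodes
  \<open>r^n z\<close> and their inverses are pairwise distinct elements of the field of rational
  functions, so a Vandermonde argument applies. An operator is thus determined by its restriction to
  \<open>Sym\<close>.\<close>

lemma dop_zero:
  assumes c: "fsupp c" and 0: "\<And>f. f \<in> Sym \<Longrightarrow> dop c f = 0"
  shows "c n = 0"
proof (rule ccontr)
  assume n: "c n \<noteq> 0"
  let ?A = "{n. c n \<noteq> 0}"
  define x where "x n = cz (r powi n) * zz" for n
  define y where "y = (\<lambda>(n, s). if s then x n else inverse (x n))"
  have x0: "x n \<noteq> 0" for n by (simp add: x_def)
  have xx: "x m * x n \<noteq> 1" for m n unfolding x_def by (rule cz_zz_zz_neq_1)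
  have xi: "x m = x n \<longleftrightarrow> m = n" for m n by (simp add: x_def cz.eq_iff r_powi_eq_iff)
  have xinv: "x m = inverse (x n) \<longleftrightarrow> False" "inverse (x m) = x n \<longleftrightarrow> False" for m n
    using xx[of m n] x0[of m] x0[of n] by (auto simp: field_simps)
  have "c (fst (n, True)) = 0"
  proof (rule vandermonde_zero[where A = "?A \<times> UNIV" and y = y and w = "\<lambda>p. c (fst p)"])
    show "finite (?A \<times> (UNIV :: bool set))" using c by (simp add: fsupp_def)
    show "inj_on y (?A \<times> UNIV)" by (auto simp: inj_on_def y_def xi xinv split: if_splits)
    fix m :: nat
    have "(\<Sum>p\<in>?A \<times> UNIV. c (fst p) * y p ^ m) = (\<Sum>n\<in>?A. \<Sum>s\<in>UNIV. c n * y (n, s) ^ m)"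
      by (simp add: sum.cartesian_product case_prod_unfold)
    also have "\<dots> = (\<Sum>n\<in>?A. c n * (x n ^ m + inverse (x n) ^ m))"
      by (simp add: UNIV_bool y_def distrib_left add.commute)
    also have "\<dots> = dop c (zz ^ m + inverse zz ^ m)"
    proof -
      have "Tn n (zz ^ m) = x n ^ m" "Tn n (inverse zz ^ m) = inverse (x n) ^ m" for n m
        by (induction m) (simp_all add: x_def)
      thus ?thesis by (simp add: dop_def)
    qed
    also have "\<dots> = 0" by (rule 0[OF Sym_powi_sum])
    finally show "(\<Sum>p\<in>?A \<times> UNIV. c (fst p) * y p ^ m) = 0" .
  qed (use n in auto)
  thus False using n by simp
qed

lemma dop_coeff_unique:
  assumes "fsupp c" "fsupp c'" "\<And>f. f \<in> Sym \<Longrightarrow> dop c f = dop c' f"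
  shows "c = c'"
proof
  fix n
  have f: "fsupp (\<lambda>n. (- 1) * c' n)" by (rule fsupp_scale[OF assms(2)])
  have "c n + (- 1) * c' n = 0"
  proof (rule dop_zero[OF fsupp_add[OF assms(1) f]])
    show "dop (\<lambda>n. c n + (- 1) * c' n) f = 0" if "f \<in> Sym" for f
      using assms(3)[OF that] dop_add[OF assms(1) f, of f] dop_scale[OF assms(2), of "- 1" f] by simp
  qed
  thus "c n = c' n" by simp
qed

lemma DO_ext:
  assumes "S \<in> DO" "S' \<in> DO" "\<And>f. f \<in> Sym \<Longrightarrow> S f = S' f"
  shows "S = S'"
  using assms dop_coeff_unique by (auto simp: DO_def)

definition leading :: "('f poly fract \<Rightarrow> 'f poly fract) \<Rightarrow> int \<Rightarrow> 'f poly fract \<Rightarrow> bool" where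
  "leading S s x \<longleftrightarrow> x \<noteq> 0 \<and> (\<exists>c. fsupp c \<and> S = dop c \<and> c s = x \<and> (\<forall>n>s. c n = 0))"

lemma leadingI: "x \<noteq> 0 \<Longrightarrow> fsupp c \<Longrightarrow> (\<And>f. S f = dop c f) \<Longrightarrow> c s = x \<Longrightarrow> (\<And>n. n > s \<Longrightarrow> c n = 0) \<Longrightarrow> leading S s x"
  unfolding leading_def by blast

lemma leadingE:
  assumes "leading S s x"
  obtains c where "x \<noteq> 0" "fsupp c" "\<And>f. S f = dop c f" "c s = x" "\<And>n. n > s \<Longrightarrow> c n = 0"
  using assms unfolding leading_def by blast

lemma leading_DO: "leading S s x \<Longrightarrow> S \<in> DO"
  by (auto simp: leading_def DO_def)

lemma leading_unique: "leading S s x \<Longrightarrow> leading S s' x' \<Longrightarrow> s = s' \<and> x = x'"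
proof -
  assume "leading S s x" "leading S s' x'"
  then obtain c c' where c: "x \<noteq> 0" "x' \<noteq> 0" "fsupp c" "fsupp c'" "S = dop c" "S = dop c'" "c s = x" "c' s' = x'"
     "\<forall>n>s. c n = 0" "\<forall>n>s'. c' n = 0" by (auto simp: leading_def)
  have cc: "c = c'" by (rule dop_coeff_unique) (use c in auto)
  have "s = s'" by (rule linorder_cases[of s s']) (use c cc in auto)
  thus ?thesis using c cc by auto
qed

lemma leading_zero: "\<not> leading (\<lambda>_. 0) s x"
proof
  assume "leading (\<lambda>_. 0) s x"
  then obtain c where c: "x \<noteq> 0" "fsupp c" "(\<lambda>_. 0) = dop c" "c s = x" by (auto simp: leading_def)
  have "c s = 0" by (rule dop_zero[OF c(2)]) (simp flip: c(3))
  thus False using c by simp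
qed

lemma DO_leading: "S \<in> DO \<Longrightarrow> S \<noteq> (\<lambda>_. 0) \<Longrightarrow> \<exists>s x. leading S s x"
proof -
  assume S: "S \<in> DO" "S \<noteq> (\<lambda>_. 0)"
  then obtain c where c: "fsupp c" "S = dop c" by (auto simp: DO_def)
  let ?A = "{n. c n \<noteq> 0}"
  have fin: "finite ?A" using c by (simp add: fsupp_def)
  have "?A \<noteq> {}"
  proof
    assume e: "?A = {}"
    have "S = (\<lambda>_. 0)" unfolding c(2) dop_def e by simp
    thus False using S(2) by contradiction
  qed
  hence M: "Max ?A \<in> ?A" by (rule Max_in[OF fin])
  have "c n = 0" if "n > Max ?A" for n
  proof (rule ccontr)
    assume "c n \<noteq> 0"
    hence "n \<le> Max ?A" by (intro Max_ge[OF fin]) simp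
    thus False using that by simp
  qed
  moreover have "c (Max ?A) \<noteq> 0" using M by (rule CollectD)
  ultimately have "leading S (Max ?A) (c (Max ?A))"
    by (intro leadingI[OF _ c(1) _ refl]) (assumption | rule fun_cong[OF c(2)])+
  thus ?thesis by blast
qed

lemma leading_comp:
  assumes "leading S s x" "leading S' s' x'"
  shows "leading (\<lambda>f. S (S' f)) (s + s') (x * Tn s x')"
proof -
  obtain c c' where c: "x \<noteq> 0" "x' \<noteq> 0" "fsupp c" "fsupp c'" "S = dop c" "S' = dop c'" "c s = x" "c' s' = x'"
     "\<forall>n>s. c n = 0" "\<forall>n>s'. c' n = 0" using assms unfolding leading_def by blast
  have fin: "finite {n. c n \<noteq> 0}" using c by (simp add: fsupp_def)
  have "cconv c c' (s + s') = (\<Sum>i | c i \<noteq> 0. if i = s then x * Tn s x' else 0)"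
    unfolding cconv_def
  proof (rule sum.cong[OF refl])
    fix i assume i: "i \<in> {i. c i \<noteq> 0}"
    hence "i \<le> s" using c(9) by force
    thus "c i * Tn i (c' (s + s' - i)) = (if i = s then x * Tn s x' else 0)"
      using c(7,8,10) by auto
  qed
  also have "\<dots> = x * Tn s x'" using c fin by simp
  finally have "cconv c c' (s + s') = x * Tn s x'" .
  moreover have "cconv c c' n = 0" if "n > s + s'" for n
    unfolding cconv_def
  proof (rule sum.neutral, rule ballI)
    fix i assume i: "i \<in> {i. c i \<noteq> 0}"
    hence "i \<le> s" using c(9) by force
    hence "c' (n - i) = 0" using c(10) that by auto
    thus "c i * Tn i (c' (n - i)) = 0" by simp
  qed
  ultimately show ?thesis
    by (intro leadingI[where c = "cconv c c'"]) (use c(1,2) dop_comp[OF c(3,4)] fsupp_cconv[OF c(3,4)] in \<open>simp_all add: c(5,6)\<close>)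
qed

lemma leading_scale:
  assumes "leading S s x" "y \<noteq> 0"
  shows "leading (\<lambda>f. y * S f) s (y * x)"
proof -
  obtain c where c: "x \<noteq> 0" "fsupp c" "\<And>f. S f = dop c f" "c s = x" "\<And>n. n > s \<Longrightarrow> c n = 0"
    using assms(1) by (rule leadingE) blast
  show ?thesis
    by (rule leadingI[OF _ fsupp_scale[OF c(2)]]) (simp_all only: c dop_scale[OF c(2)] assms mult_zero_right mult_eq_0_iff simp_thms)
qed

lemma leading_add_lower:
  assumes "leading S s x" "fsupp c'" "\<And>n. n \<ge> s \<Longrightarrow> c' n = 0"
  shows "leading (\<lambda>f. S f + dop c' f) s x"
proof -
  obtain c where c: "x \<noteq> 0" "fsupp c" "\<And>f. S f = dop c f" "c s = x" "\<And>n. n > s \<Longrightarrow> c n = 0"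
    using assms(1) by (rule leadingE) blast
  show ?thesis
    by (rule leadingI[OF c(1) fsupp_add[OF c(2) assms(2)]])
       (simp_all add: c(3,4,5) dop_add[OF c(2) assms(2)] assms(3))
qed

lemma leading_diff:
  assumes "leading S s x" "leading S' s x"
  shows "(\<lambda>f. S f - S' f) = (\<lambda>_. 0) \<or> (\<exists>s' x'. s' < s \<and> leading (\<lambda>f. S f - S' f) s' x')"
proof (cases "(\<lambda>f. S f - S' f) = (\<lambda>_. 0)")
  case False
  obtain c c' where c: "fsupp c" "fsupp c'" "S = dop c" "S' = dop c'" "c s = x" "c' s = x"
     "\<forall>n>s. c n = 0" "\<forall>n>s. c' n = 0" using assms unfolding leading_def by blast
  define e where "e n = c n + (- 1) * c' n" for n
  have e: "fsupp e" unfolding e_def by (intro fsupp_add fsupp_scale c)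
  have eS: "(\<lambda>f. S f - S' f) = dop e"
  proof
    fix f
    have "e = (\<lambda>n. c n + (- 1) * c' n)" by (rule ext) (rule e_def)
    thus "S f - S' f = dop e f"
      by (simp only: c(3,4) dop_add[OF c(1) fsupp_scale[OF c(2)]] dop_scale[OF c(2)]) simp
  qed
  have "(\<lambda>f. S f - S' f) \<in> DO" using e eS by (auto simp: DO_def)
  then obtain s' x' where t: "leading (\<lambda>f. S f - S' f) s' x'" using DO_leading False by blast
  then obtain e' where e': "fsupp e'" "dop e = dop e'" "e' s' = x'" "x' \<noteq> 0" unfolding leading_def eS by blast
  have "e = e'" by (rule dop_coeff_unique) (use e e' in auto)
  moreover have "e n = 0" if "n \<ge> s" for n using that c by (cases "n = s") (auto simp: e_def)
  ultimately have e0: "e' n = 0" if "n \<ge> s" for n using that by simp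
  have "s' < s"
  proof (rule ccontr)
    assume "\<not> s' < s"
    thus False using e0[of s'] e'(3,4) by simp
  qed
  thus ?thesis using t by blast
qed simp

text \<open>Conjugation by \<open>z -> 1/z\<close> does not change the action on symmetric
  functions, but it moves the reflected coefficient at \<open>n\<close> to \<open>- n\<close>.
  Coefficients therefore occur at opposite exponents in pairs.\<close>

lemma leading_nonneg:
  assumes t: "leading S s x" and S: "\<And>f. f \<in> Sym \<Longrightarrow> S f \<in> Sym"
  shows "s \<ge> 0"
proof (rule ccontr)
  assume s: "\<not> s \<ge> 0"
  obtain c where c: "x \<noteq> 0" "fsupp c" "S = dop c" "c s = x" "\<forall>n>s. c n = 0" using t unfolding leading_def by blast
  define c' where "c' n = zinv (c (- n))" for n
  have supp: "{n. c' n \<noteq> 0} = uminus ` {n. c n \<noteq> 0}"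
    by (auto simp: c'_def image_iff) (metis minus_minus)
  have c': "fsupp c'" using c(2) unfolding fsupp_def supp by simp
  have "dop c' f = dop c f" if f: "f \<in> Sym" for f
  proof -
    have "dop c' f = (\<Sum>n | c n \<noteq> 0. zinv (c n) * Tn (- n) f)"
      unfolding dop_def supp by (subst sum.reindex) (auto simp: c'_def inj_on_def)
    also have "\<dots> = zinv (dop c f)"
      using f by (simp add: dop_def zinv.sum zinv.mult zinv_Tn Sym_def)
    also have "\<dots> = dop c f" using S[OF f] c(3) by (simp add: Sym_def)
    finally show ?thesis .
  qed
  hence "c' = c" by (intro dop_coeff_unique c' c)
  hence "c s = zinv (c (- s))" unfolding c'_def by metis
  thus False using c s by simp
qed

text \<open>Invariance under \<open>z -> qz\<close> gives invariance under all
  \<open>z -> q^n z\<close>. After clearing denominators, the comparison for all \<open>n\<close>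
  shows numerator and denominator to be proportional.\<close>

lemma Tn_2_fixed:
  assumes "Tn 2 g = g"
  shows "\<exists>x. g = cz x"
proof -
  obtain p v where pv: "g = to_fract p / to_fract v" "v \<noteq> 0"
    by (cases g) (auto simp: Fract_conv_to_fract)
  have T: "Tn (2 * int n) g = g" for n
  proof (induction n)
    case (Suc n)
    have "Tn (2 * int (Suc n)) g = Tn 2 (Tn (2 * int n) g)" by simp
    thus ?case using Suc assms by simp
  qed simp
  have tf: "Tn k (to_fract u) = to_fract (pcompose u [:0, r powi k:])" for k u
  proof (induction u)
    case (pCons a u)
    have "to_fract (pcompose (pCons a u) [:0, r powi k:]) = cz a + cz (r powi k) * zz * to_fract (pcompose u [:0, r powi k:])"
      by (simp add: pcompose_pCons cz_def zz_def flip: to_fract_add to_fract_mult)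
    thus ?case by (simp add: to_fract_pCons pCons.IH)
  qed simp
  have co: "coeff (pcompose u [:0, y:]) k = coeff u k * y ^ k" for u :: "'f poly" and y k
    using coeff_pcompose_linear[of u y k] by (simp add: mult.commute)
  have eq: "pcompose p [:0, r powi (2 * int n):] * v = p * pcompose v [:0, r powi (2 * int n):]" for n
  proof -
    have nz: "to_fract v \<noteq> 0" "to_fract (pcompose v [:0, r powi (2 * int n):]) \<noteq> 0"
      using pv(2) tf[of "2 * int n" v, symmetric] by simp_all
    have "to_fract (pcompose p [:0, r powi (2 * int n):]) / to_fract (pcompose v [:0, r powi (2 * int n):]) = to_fract p / to_fract v"
      using T[of n] unfolding pv by (simp add: tf)
    hence "to_fract (pcompose p [:0, r powi (2 * int n):] * v) = to_fract (p * pcompose v [:0, r powi (2 * int n):])"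
      using nz by (simp add: frac_eq_eq)
    thus ?thesis unfolding to_fract_eq_iff .
  qed
  \<comment> \<open>The coefficient of \<open>z^m\<close> in the cleared identity is a combination
    of \<open>n\<close>-th powers of the distinct nodes \<open>q^i\<close>, so each term
    vanishes.\<close>
  have cross: "coeff p i * coeff v (m - i) = coeff v i * coeff p (m - i)" if "i \<le> m" for i m
  proof -
    have "coeff p i * coeff v (m - i) - coeff v i * coeff p (m - i) = 0"
    proof (rule vandermonde_zero[where A = "{..m}" and y = "\<lambda>i. r powi (2 * int i)" and
          w = "\<lambda>i. coeff p i * coeff v (m - i) - coeff v i * coeff p (m - i)"])
      show "inj_on (\<lambda>i. r powi (2 * int i)) {..m}" by (auto simp: inj_on_def r_powi_eq_iff)
      fix n :: nat
      have pw: "(r powi (2 * int n)) ^ i = (r powi (2 * int i)) ^ n" for i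
      proof -
        have "(r powi k) ^ j = r powi (k * int j)" for k j by (simp add: power_int_mult)
        thus ?thesis by (simp only: mult_ac)
      qed
      have "0 = coeff (pcompose p [:0, r powi (2 * int n):] * v) m - coeff (pcompose v [:0, r powi (2 * int n):] * p) m"
        using eq[of n] by (simp add: mult.commute)
      also have "\<dots> = (\<Sum>i\<le>m. (coeff p i * coeff v (m - i) - coeff v i * coeff p (m - i)) * (r powi (2 * int i)) ^ n)"
        unfolding coeff_mult co pw sum_subtractf[symmetric] by (rule sum.cong) (simp_all add: algebra_simps)
      finally show "(\<Sum>i\<le>m. (coeff p i * coeff v (m - i) - coeff v i * coeff p (m - i)) * (r powi (2 * int i)) ^ n) = 0" ..
    qed (use that in auto)
    thus ?thesis by simp
  qed
  define j where "j = degree v"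
  have j: "coeff v j \<noteq> 0" using pv by (simp add: j_def)
  define \<kappa> where "\<kappa> = coeff p j / coeff v j"
  have p: "p = [:\<kappa>:] * v"
  proof (rule poly_eqI)
    fix i
    show "coeff p i = coeff ([:\<kappa>:] * v) i"
      using cross[of i "i + j"] j by (simp add: field_simps \<kappa>_def)
  qed
  have "g = cz \<kappa> * to_fract v / to_fract v"
    unfolding pv(1) by (subst p) (simp only: cz_def to_fract_mult)
  thus ?thesis using pv(2) by (intro exI[of _ \<kappa>]) simp
qed

end


section \<open>Intertwiners of Askey--Wilson operators\<close>

context q_shift
begin

lemma leading_mult_Tn: "x \<noteq> 0 \<Longrightarrow> leading (\<lambda>f. x * Tn k f) k x"
  by (rule leadingI[OF _ fsupp_single[of k x]]) (simp_all add: dop_single)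

lemma leading_Dop:
  assumes "M \<noteq> 0"
  shows "leading (Dop r M) 1 (M / zdiff)"
proof -
  have "leading (\<lambda>f. M / zdiff * Tn 1 f + dop (\<lambda>n. if n = - 1 then - (zinv M / zdiff) else 0) f) 1 (M / zdiff)"
    by (rule leading_add_lower[OF leading_mult_Tn fsupp_single]) (use assms in simp_all)
  moreover have "(\<lambda>f. M / zdiff * Tn 1 f + dop (\<lambda>n. if n = - 1 then - (zinv M / zdiff) else 0) f) = Dop r M"
    by (rule ext) (simp add: Dop_def dop_single zscale_Tn diff_divide_distrib)
  ultimately show ?thesis by simp
qed

lemma linear_factor_nonzero: "1 - cz x * zz \<noteq> (0 :: 'f poly fract)"
proof -
  have "1 - cz x * zz = to_fract [:1, - x:]"
    using to_fract_pCons[of 1 "[:- x:]"] by (simp add: cz_def[symmetric] cz.uminus mult.commute)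
  thus ?thesis by simp
qed

lemma linear_factor_neq [simp]: "cz x * zz \<noteq> (1 :: 'f poly fract)"
  using linear_factor_nonzero[of x] by auto

definition nu :: "'f \<Rightarrow> 'f \<Rightarrow> 'f \<Rightarrow> 'f \<Rightarrow> 'f poly fract" where
  "nu a b c d = (1 - cz a * zz) * (1 - cz b * zz) * (1 - cz c * zz) * (1 - cz d * zz) * (inverse zz * inverse zz)"

definition Ac :: "'f \<Rightarrow> 'f \<Rightarrow> 'f \<Rightarrow> 'f \<Rightarrow> 'f poly fract" where
  "Ac a b c d = cz (inverse r) * (nu a b c d / zdiff * Tn 1 (1 / zdiff))"

lemma Ac_nonzero: "Ac a b c d \<noteq> 0"
  by (simp add: Ac_def nu_def linear_factor_nonzero)

lemma leading_Lop: "leading (Lop r a b c d) 2 (Ac a b c d)"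
proof -
  have 1: "leading (Splus r) 1 (1 / zdiff)" unfolding Splus_def by (rule leading_Dop) simp
  have 2: "leading (Sminus r a b c d) 1 (nu a b c d / zdiff)"
    unfolding Sminus_def nu_def by (rule leading_Dop) (simp add: linear_factor_nonzero)
  have "leading (\<lambda>f. cz (inverse r) * Sminus r a b c d (Splus r f)) (1 + 1) (Ac a b c d)"
    unfolding Ac_def by (rule leading_scale[OF leading_comp[OF 2 1]]) simp
  hence 3: "leading (\<lambda>f. cz (inverse r) * Sminus r a b c d (Splus r f)) 2 (Ac a b c d)" by simp
  have "leading (\<lambda>f. cz (inverse r) * Sminus r a b c d (Splus r f) + dop (\<lambda>n. if n = 0 then cz (1 + a * b * c * d / r ^ 2) else 0) f) 2 (Ac a b c d)"
    by (rule leading_add_lower[OF 3 fsupp_single]) simp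
  moreover have "(\<lambda>f. cz (inverse r) * Sminus r a b c d (Splus r f) + dop (\<lambda>n. if n = 0 then cz (1 + a * b * c * d / r ^ 2) else 0) f) = Lop r a b c d"
    by (rule ext) (simp add: Lop_def dop_single)
  ultimately show ?thesis by simp
qed

text \<open>Intertwiners of \<open>L\<close> and \<open>L'\<close> up to the scalar
  \<open>\<kappa>\<close>. The conditions refer to \<open>Sym\<close> alone, where the relations of
  the elementary operators hold by the basis computations; equality of operators is recovered
  through \<open>DO_ext\<close>.\<close>

definition Sh :: "('f poly fract \<Rightarrow> 'f poly fract) \<Rightarrow> ('f poly fract \<Rightarrow> 'f poly fract) \<Rightarrow> 'f \<Rightarrow>
    ('f poly fract \<Rightarrow> 'f poly fract) set" where
  "Sh L L' \<kappa> = {S \<in> DO. \<forall>f\<in>Sym. S f \<in> Sym \<and> S (L f) = cz \<kappa> * L' (S f)}"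

lemma ShI: "S \<in> DO \<Longrightarrow> (\<And>f. f \<in> Sym \<Longrightarrow> S f \<in> Sym) \<Longrightarrow>
    (\<And>f. f \<in> Sym \<Longrightarrow> S (L f) = cz \<kappa> * L' (S f)) \<Longrightarrow> S \<in> Sh L L' \<kappa>"
  by (simp add: Sh_def)

lemma ShD:
  assumes "S \<in> Sh L L' \<kappa>"
  shows "S \<in> DO" "klin S" "f \<in> Sym \<Longrightarrow> S f \<in> Sym" "f \<in> Sym \<Longrightarrow> S (L f) = cz \<kappa> * L' (S f)"
  using assms klin_DO by (auto simp: Sh_def)

lemma Sh_zero: "klin L' \<Longrightarrow> (\<lambda>_. 0) \<in> Sh L L' \<kappa>"
  by (rule ShI) (simp_all add: DO_zero)

lemma Sh_add: "klin L' \<Longrightarrow> S \<in> Sh L L' \<kappa> \<Longrightarrow> S' \<in> Sh L L' \<kappa> \<Longrightarrow> (\<lambda>f. S f + S' f) \<in> Sh L L' \<kappa>"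
  by (rule ShI) (simp_all add: DO_add ShD klin_add distrib_left)

lemma Sh_scale: "klin L' \<Longrightarrow> S \<in> Sh L L' \<kappa> \<Longrightarrow> (\<lambda>f. cz x * S f) \<in> Sh L L' \<kappa>"
  by (rule ShI) (simp_all add: DO_scale ShD klin_scale mult.left_commute)

lemma Sh_comp: "S \<in> Sh L L' \<kappa> \<Longrightarrow> S' \<in> Sh L' L'' \<kappa>' \<Longrightarrow> (\<lambda>f. S' (S f)) \<in> Sh L L'' (\<kappa> * \<kappa>')"
  by (rule ShI) (simp_all add: DO_comp ShD klin_scale[OF ShD(2)] cz.mult mult.assoc)

lemma Sh_id: "(\<lambda>f. f) \<in> Sh L L 1"
  by (rule ShI) (simp_all add: DO_id)

lemma Lop_DO: "Lop r a b c d \<in> DO"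
  by (rule leading_DO[OF leading_Lop])

lemma Sh_Lop: "Lop r a b c d \<in> Sh (Lop r a b c d) (Lop r a b c d) 1"
  by (rule ShI) (simp_all add: Lop_DO Lop_Sym)

lemma Lop_pow:
  "((Lop r a b c d) ^^ k) \<in> Sh (Lop r a b c d) (Lop r a b c d) 1 \<and> (\<exists>y. leading ((Lop r a b c d) ^^ k) (2 * int k) y)"
proof (induction k)
  case 0
  have "leading (\<lambda>f. 1 * Tn 0 f) 0 1" by (rule leading_mult_Tn) simp
  hence "leading id 0 1" by (simp add: id_def)
  moreover have "id \<in> Sh (Lop r a b c d) (Lop r a b c d) 1" using Sh_id by (simp add: id_def)
  ultimately show ?case by (metis funpow.simps(1) mult_zero_right of_nat_0)
next
  case (Suc k)
  let ?L = "Lop r a b c d"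
  obtain y where y: "leading (?L ^^ k) (2 * int k) y" using Suc by blast
  have e: "?L ^^ Suc k = (\<lambda>f. ?L ((?L ^^ k) f))" by (simp add: fun_eq_iff)
  have "(\<lambda>f. ?L ((?L ^^ k) f)) \<in> Sh ?L ?L (1 * 1)" by (rule Sh_comp[OF _ Sh_Lop]) (use Suc in blast)
  moreover have "leading (\<lambda>f. ?L ((?L ^^ k) f)) (2 + 2 * int k) (Ac a b c d * Tn 2 y)"
    by (rule leading_comp[OF leading_Lop y])
  ultimately show ?case unfolding e by (auto simp: algebra_simps)
qed

text \<open>Comparison of the coefficients at the top exponent \<open>s + 2\<close> of
  \<open>S L\<close> and \<open>\<kappa> L' S\<close>.\<close>

lemma leading_equation:
  assumes S: "S \<in> Sh (Lop r a b c d) (Lop r a' b' c' d') \<kappa>" and \<kappa>: "\<kappa> \<noteq> 0" and t: "leading S s x"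
  shows "x * Tn s (Ac a b c d) = cz \<kappa> * (Ac a' b' c' d' * Tn 2 x)"
proof -
  let ?L = "Lop r a b c d" and ?L' = "Lop r a' b' c' d'"
  have 1: "leading (\<lambda>f. S (?L f)) (s + 2) (x * Tn s (Ac a b c d))" by (rule leading_comp[OF t leading_Lop])
  have 2: "leading (\<lambda>f. cz \<kappa> * ?L' (S f)) (2 + s) (cz \<kappa> * (Ac a' b' c' d' * Tn 2 x))"
    by (rule leading_scale[OF leading_comp[OF leading_Lop t]]) (use \<kappa> in simp)
  have "(\<lambda>f. S (?L f)) = (\<lambda>f. cz \<kappa> * ?L' (S f))"
    by (rule DO_ext[OF leading_DO[OF 1] leading_DO[OF 2]]) (rule ShD(4)[OF S])
  with 1 2 show ?thesis using leading_unique by metis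
qed

text \<open>Both leading coefficients satisfy the same first order equation, so their quotient is
  invariant under \<open>z -> qz\<close>.\<close>

lemma leading_ratio:
  assumes "S \<in> Sh (Lop r a b c d) (Lop r a' b' c' d') \<kappa>" "leading S s x"
    and "S' \<in> Sh (Lop r a b c d) (Lop r a' b' c' d') \<kappa>" "leading S' s x'" and \<kappa>: "\<kappa> \<noteq> 0"
  shows "\<exists>y. y \<noteq> 0 \<and> x = cz y * x'"
proof -
  have x: "x \<noteq> 0" "x' \<noteq> 0" using assms by (auto simp: leading_def)
  define A where "A = Tn s (Ac a b c d)"
  define A' where "A' = cz \<kappa> * Ac a' b' c' d'"
  have A: "A \<noteq> 0" "A' \<noteq> 0" using \<kappa> by (simp_all add: A_def A'_def Ac_nonzero)
  have "x * A = A' * Tn 2 x" "x' * A = A' * Tn 2 x'"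
    using leading_equation[OF assms(1) \<kappa> assms(2)] leading_equation[OF assms(3) \<kappa> assms(4)]
    by (simp_all add: A_def A'_def mult.assoc)
  hence "Tn 2 x = x * A / A'" "Tn 2 x' = x' * A / A'" using A by (simp_all add: field_simps)
  hence "Tn 2 (x / x') = x / x'" using x A by simp
  then obtain y where "x / x' = cz y" using Tn_2_fixed by blast
  moreover from this have "y \<noteq> 0" using x by auto
  ultimately show ?thesis using x by (auto simp: field_simps)
qed

text \<open>Numerator and denominator of \<open>Ac\<close> as polynomials, for counting orders of
  vanishing. The roots of \<open>Pd\<close> satisfy \<open>z^2 = 1\<close> or
  \<open>q z^2 = 1\<close>; the assumption on \<open>a ^ 2\<close> in \<open>zero_orbit\<close>
  keeps them off the orbit.\<close>

definition Pn :: "'f \<Rightarrow> 'f \<Rightarrow> 'f \<Rightarrow> 'f \<Rightarrow> 'f poly" where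
  "Pn a b c d = [:1, - a:] * [:1, - b:] * [:1, - c:] * [:1, - d:]"

definition Pd :: "'f poly" where
  "Pd = [:- 1, 0, 1:] * [:- 1, 0, r ^ 2:]"

lemma Tn_to_fract: "Tn k (to_fract u) = to_fract (pcompose u [:0, r powi k:])"
proof (induction u)
  case (pCons a u)
  have "to_fract (pcompose (pCons a u) [:0, r powi k:]) = cz a + cz (r powi k) * zz * to_fract (pcompose u [:0, r powi k:])"
    by (simp add: pcompose_pCons cz_def zz_def flip: to_fract_add to_fract_mult)
  thus ?case by (simp add: to_fract_pCons pCons.IH)
qed simp

lemma Ac_eq: "Ac a b c d = to_fract (Pn a b c d) / to_fract Pd"
proof -
  have l: "to_fract [:1, - x:] = 1 - cz x * zz" for x
    using to_fract_pCons[of 1 "[:- x:]"] by (simp add: cz_def[symmetric] cz.uminus mult.commute)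
  have q: "to_fract [:- 1, 0, x:] = cz x * (zz * zz) - 1" for x
    by (simp add: to_fract_pCons cz.uminus mult_ac)
  define w where "w = zz * zz - (1 :: 'f poly fract)"
  define w' where "w' = cz (r ^ 2) * (zz * zz) - 1"
  have z: "zdiff = w / zz" by (simp add: zdiff_def w_def field_simps)
  have w: "w \<noteq> 0" using z zdiff_nonzero by auto
  have z': "Tn 1 zdiff = w' / (cz r * zz)"
    unfolding zdiff_def w'_def by (simp add: cz.mult field_simps power2_eq_square)
  have w': "w' \<noteq> 0"
  proof
    assume "w' = 0"
    hence "Tn 1 zdiff = 0" using z' by simp
    thus False by simp
  qed
  have "to_fract Pd = w * w'" by (simp only: Pd_def to_fract_mult q w_def w'_def cz.one mult_1)
  moreover have "Ac a b c d = (1 - cz a * zz) * (1 - cz b * zz) * (1 - cz c * zz) * (1 - cz d * zz) / (w * w')"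
  proof -
    have iw: "Tn 1 (1 / zdiff) = cz r * zz / w'" by (simp only: Tn_simps(8) Tn_simps(6) z' divide_divide_eq_right mult_1)
    have "cz (inverse r) * (X * (inverse zz * inverse zz) / (w / zz) * (cz r * zz / w')) = X / (w * w')" for X
      unfolding cz.inverse using w w' by (simp add: field_simps)
    note e = this
    show ?thesis unfolding Ac_def nu_def iw unfolding z by (rule e)
  qed
  ultimately show ?thesis by (simp only: Pn_def to_fract_mult l)
qed

lemma poly_Pn: "poly (Pn a b c d) t = (1 - a * t) * (1 - b * t) * (1 - c * t) * (1 - d * t)"
proof -
  have "poly [:1, - x:] t = 1 - x * t" for x by (simp add: mult.commute)
  thus ?thesis by (simp only: Pn_def poly_mult)
qed

lemma poly_Pd: "poly Pd t = (t * t - 1) * (r ^ 2 * (t * t) - 1)"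
proof -
  have "poly [:- 1, 0, x:] t = x * (t * t) - 1" for x :: 'f by (simp add: algebra_simps)
  thus ?thesis by (simp only: Pd_def poly_mult mult_1)
qed

lemma Pn_nonzero: "Pn a b c d \<noteq> 0" and Pd_nonzero: "Pd \<noteq> 0"
  by (simp_all add: Pn_def Pd_def)

text \<open>
  If \<open>x(qz) / x(z)\<close> has divisor \<open>A(r\<^sup>sz) / A'(z)\<close>, the zero \<open>1 / (a r\<^sup>s)\<close> of the numerator has to be
  compensated on its orbit under multiplication by \<open>q\<close>, since the divisor of \<open>x\<close> is finite.
\<close>

lemma zero_orbit:
  assumes x: "x \<noteq> 0" and eq: "x * Tn s (Ac a b c d) = cz \<kappa> * (Ac a' b' c' d' * Tn 2 x)"
    and a0: "a \<noteq> 0" and a2: "\<And>j. a ^ 2 \<noteq> r powi j"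
    and y: "\<And>y j. y \<in> {b, c, d, b', c', d'} \<Longrightarrow> y \<noteq> a * r powi j"
  shows "\<exists>k. a' = a * r powi (s - 2 * k)"
proof (rule ccontr)
  assume no: "\<not> ?thesis"
  obtain u v where uv: "x = to_fract u / to_fract v" "v \<noteq> 0"
    by (cases x) (auto simp: Fract_conv_to_fract)
  have u0: "u \<noteq> 0" using x uv by auto
  have \<kappa>: "\<kappa> \<noteq> 0" using eq x Ac_nonzero by auto
  define sc where "sc p n = pcompose p [:0, r powi n:]" for p n
  have sc0: "sc p n = 0 \<longleftrightarrow> p = 0" for p n
    using Tn_to_fract[of n p, folded sc_def] by (metis to_fract_eq_0_iff Tn_simps(7))
  have osc: "order \<zeta> (sc p n) = order (r powi n * \<zeta>) p" if "p \<noteq> 0" for p n \<zeta>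
    unfolding sc_def by (rule order_pcompose_scale) (use that in auto)
  define P where "P = Pn a b c d"
  define P' where "P' = Pn a' b' c' d'"
  have nz: "P \<noteq> 0" "P' \<noteq> 0" "Pd \<noteq> 0" by (simp_all add: P_def P'_def Pn_nonzero Pd_nonzero)
  have "to_fract (u * sc P s * Pd * sc v 2) = to_fract ([:\<kappa>:] * P' * sc u 2 * v * sc Pd s)"
  proof -
    have "to_fract u / to_fract v * (to_fract (sc P s) / to_fract (sc Pd s)) =
        cz \<kappa> * (to_fract P' / to_fract Pd * (to_fract (sc u 2) / to_fract (sc v 2)))"
      using eq unfolding uv(1) Ac_eq by (simp add: Tn_to_fract sc_def P_def P'_def)
    thus ?thesis using uv nz sc0[of v 2] sc0[of Pd s]
      unfolding to_fract_mult by (simp add: frac_eq_eq cz_def mult_ac)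
  qed
  hence poly_eq: "u * sc P s * Pd * sc v 2 = [:\<kappa>:] * P' * sc u 2 * v * sc Pd s"
    unfolding to_fract_eq_iff .
  have all: "order \<zeta> u + order (r powi s * \<zeta>) P + order \<zeta> Pd + order (r powi 2 * \<zeta>) v =
      order \<zeta> P' + order (r powi 2 * \<zeta>) u + order \<zeta> v + order (r powi s * \<zeta>) Pd" for \<zeta>
  proof -
    have "order \<zeta> (u * sc P s * Pd * sc v 2) = order \<zeta> u + order (r powi s * \<zeta>) P + order \<zeta> Pd + order (r powi 2 * \<zeta>) v"
      using u0 uv nz by (simp add: order_mult sc0 osc)
    moreover have "order \<zeta> ([:\<kappa>:] * P' * sc u 2 * v * sc Pd s) =
        order \<zeta> P' + order (r powi 2 * \<zeta>) u + order \<zeta> v + order (r powi s * \<zeta>) Pd"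
    proof -
      have sm: "[:\<kappa>:] * P' * sc u 2 * v * sc Pd s = Polynomial.smult \<kappa> (P' * sc u 2 * v * sc Pd s)" by simp
      show ?thesis unfolding sm order_smult[OF \<kappa>] using u0 uv nz by (simp add: order_mult sc0 osc)
    qed
    ultimately show ?thesis using poly_eq by simp
  qed
  \<comment> \<open>The orbit under multiplication by \<open>q\<close> of
    \<open>1 / (a r^s)\<close>, which is \<open>\<zeta> 0\<close> and a zero of the numerator after
    the shift by \<open>s\<close>.\<close>
  define \<zeta> where "\<zeta> k = inverse a * r powi (2 * k - s)" for k
  have sz: "r powi s * \<zeta> k = inverse a * r powi (2 * k)" for k
  proof -
    have "r powi s * r powi (2 * k - s) = r powi (2 * k)" by (subst power_int_add[symmetric]) simp_all
    thus ?thesis by (simp only: \<zeta>_def mult.left_commute)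
  qed
  have z1: "r powi 2 * \<zeta> k = \<zeta> (k + 1)" for k
  proof -
    have "r powi 2 * r powi (2 * k - s) = r powi (2 * (k + 1) - s)"
      by (subst power_int_add[symmetric]) (simp_all add: algebra_simps)
    thus ?thesis by (simp only: \<zeta>_def mult.left_commute)
  qed
  have Pd0: "order (inverse a * r powi j) Pd = 0" for j
  proof (rule order_0I)
    let ?t = "inverse a * r powi j"
    have e: "?t * ?t = r powi (2 * j) / a ^ 2"
    proof -
      have "r powi j * r powi j = r powi (2 * j)" by (subst power_int_add[symmetric]) simp_all
      thus ?thesis by (simp add: divide_inverse power2_eq_square mult_ac)
    qed
    have "r powi 2 * r powi (2 * j) = r powi (2 + 2 * j)" by (subst power_int_add[symmetric]) simp_all
    hence e2: "r ^ 2 * (?t * ?t) = r powi (2 + 2 * j) / a ^ 2" unfolding e by simp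
    have "x / a ^ 2 = 1 \<Longrightarrow> a ^ 2 = x" for x using a0 by (simp add: field_simps)
    hence "?t * ?t \<noteq> 1" "r ^ 2 * (?t * ?t) \<noteq> 1" unfolding e2 unfolding e using a2 by blast+
    thus "poly Pd ?t \<noteq> 0" unfolding poly_Pd mult_eq_0_iff right_minus_eq by blast
  qed
  have yv: "1 - y * (inverse a * r powi j) \<noteq> 0" if "y \<in> {b, c, d, b', c', d'}" for y j
  proof
    assume "1 - y * (inverse a * r powi j) = 0"
    hence "y * r powi j = a" using a0 by (simp add: field_simps)
    hence "y = a * r powi (- j)" by (auto simp: power_int_minus field_simps)
    thus False using y[OF that] by blast
  qed
  have Ppoly: "poly P (inverse a * r powi (2 * k)) = 0 \<longleftrightarrow> k = 0" for k
  proof -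
    have "1 - a * (inverse a * r powi (2 * k)) = 0 \<longleftrightarrow> k = 0"
      using a0 r_powi[of "2 * k"] by (auto simp: mult.assoc[symmetric])
    thus ?thesis using yv[of b "2 * k"] yv[of c "2 * k"] yv[of d "2 * k"]
      by (simp only: P_def poly_Pn mult_eq_0_iff insert_iff simp_thms)
  qed
  \<comment> \<open>The negated claim enters here: a zero of \<open>P'\<close> on the orbit could
    only come from \<open>a'\<close>.\<close>
  have P'poly: "order (\<zeta> k) P' = 0" for k
  proof (rule order_0I)
    have "a' \<noteq> a * r powi (s - 2 * k)" using no by blast
    hence "1 - a' * \<zeta> k \<noteq> 0"
    proof -
      have "r powi (2 * k - s) * r powi (s - 2 * k) = 1" by (subst power_int_add[symmetric]) simp_all
      hence "a' = a * r powi (s - 2 * k)" if "a' * r powi (2 * k - s) = a"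
        using that by (metis mult.assoc mult.right_neutral)
      moreover have "a' * r powi (2 * k - s) = a" if "1 - a' * \<zeta> k = 0"
        using that a0 by (simp add: \<zeta>_def field_simps)
      ultimately show ?thesis using \<open>a' \<noteq> _\<close> by blast
    qed
    thus "poly P' (\<zeta> k) \<noteq> 0"
      using yv[of b' "2 * k - s"] yv[of c' "2 * k - s"] yv[of d' "2 * k - s"]
      by (simp only: P'_def poly_Pn \<zeta>_def mult_eq_0_iff insert_iff simp_thms)
  qed
  \<comment> \<open>The order of \<open>x\<close> at \<open>\<zeta> k\<close>. It increases from
    \<open>k = 0\<close> to \<open>k = 1\<close> and is constant elsewhere, yet it is zero far out
    on both sides.\<close>
  define \<omega> where "\<omega> k = int (order (\<zeta> k) u) - int (order (\<zeta> k) v)" for k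
  have step: "\<omega> k + int (order (inverse a * r powi (2 * k)) P) = \<omega> (k + 1)" for k
  proof -
    have "order (\<zeta> k) Pd = 0" using Pd0 by (simp only: \<zeta>_def)
    hence "order (\<zeta> k) u + order (inverse a * r powi (2 * k)) P + order (\<zeta> (k + 1)) v =
        order (\<zeta> (k + 1)) u + order (\<zeta> k) v"
      using all[of "\<zeta> k"] Pd0[of "2 * k"] P'poly[of k] unfolding sz z1 by linarith
    thus ?thesis unfolding \<omega>_def by linarith
  qed
  have "order (inverse a * r powi (2 * k)) P = 0" if "k \<noteq> 0" for k
    by (rule order_0I) (use Ppoly that in simp)
  hence s1: "\<omega> k = \<omega> (k + 1)" if "k \<noteq> 0" for k using step[of k] that by simp
  have "order (inverse a * r powi (2 * 0)) P > 0"
    using Ppoly[of 0] nz by (simp add: order_gt_0_iff)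
  hence s0: "\<omega> 0 < \<omega> 1" using step[of 0] by simp
  have inj: "inj \<zeta>"
  proof (rule injI)
    fix i j assume "\<zeta> i = \<zeta> j"
    hence "r powi (2 * i - s) = r powi (2 * j - s)" unfolding \<zeta>_def using a0 by simp
    thus "i = j" unfolding r_powi_eq_iff by simp
  qed
  have "finite {k. poly (u * v) (\<zeta> k) = 0}"
  proof -
    have "finite (\<zeta> -` {z. poly (u * v) z = 0})"
      by (rule finite_vimageI[OF poly_roots_finite inj]) (use u0 uv in simp)
    thus ?thesis by (simp add: vimage_def)
  qed
  then obtain K where "{k. poly (u * v) (\<zeta> k) = 0} \<subseteq> {k. \<bar>k\<bar> \<le> K}" unfolding finite_int_iff_bounded_le by auto
  hence K: "\<bar>k\<bar> \<le> K" if "poly (u * v) (\<zeta> k) = 0" for k using that by blast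
  have zero: "\<omega> k = 0" if "\<bar>k\<bar> > K" for k
  proof -
    have "poly u (\<zeta> k) \<noteq> 0" "poly v (\<zeta> k) \<noteq> 0" using K[of k] that by auto
    thus ?thesis by (simp add: \<omega>_def order_0I)
  qed
  have w1: "\<omega> (1 + int n) = \<omega> 1" for n
  proof (induction n)
    case (Suc n)
    thus ?case using s1[of "1 + int n"] by (simp add: algebra_simps)
  qed simp
  have "\<omega> (1 + int (nat (K + 1))) = 0" by (rule zero) linarith
  hence "\<omega> 1 = 0" unfolding w1 .
  moreover have w0: "\<omega> (- int n) = \<omega> 0" for n
  proof (induction n)
    case (Suc n)
    thus ?case using s1[of "- int (Suc n)"] by simp
  qed simp
  have "\<omega> (- int (nat (K + 1))) = 0" by (rule zero) linarith
  hence "\<omega> 0 = 0" unfolding w0 .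
  ultimately show False using s0 by simp
qed

text \<open>Besides relating \<open>a'\<close> to \<open>a\<close>, this fixes the parity of the
  order \<open>s\<close> by the parameters alone, so that any two intertwiners have orders of equal
  parity.\<close>

lemma leading_parity:
  assumes "S \<in> Sh (Lop r a b c d) (Lop r a' b' c' d') \<kappa>" "\<kappa> \<noteq> 0" "leading S s x"
    and "a \<noteq> 0" "\<And>j. a ^ 2 \<noteq> r powi j" "\<And>y j. y \<in> {b, c, d, b', c', d'} \<Longrightarrow> y \<noteq> a * r powi j"
  shows "\<exists>k. a' = a * r powi (s - 2 * k)"
proof (rule zero_orbit)
  show "x \<noteq> 0" using assms(3) by (simp add: leading_def)
  show "x * Tn s (Ac a b c d) = cz \<kappa> * (Ac a' b' c' d' * Tn 2 x)"
    by (rule leading_equation[OF assms(1-3)])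
qed (use assms in auto)

text \<open>\<open>T\<close> guarantees that a minimal order exists; it need not be the generator
  itself.\<close>

lemma Sh_cyclic:
  fixes a b c d a' b' c' d' \<kappa> :: 'f
  assumes a0: "a \<noteq> 0" and a2: "\<And>j. a ^ 2 \<noteq> r powi j"
    and y: "\<And>y j. y \<in> {b, c, d, b', c', d'} \<Longrightarrow> y \<noteq> a * r powi j" and \<kappa>: "\<kappa> \<noteq> 0"
  defines "L \<equiv> Lop r a b c d" and "L' \<equiv> Lop r a' b' c' d'"
  assumes T: "T \<in> Sh L L' \<kappa>" "T \<noteq> (\<lambda>_. 0)"
  shows "\<exists>S0\<in>Sh L L' \<kappa>. S0 \<noteq> (\<lambda>_. 0) \<and> (\<forall>S\<in>Sh L L' \<kappa>. \<exists>X\<in>Sh L L 1. S = (\<lambda>f. S0 (X f)))"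
proof -
  have klin: "klin L" "klin L'" by (simp_all add: L_def L'_def klin_Lop)
  define tops where "tops n \<longleftrightarrow> (\<exists>S\<in>Sh L L' \<kappa>. \<exists>x. leading S (int n) x)" for n
  have nonneg: "s \<ge> 0" if "S \<in> Sh L L' \<kappa>" "leading S s x" for S s x
    using leading_nonneg[OF that(2) ShD(3)[OF that(1)]] .
  obtain s x where "leading T s x" using DO_leading[OF ShD(1)[OF T(1)] T(2)] by blast
  hence "tops (nat s)" using nonneg[OF T(1)] T(1) unfolding tops_def by auto
  define n0 where "n0 = (LEAST n. tops n)"
  have "tops n0" unfolding n0_def by (rule LeastI) fact
  then obtain S0 x0 where S0: "S0 \<in> Sh L L' \<kappa>" "leading S0 (int n0) x0" by (auto simp: tops_def)
  have least: "int n0 \<le> s" if "S \<in> Sh L L' \<kappa>" "leading S s x" for S s x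
  proof -
    have "tops (nat s)" using that nonneg[OF that] by (auto simp: tops_def)
    hence "n0 \<le> nat s" unfolding n0_def by (rule Least_le)
    thus ?thesis using nonneg[OF that] by simp
  qed
  have S0nz: "S0 \<noteq> (\<lambda>_. 0)" using S0(2) leading_zero by metis
  obtain k0 where k0: "a' = a * r powi (int n0 - 2 * k0)"
    using leading_parity[OF S0(1)[unfolded L_def L'_def] \<kappa> S0(2) a0 a2 y] by blast
  have main: "\<exists>X\<in>Sh L L 1. S = (\<lambda>f. S0 (X f))" if "S \<in> Sh L L' \<kappa>" "leading S (int n) x" for S n x
    using that
  proof (induction n arbitrary: S x rule: less_induct)
    case (less n)
    obtain k1 where k1: "a' = a * r powi (int n - 2 * k1)"
      using leading_parity[OF less.prems(1)[unfolded L_def L'_def] \<kappa> less.prems(2) a0 a2 y] by blast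
    have "a * r powi (int n - 2 * k1) = a * r powi (int n0 - 2 * k0)" by (rule trans[OF k1[symmetric] k0])
    \<comment> \<open>Both exponents describe the quotient \<open>a' / a\<close>; hence
      \<open>n\<close> and \<open>n0\<close> have equal parity and a power of \<open>L\<close> makes
      up the difference.\<close>
    hence "int n - 2 * k1 = int n0 - 2 * k0" using a0 unfolding mult_cancel_left r_powi_eq_iff by blast
    moreover define k where "k = nat (k1 - k0)"
    moreover have "int n0 \<le> int n" by (rule least[OF less.prems])
    ultimately have n: "int n = int n0 + 2 * int k" by linarith
    obtain w where w: "leading (L ^^ k) (2 * int k) w" "L ^^ k \<in> Sh L L 1"
      using Lop_pow[of k a b c d, folded L_def] by blast
    define S1 where "S1 = (\<lambda>f. S0 ((L ^^ k) f))"
    have S1: "S1 \<in> Sh L L' \<kappa>" using Sh_comp[OF w(2) S0(1)] by (simp add: S1_def)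
    obtain x1 where t1: "leading S1 (int n) x1" using leading_comp[OF S0(2) w(1)] unfolding S1_def n by blast
    obtain y where yx: "y \<noteq> 0" "x = cz y * x1"
      using leading_ratio[OF less.prems[unfolded L_def L'_def] S1[unfolded L_def L'_def] t1 \<kappa>] by blast
    \<comment> \<open>Scaled so that the leading terms coincide and the difference \<open>S2\<close>
      has smaller order.\<close>
    have t2: "leading (\<lambda>f. cz y * S1 f) (int n) x" unfolding yx(2) by (rule leading_scale[OF t1]) (use yx in simp)
    define S2 where "S2 = (\<lambda>f. S f - cz y * S1 f)"
    have S2: "S2 \<in> Sh L L' \<kappa>"
    proof -
      have "(\<lambda>f. S f + cz (- y) * S1 f) \<in> Sh L L' \<kappa>"
        by (rule Sh_add[OF klin(2) less.prems(1) Sh_scale[OF klin(2) S1]])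
      thus ?thesis by (simp add: S2_def cz.uminus)
    qed
    have "\<exists>X\<in>Sh L L 1. S2 = (\<lambda>f. S0 (X f))"
    proof (cases "S2 = (\<lambda>_. 0)")
      case True
      show ?thesis
        by (rule bexI[OF _ Sh_zero[OF klin(1)]]) (simp only: True klin_0[OF ShD(2)[OF S0(1)]])
    next
      case False
      then obtain s' x' where s': "s' < int n" "leading S2 s' x'"
        using leading_diff[OF less.prems(2) t2, folded S2_def] by blast
      have "leading S2 (int (nat s')) x'" "nat s' < n" using s' nonneg[OF S2 s'(2)] by auto
      thus ?thesis using less.IH S2 by blast
    qed
    then obtain X where X: "X \<in> Sh L L 1" "S2 = (\<lambda>f. S0 (X f))" by blast
    define X' where "X' = (\<lambda>f. X f + cz y * (L ^^ k) f)"
    have "X' \<in> Sh L L 1" unfolding X'_def by (intro Sh_add Sh_scale klin X w)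
    moreover have "S = (\<lambda>f. S0 (X' f))"
    proof
      fix f
      have "S f = S2 f + cz y * S1 f" by (simp add: S2_def)
      also have "\<dots> = S0 (X' f)"
        by (simp add: X(2) S1_def X'_def klin_add[OF ShD(2)[OF S0(1)]] klin_scale[OF ShD(2)[OF S0(1)]])
      finally show "S f = S0 (X' f)" .
    qed
    ultimately show ?case by blast
  qed
  have "\<exists>X\<in>Sh L L 1. S = (\<lambda>f. S0 (X f))" if S: "S \<in> Sh L L' \<kappa>" for S
  proof (cases "S = (\<lambda>_. 0)")
    case True
    show ?thesis
      by (rule bexI[OF _ Sh_zero[OF klin(1)]]) (simp only: True klin_0[OF ShD(2)[OF S0(1)]])
  next
    case False
    then obtain s x where t: "leading S s x" using DO_leading[OF ShD(1)[OF S]] by blast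
    hence "leading S (int (nat s)) x" using nonneg[OF S t] by simp
    thus ?thesis using main[OF S] by blast
  qed
  thus ?thesis using S0(1) S0nz by blast
qed

text \<open>The leading term of a composition is a product of nonzero rational functions, so
  difference operators have no zero divisors.\<close>

lemma Sh_comp_cancel:
  assumes S: "S \<in> DO" "S \<noteq> (\<lambda>_. 0)" and X: "X \<in> DO" "Y \<in> DO" and eq: "(\<lambda>f. S (X f)) = (\<lambda>f. S (Y f))"
  shows "X = Y"
proof (rule ccontr)
  assume "X \<noteq> Y"
  define Z where "Z = (\<lambda>f. X f + (- 1) * Y f)"
  have Z: "Z \<in> DO" unfolding Z_def by (intro DO_add DO_scale X)
  have "Z \<noteq> (\<lambda>_. 0)"
  proof
    assume "Z = (\<lambda>_. 0)"
    hence "X f + (- 1) * Y f = 0" for f unfolding Z_def by (rule fun_cong)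
    hence "X f = Y f" for f by simp
    thus False using \<open>X \<noteq> Y\<close> by blast
  qed
  then obtain s x s' x' where t: "leading S s x" "leading Z s' x'" using DO_leading S Z by metis
  have "S (Z f) = 0" for f
  proof -
    have "Z f = X f - Y f" by (simp add: Z_def)
    thus ?thesis using fun_cong[OF eq, of f] by (simp add: klin_diff[OF klin_DO[OF S(1)]])
  qed
  hence "(\<lambda>f. S (Z f)) = (\<lambda>_. 0)" by blast
  thus False using leading_comp[OF t] leading_zero by metis
qed

lemma Sym_span_awp:
  assumes "a \<noteq> 0" "f \<in> Sym"
  shows "\<exists>n x. f = (\<Sum>j<n. cz (x j) * lz (awp r a b c d j))"
proof -
  obtain g where g: "f = lz g" "g \<in> symL" using assms by (auto simp: Sym_eq)
  obtain n where n: "\<forall>m\<ge>int n. Poly_Mapping.lookup g m = 0" by (rule symL_bound[OF g(2)])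
  obtain x where "g = (\<Sum>i<n. Poly_Mapping.single 0 (x i) * awp r a b c d i)"
    using symL_span[OF awp_props(1)[OF assms(1), of b c d] g(2) n] by blast
  hence "f = (\<Sum>j<n. cz (x j) * lz (awp r a b c d j))" by (simp add: g(1) lz.sum lz.mult)
  thus ?thesis by blast
qed

lemma klin_eq_on_awp:
  assumes "a \<noteq> 0" "klin F" "klin G" "\<And>j. F (lz (awp r a b c d j)) = G (lz (awp r a b c d j))" "f \<in> Sym"
  shows "F f = G f"
proof -
  obtain n x where "f = (\<Sum>j<n. cz (x j) * lz (awp r a b c d j))" using Sym_span_awp[OF assms(1,5)] by blast
  thus ?thesis using assms by (simp add: klin_sum klin_scale)
qed

lemma awp_Sym: "a \<noteq> 0 \<Longrightarrow> lz (awp r a b c d n) \<in> Sym"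
  using awp_props(1)[of a b c d n] by (simp add: lz_in_Sym_iff ldeg_def)

text \<open>Eigenspaces of \<open>L\<close> are lines, so both operators are diagonal on the
  polynomials \<open>awp\<close>.\<close>

lemma Sh_commute:
  fixes a b c d :: 'f
  assumes a: "a \<noteq> 0" and g: "gen (a * b * c * d)"
  defines "L \<equiv> Lop r a b c d"
  assumes X: "X \<in> Sh L L 1" and Y: "Y \<in> Sh L L 1"
  shows "X (Y f) = Y (X f)"
proof -
  have eig: "\<exists>x. Z (lz (awp r a b c d n)) = cz x * lz (awp r a b c d n)" if Z: "Z \<in> Sh L L 1" for Z n
  proof -
    let ?p = "lz (awp r a b c d n)"
    have pS: "?p \<in> Sym" by (rule awp_Sym[OF a])
    have "L (Z ?p) = Z (L ?p)" by (rule ShD(4)[OF Z pS, unfolded cz.one mult_1, symmetric])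
    also have "L ?p = cz (lam r (a * b * c * d) (int n)) * ?p" unfolding L_def by (rule Lop_awp[OF a g])
    also have "Z \<dots> = cz (lam r (a * b * c * d) (int n)) * Z ?p" by (rule klin_scale[OF ShD(2)[OF Z]])
    finally have "\<exists>x. Z ?p = cz x * lz (awp r a b c d (nat (int n)))"
      unfolding L_def by (rule Lop_eigen_unique(2)[OF a g ShD(3)[OF Z pS] _ of_nat_0_le_iff])
    thus ?thesis unfolding nat_int .
  qed
  have comm: "X (Y f) = Y (X f)" if f: "f \<in> Sym" for f
  proof (rule klin_eq_on_awp[OF a klin_comp[OF ShD(2)[OF X] ShD(2)[OF Y]] klin_comp[OF ShD(2)[OF Y] ShD(2)[OF X]] _ f])
    fix j
    obtain x y where xy: "X (lz (awp r a b c d j)) = cz x * lz (awp r a b c d j)"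
      "Y (lz (awp r a b c d j)) = cz y * lz (awp r a b c d j)" using eig[OF X, of j] eig[OF Y, of j] by blast
    show "X (Y (lz (awp r a b c d j))) = Y (X (lz (awp r a b c d j)))"
      unfolding xy klin_scale[OF ShD(2)[OF X]] klin_scale[OF ShD(2)[OF Y]] by (simp only: mult.left_commute)
  qed
  have "(\<lambda>f. X (Y f)) = (\<lambda>f. Y (X f))"
    by (rule DO_ext[OF DO_comp[OF ShD(1)[OF X] ShD(1)[OF Y]] DO_comp[OF ShD(1)[OF Y] ShD(1)[OF X]] comm])
  thus ?thesis by (rule fun_cong)
qed

end


section \<open>The module of shift operators\<close>

text \<open>The ring of the statement for an arbitrary set of operators, and likewise
  \<open>op_module\<close>, so that the module axioms follow from closure properties alone.\<close>

definition op_ring :: "('a \<Rightarrow> 'a::ab_group_add) set \<Rightarrow> ('a \<Rightarrow> 'a) ring" where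
  "op_ring A = \<lparr>carrier = A, monoid.mult = (\<circ>), one = id, zero = (\<lambda>_. 0), add = (\<lambda>S S' f. S f + S' f)\<rparr>"

definition op_module :: "('a \<Rightarrow> 'a::ab_group_add) set \<Rightarrow> ('a \<Rightarrow> 'a, 'a \<Rightarrow> 'a) module" where
  "op_module B = \<lparr>carrier = B, monoid.mult = undefined, one = undefined,
      zero = (\<lambda>_. 0), add = (\<lambda>S S' f. S f + S' f), smult = (\<lambda>X S. S \<circ> X)\<rparr>"

lemma op_module_module:
  fixes A B :: "('a \<Rightarrow> 'a::ab_group_add) set"
  assumes A0: "(\<lambda>_. 0) \<in> A" and A1: "id \<in> A"
    and Aadd: "\<And>X Y. X \<in> A \<Longrightarrow> Y \<in> A \<Longrightarrow> (\<lambda>f. X f + Y f) \<in> A"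
    and Aneg: "\<And>X. X \<in> A \<Longrightarrow> (\<lambda>f. - X f) \<in> A"
    and Acomp: "\<And>X Y. X \<in> A \<Longrightarrow> Y \<in> A \<Longrightarrow> X \<circ> Y \<in> A"
    and Acomm: "\<And>X Y. X \<in> A \<Longrightarrow> Y \<in> A \<Longrightarrow> X \<circ> Y = Y \<circ> X"
    and B0: "(\<lambda>_. 0) \<in> B"
    and Badd: "\<And>S T. S \<in> B \<Longrightarrow> T \<in> B \<Longrightarrow> (\<lambda>f. S f + T f) \<in> B"
    and Bneg: "\<And>S. S \<in> B \<Longrightarrow> (\<lambda>f. - S f) \<in> B"
    and Blin: "\<And>S f g. S \<in> B \<Longrightarrow> S (f + g) = S f + S g"
    and Bcomp: "\<And>S X. S \<in> B \<Longrightarrow> X \<in> A \<Longrightarrow> S \<circ> X \<in> B"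
  shows "Module.module (op_ring A) (op_module B)"
proof (rule moduleI)
  have "abelian_group (op_ring A)"
  proof (rule abelian_groupI)
    fix X assume "X \<in> carrier (op_ring A)"
    thus "\<exists>Y\<in>carrier (op_ring A). Y \<oplus>\<^bsub>op_ring A\<^esub> X = \<zero>\<^bsub>op_ring A\<^esub>"
      using Aneg by (intro bexI[of _ "\<lambda>f. - X f"]) (simp_all add: op_ring_def)
  qed (simp_all add: op_ring_def A0 Aadd add.assoc, simp add: add.commute)
  moreover have "comm_monoid (op_ring A)"
    by (rule comm_monoidI) (simp_all add: op_ring_def A1 Acomp comp_assoc Acomm)
  ultimately show "cring (op_ring A)"
    by (rule cringI) (simp add: op_ring_def comp_def)
  show "abelian_group (op_module B)"
  proof (rule abelian_groupI)
    fix X assume "X \<in> carrier (op_module B)"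
    thus "\<exists>Y\<in>carrier (op_module B). Y \<oplus>\<^bsub>op_module B\<^esub> X = \<zero>\<^bsub>op_module B\<^esub>"
      using Bneg by (intro bexI[of _ "\<lambda>f. - X f"]) (simp_all add: op_module_def)
  qed (simp_all add: op_module_def B0 Badd add.assoc, simp add: add.commute)
next
  fix X Y S assume XY: "X \<in> carrier (op_ring A)" "Y \<in> carrier (op_ring A)" and S: "S \<in> carrier (op_module B)"
  have "X \<circ> Y = Y \<circ> X" by (rule Acomm) (use XY in \<open>simp_all add: op_ring_def\<close>)
  hence "S \<circ> (X \<circ> Y) = (S \<circ> Y) \<circ> X" by (simp add: comp_assoc)
  thus "(X \<otimes>\<^bsub>op_ring A\<^esub> Y) \<odot>\<^bsub>op_module B\<^esub> S = X \<odot>\<^bsub>op_module B\<^esub> (Y \<odot>\<^bsub>op_module B\<^esub> S)"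
    by (simp add: op_ring_def op_module_def)
qed (simp_all add: op_ring_def op_module_def Bcomp Blin fun_eq_iff)

lemma op_module_free_0:
  assumes "Module.module (op_ring A) (op_module {\<lambda>_. 0})"
  shows "free_module_of_rank (op_ring A) (op_module {\<lambda>_. 0}) 0"
proof -
  let ?M = "op_module {\<lambda>_. 0}"
  interpret M: Module.module "op_ring A" ?M by fact
  have z: "carrier ?M = {\<zero>\<^bsub>?M\<^esub>}" by (simp add: op_module_def)
  have "\<exists>!c. c \<in> {} \<rightarrow>\<^sub>E carrier (op_ring A) \<and> x = (\<Oplus>\<^bsub>?M\<^esub>b\<in>{}. c b \<odot>\<^bsub>?M\<^esub> b)" if "x \<in> carrier ?M" for x
  proof -
    have "x = (\<Oplus>\<^bsub>?M\<^esub>b\<in>{}. c b \<odot>\<^bsub>?M\<^esub> b)" for c using that unfolding z by simp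
    thus ?thesis by auto
  qed
  thus ?thesis unfolding free_module_of_rank_def
    by (intro conjI assms exI[of _ "{}"] ballI) simp_all
qed

lemma op_module_free_1:
  assumes m: "Module.module (op_ring A) (op_module B)"
    and S0: "S0 \<in> B" "\<And>S. S \<in> B \<Longrightarrow> \<exists>X\<in>A. S = S0 \<circ> X"
    and inj: "\<And>X Y. X \<in> A \<Longrightarrow> Y \<in> A \<Longrightarrow> S0 \<circ> X = S0 \<circ> Y \<Longrightarrow> X = Y"
  shows "free_module_of_rank (op_ring A) (op_module B) 1"
proof -
  let ?R = "op_ring A" and ?M = "op_module B"
  interpret M: Module.module ?R ?M by fact
  have car: "carrier ?R = A" "carrier ?M = B" by (simp_all add: op_ring_def op_module_def)
  have s: "(\<Oplus>\<^bsub>?M\<^esub>b\<in>{S0}. c b \<odot>\<^bsub>?M\<^esub> b) = S0 \<circ> c S0" if "c S0 \<in> A" for c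
  proof -
    have "c S0 \<odot>\<^bsub>?M\<^esub> S0 \<in> carrier ?M" using M.smult_closed[of "c S0" S0] that S0(1) by (simp add: car)
    hence "(\<Oplus>\<^bsub>?M\<^esub>b\<in>{S0}. c b \<odot>\<^bsub>?M\<^esub> b) = c S0 \<odot>\<^bsub>?M\<^esub> S0" by (simp add: M.finsum_insert)
    thus ?thesis by (simp add: op_module_def)
  qed
  have "\<exists>!c. c \<in> {S0} \<rightarrow>\<^sub>E carrier ?R \<and> S = (\<Oplus>\<^bsub>?M\<^esub>b\<in>{S0}. c b \<odot>\<^bsub>?M\<^esub> b)" if S: "S \<in> B" for S
  proof -
    obtain X where X: "X \<in> A" "S = S0 \<circ> X" using S0(2)[OF S] by blast
    show ?thesis
    proof (rule ex1I[of _ "\<lambda>b\<in>{S0}. X"])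
      show "(\<lambda>b\<in>{S0}. X) \<in> {S0} \<rightarrow>\<^sub>E carrier ?R \<and> S = (\<Oplus>\<^bsub>?M\<^esub>b\<in>{S0}. (\<lambda>b\<in>{S0}. X) b \<odot>\<^bsub>?M\<^esub> b)"
        using s[of "\<lambda>b\<in>{S0}. X"] X by (simp add: car)
      fix c assume c: "c \<in> {S0} \<rightarrow>\<^sub>E carrier ?R \<and> S = (\<Oplus>\<^bsub>?M\<^esub>b\<in>{S0}. c b \<odot>\<^bsub>?M\<^esub> b)"
      hence cA: "c S0 \<in> A" by (auto simp: car)
      hence "S0 \<circ> c S0 = S0 \<circ> X" using c s[of c, OF cA] X by simp
      hence "c S0 = X" by (rule inj[OF cA X(1)])
      show "c = (\<lambda>b\<in>{S0}. X)"
      proof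
        fix b show "c b = (\<lambda>b\<in>{S0}. X) b"
          by (cases "b = S0") (use c \<open>c S0 = X\<close> in \<open>auto simp: PiE_def extensional_def\<close>)
      qed
    qed
  qed
  thus ?thesis unfolding free_module_of_rank_def
    by (intro conjI m exI[of _ "{S0}"] ballI) (simp_all add: S0 car)
qed

section \<open>Intertwiners for shifts in the lattice\<close>

context q_shift
begin

lemma Dop_neq_0: "M \<noteq> 0 \<Longrightarrow> Dop r M \<noteq> (\<lambda>_. 0)"
  using leading_Dop leading_zero by metis

lemma Dop_DO: "M \<noteq> 0 \<Longrightarrow> Dop r M \<in> DO"
  using leading_Dop leading_DO by blast

lemma Sh_Splus:
  assumes "a \<noteq> 0"
  shows "\<exists>S\<in>Sh (Lop r a b c d) (Lop r (a * r) (b * r) (c * r) (d * r)) (r powi - 2). S \<noteq> (\<lambda>_. 0)"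
proof (rule bexI)
  show "Splus r \<noteq> (\<lambda>_. 0)" unfolding Splus_def by (rule Dop_neq_0) simp
  show "Splus r \<in> Sh (Lop r a b c d) (Lop r (a * r) (b * r) (c * r) (d * r)) (r powi - 2)"
  proof (rule ShI)
    show "Splus r \<in> DO" unfolding Splus_def by (rule Dop_DO) simp
    fix f :: "'f poly fract" assume f: "f \<in> Sym"
    show "Splus r f \<in> Sym" by (rule Splus_Sym[OF f])
    have "cz (r powi - 2) * cz (r ^ 2) = 1" by (simp add: power_int_minus flip: cz.mult)
    thus "Splus r (Lop r a b c d f) = cz (r powi - 2) * Lop r (a * r) (b * r) (c * r) (d * r) (Splus r f)"
      unfolding Lop_Splus[OF assms f] mult.assoc[symmetric] by (simp only: mult_1)
  qed
qed

lemma Sh_Sminus: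
  assumes "a \<noteq> 0"
  shows "\<exists>S\<in>Sh (Lop r (a * r) (b * r) (c * r) (d * r)) (Lop r a b c d) (r powi 2). S \<noteq> (\<lambda>_. 0)"
proof (rule bexI)
  show "Sminus r a b c d \<noteq> (\<lambda>_. 0)" unfolding Sminus_def
    by (rule Dop_neq_0) (simp add: linear_factor_nonzero)
  show "Sminus r a b c d \<in> Sh (Lop r (a * r) (b * r) (c * r) (d * r)) (Lop r a b c d) (r powi 2)"
  proof (rule ShI)
    show "Sminus r a b c d \<in> DO" unfolding Sminus_def by (rule Dop_DO) (simp add: linear_factor_nonzero)
    fix f :: "'f poly fract" assume f: "f \<in> Sym"
    show "Sminus r a b c d f \<in> Sym" by (rule Sminus_Sym[OF f])
    have "cz (r powi 2) * cz (inverse (r ^ 2)) = 1" by (simp flip: cz.mult)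
    thus "Sminus r a b c d (Lop r (a * r) (b * r) (c * r) (d * r) f) = cz (r powi 2) * Lop r a b c d (Sminus r a b c d f)"
      unfolding Lop_Sminus[OF assms f] mult.assoc[symmetric] by (simp only: mult_1)
  qed
qed

lemma Sh_Eop:
  assumes "a \<noteq> 0"
  shows "\<exists>S\<in>Sh (Lop r (a * r) (b * r) c d) (Lop r a b (c * r) (d * r)) (r powi 0). S \<noteq> (\<lambda>_. 0)"
proof (rule bexI)
  show "Eop r a b \<noteq> (\<lambda>_. 0)" unfolding Eop_def
    by (rule Dop_neq_0) (simp add: linear_factor_nonzero)
  show "Eop r a b \<in> Sh (Lop r (a * r) (b * r) c d) (Lop r a b (c * r) (d * r)) (r powi 0)"
  proof (rule ShI)
    show "Eop r a b \<in> DO" unfolding Eop_def by (rule Dop_DO) (simp add: linear_factor_nonzero)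
    fix f :: "'f poly fract" assume f: "f \<in> Sym"
    show "Eop r a b f \<in> Sym" by (rule Eop_Sym[OF f])
    show "Eop r a b (Lop r (a * r) (b * r) c d f) = cz (r powi 0) * Lop r a b (c * r) (d * r) (Eop r a b f)"
      unfolding Lop_Eop[OF assms f] by (simp only: power_int_0_right cz.one mult_1)
  qed
qed

text \<open>The parameters enter only through the coefficient of \<open>Sminus\<close> and their
  product, both symmetric. Relations derived from a basis that singles out \<open>a\<close> thereby
  become available for every pair of parameters.\<close>

lemma Lop_swap: "Lop r a b c d = Lop r b a c d" "Lop r a b c d = Lop r a c b d" "Lop r a b c d = Lop r a b d c"
proof -
  have e: "Lop r a b c d = Lop r a' b' c' d'"
    if "Sminus r a b c d = Sminus r a' b' c' d'" "a * b * c * d = a' * b' * c' * d'" for a b c d a' b' c' d'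
    by (rule ext) (simp only: Lop_def that)
  show "Lop r a b c d = Lop r b a c d" "Lop r a b c d = Lop r a c b d" "Lop r a b c d = Lop r a b d c"
    by (rule e; simp only: Sminus_def mult_ac)+
qed

context
  fixes a b c d :: 'f
  assumes nz: "a \<noteq> 0" "b \<noteq> 0" "c \<noteq> 0" "d \<noteq> 0"
begin

definition Lsh :: "int \<Rightarrow> int \<Rightarrow> int \<Rightarrow> int \<Rightarrow> 'f poly fract \<Rightarrow> 'f poly fract" where
  "Lsh i j k l = Lop r (a * r powi i) (b * r powi j) (c * r powi k) (d * r powi l)"

text \<open>Parameters are recorded by their exponents of \<open>r\<close>, that is by twice their
  exponents of \<open>q\<close>, and \<open>\<kappa>\<close> by its exponent \<open>t\<close>, so
  that composition becomes integer addition.\<close>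

definition joined :: "int \<Rightarrow> int \<Rightarrow> int \<Rightarrow> int \<Rightarrow> int \<Rightarrow> int \<Rightarrow> int \<Rightarrow> int \<Rightarrow> int \<Rightarrow> bool" where
  "joined t i j k l i' j' k' l' \<longleftrightarrow> (\<exists>S\<in>Sh (Lsh i j k l) (Lsh i' j' k' l') (r powi t). S \<noteq> (\<lambda>_. 0))"

lemma joined_refl: "joined 0 i j k l i j k l"
proof -
  have "(\<lambda>f. f) \<noteq> (\<lambda>_. 0 :: 'f poly fract)" by (metis one_neq_zero)
  thus ?thesis unfolding joined_def power_int_0_right using Sh_id by blast
qed

lemma joined_trans:
  assumes "joined t i j k l i' j' k' l'" "joined t' i' j' k' l' i'' j'' k'' l''"
  shows "joined (t + t') i j k l i'' j'' k'' l''"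
proof -
  obtain S S' where S: "S \<in> Sh (Lsh i j k l) (Lsh i' j' k' l') (r powi t)" "S \<noteq> (\<lambda>_. 0)"
    and S': "S' \<in> Sh (Lsh i' j' k' l') (Lsh i'' j'' k'' l'') (r powi t')" "S' \<noteq> (\<lambda>_. 0)"
    using assms unfolding joined_def by blast
  have "(\<lambda>f. S' (S f)) \<in> Sh (Lsh i j k l) (Lsh i'' j'' k'' l'') (r powi (t + t'))"
    unfolding power_int_add[OF disjI1[OF r_nz]] by (rule Sh_comp[OF S(1) S'(1)])
  moreover have "(\<lambda>f. S' (S f)) \<noteq> (\<lambda>_. 0)"
  proof -
    obtain s x s' x' where "leading S s x" "leading S' s' x'" using DO_leading S S' ShD(1) by meson
    hence "leading (\<lambda>f. S' (S f)) (s' + s) (x' * Tn s' x)" by (intro leading_comp)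
    thus ?thesis using leading_zero by metis
  qed
  ultimately show ?thesis unfolding joined_def by blast
qed

lemma joined_iterate:
  assumes up: "\<And>i j k l. joined t i j k l (i + v1) (j + v2) (k + v3) (l + v4)"
    and dn: "\<And>i j k l. joined (- t) i j k l (i - v1) (j - v2) (k - v3) (l - v4)"
  shows "joined (n * t) i j k l (i + n * v1) (j + n * v2) (k + n * v3) (l + n * v4)"
proof (induction n rule: int_induct[of _ 0])
  case base
  show ?case using joined_refl by simp
next
  case (step1 n)
  from joined_trans[OF step1.IH up] show ?case by (simp add: algebra_simps)
next
  case (step2 n)
  from joined_trans[OF step2.IH dn] show ?case by (simp add: algebra_simps)
qed

lemma powi_step: "x * r powi i = x * r powi (i - 1) * r" "x * r powi (i + 1) = x * r powi i * r"
  using power_int_add_1[OF disjI1[OF r_nz], of "i - 1"] power_int_add_1[OF disjI1[OF r_nz], of i]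
  by (simp_all add: mult.assoc)

text \<open>The shifts by \<open>v_i\<close> and \<open>- v_i\<close>. Those for
  \<open>i = 2, 3, 4\<close> use \<open>Eop\<close> for each of the six pairs of parameters,
  complementary pairs giving opposite directions.\<close>

lemma joined_moves:
  "joined (- 2) i j k l (i + 1) (j + 1) (k + 1) (l + 1)"
  "joined 2 i j k l (i - 1) (j - 1) (k - 1) (l - 1)"
  "joined 0 i j k l (i - 1) (j - 1) (k + 1) (l + 1)"
  "joined 0 i j k l (i + 1) (j + 1) (k - 1) (l - 1)"
  "joined 0 i j k l (i - 1) (j + 1) (k - 1) (l + 1)"
  "joined 0 i j k l (i + 1) (j - 1) (k + 1) (l - 1)"
  "joined 0 i j k l (i - 1) (j + 1) (k + 1) (l - 1)"
  "joined 0 i j k l (i + 1) (j - 1) (k - 1) (l + 1)"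
proof -
  have nz': "x * r powi m \<noteq> 0" if "x \<in> {a, b, c, d}" for x m using nz that by auto
  define p where "p x m = x * r powi m" for x m
  have pn: "p x m \<noteq> 0" if "x \<in> {a, b, c, d}" for x m using nz'[OF that] by (simp add: p_def)
  have st: "p x m * r = p x (m + 1)" for x m by (simp only: p_def powi_step(2))
  have st': "p x (m - 1) * r = p x m" for x m using st[of x "m - 1"] by simp
  note D = joined_def Lsh_def p_def[symmetric]
  have abcd: "a \<in> {a, b, c, d}" "b \<in> {a, b, c, d}" "c \<in> {a, b, c, d}" "d \<in> {a, b, c, d}" by auto
  show "joined (- 2) i j k l (i + 1) (j + 1) (k + 1) (l + 1)" unfolding D
    by (rule Sh_Splus[OF pn[OF abcd(1)], of i "p b j" "p c k" "p d l", unfolded st])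
  show "joined 2 i j k l (i - 1) (j - 1) (k - 1) (l - 1)" unfolding D
    by (rule Sh_Sminus[OF pn[OF abcd(1)], of "i - 1" "p b (j - 1)" "p c (k - 1)" "p d (l - 1)", unfolded st'])
  have E: "\<exists>S\<in>Sh (Lop r (p x m1) (p y m2) (p z m3) (p w m4)) (Lop r (p x (m1 - 1)) (p y (m2 - 1)) (p z (m3 + 1)) (p w (m4 + 1))) (r powi 0). S \<noteq> (\<lambda>_. 0)"
    if "x \<in> {a, b, c, d}" for x y z w m1 m2 m3 m4
    using Sh_Eop[OF pn[OF that], of "m1 - 1" "p y (m2 - 1)" "p z m3" "p w m4"] unfolding st diff_add_cancel .
  have perm: "Lop r (p c k) (p d l) (p a i) (p b j) = Lop r (p a i) (p b j) (p c k) (p d l)"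
    "Lop r (p a i) (p c k) (p b j) (p d l) = Lop r (p a i) (p b j) (p c k) (p d l)"
    "Lop r (p b j) (p d l) (p a i) (p c k) = Lop r (p a i) (p b j) (p c k) (p d l)"
    "Lop r (p a i) (p d l) (p b j) (p c k) = Lop r (p a i) (p b j) (p c k) (p d l)"
    "Lop r (p b j) (p c k) (p a i) (p d l) = Lop r (p a i) (p b j) (p c k) (p d l)" for i j k l
    by (metis Lop_swap)+
  show "joined 0 i j k l (i - 1) (j - 1) (k + 1) (l + 1)" unfolding D by (rule E[OF abcd(1)])
  show "joined 0 i j k l (i + 1) (j + 1) (k - 1) (l - 1)" unfolding D using E[OF abcd(3), of k d l a i b j] unfolding perm(1) .
  show "joined 0 i j k l (i - 1) (j + 1) (k - 1) (l + 1)" unfolding D using E[OF abcd(1), of i c k b j d l] unfolding perm(2) .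
  show "joined 0 i j k l (i + 1) (j - 1) (k + 1) (l - 1)" unfolding D using E[OF abcd(2), of j d l a i c k] unfolding perm(3) .
  show "joined 0 i j k l (i - 1) (j + 1) (k + 1) (l - 1)" unfolding D using E[OF abcd(1), of i d l b j c k] unfolding perm(4) .
  show "joined 0 i j k l (i + 1) (j - 1) (k - 1) (l + 1)" unfolding D using E[OF abcd(2), of j c k a i d l] unfolding perm(5) .
qed

text \<open>As the \<open>v_i\<close> are orthonormal, a lattice shift is the sum of the
  \<open>n_i v_i\<close> with \<open>n_i = h . v_i\<close>; the exponents of \<open>r\<close> are
  the coordinates of twice this vector. Only \<open>v_1\<close> affects the scalar.\<close>

lemma joined_lattice:
  "joined (- (2 * n1)) i j k l (i + n1 + n2 + n3 + n4) (j + n1 + n2 - n3 - n4) (k + n1 - n2 + n3 - n4) (l + n1 - n2 - n3 + n4)"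
proof -
  have 1: "joined (n * (- 2)) i j k l (i + n * 1) (j + n * 1) (k + n * 1) (l + n * 1)" for n i j k l
    by (rule joined_iterate) (use joined_moves(1,2) in simp_all)
  have 2: "joined (n * 0) i j k l (i + n * 1) (j + n * 1) (k + n * (- 1)) (l + n * (- 1))" for n i j k l
    by (rule joined_iterate) (use joined_moves(3,4) in simp_all)
  have 3: "joined (n * 0) i j k l (i + n * 1) (j + n * (- 1)) (k + n * 1) (l + n * (- 1))" for n i j k l
    by (rule joined_iterate) (use joined_moves(5,6) in simp_all)
  have 4: "joined (n * 0) i j k l (i + n * 1) (j + n * (- 1)) (k + n * (- 1)) (l + n * 1)" for n i j k l
    by (rule joined_iterate) (use joined_moves(7,8) in simp_all)
  from joined_trans[OF joined_trans[OF joined_trans[OF 1[of n1] 2[of n2]] 3[of n3]] 4[of n4]]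
  show ?thesis by (simp add: algebra_simps)
qed

lemma Sh_lattice:
  "\<exists>S\<in>Sh (Lop r a b c d) (Lop r (a * r powi (n1 + n2 + n3 + n4)) (b * r powi (n1 + n2 - n3 - n4))
      (c * r powi (n1 - n2 + n3 - n4)) (d * r powi (n1 - n2 - n3 + n4))) (r powi (- (2 * n1))). S \<noteq> (\<lambda>_. 0)"
  using joined_lattice[of n1 0 0 0 0 n2 n3 n4] unfolding joined_def Lsh_def add_0 power_int_0_right mult_1_right .

end

text \<open>As the product of the parameters is multiplied by \<open>r^(4 m)\<close>, the shifted
  eigenvalue at \<open>n - m\<close> is \<open>r^(2 m)\<close> times the original one at
  \<open>n\<close>. Eigenspaces being lines, intertwining amounts to sending the \<open>n\<close>-th
  polynomial to a multiple of the shifted one of degree \<open>n - m\<close>, to be read as zero for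
  \<open>n < m\<close>.\<close>

lemma Sh_iff_awp:
  assumes a: "a \<noteq> 0" "a' \<noteq> 0" and g: "gen (a * b * c * d)" "gen (a' * b' * c' * d')"
    and X': "a' * b' * c' * d' = a * b * c * d * r powi (4 * m)"
  shows "S \<in> Sh (Lop r a b c d) (Lop r a' b' c' d') (r powi (- (2 * m))) \<longleftrightarrow>
    S \<in> DO \<and> (\<forall>f\<in>Sym. S f \<in> Sym) \<and> (\<forall>n. \<exists>C. S (lz (awp r a b c d n)) =
      cz C * (if m \<le> int n then lz (awp r a' b' c' d' (nat (int n - m))) else 0))"
    (is "_ \<longleftrightarrow> _ \<and> _ \<and> (\<forall>n. \<exists>C. S (?p n) = cz C * ?p' n)")
proof -
  let ?L = "Lop r a b c d" and ?L' = "Lop r a' b' c' d'"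
  let ?l = "\<lambda>n. lam r (a * b * c * d) (int n)" and ?l' = "\<lambda>n. lam r (a' * b' * c' * d') (int n - m)"
  have l: "r powi (- (2 * m)) * ?l' n = ?l n" for n
  proof -
    have "r powi (- (2 * m)) * r powi (- 2 * (int n - m)) = r powi (- 2 * int n)"
      "r powi (- (2 * m)) * (r powi (4 * m) * r powi (2 * (int n - m) - 2)) = r powi (2 * int n - 2)"
      by (simp_all flip: power_int_add)
    moreover have "r powi (- (2 * m)) * ?l' n = r powi (- (2 * m)) * r powi (- 2 * (int n - m)) +
        a * b * c * d * (r powi (- (2 * m)) * (r powi (4 * m) * r powi (2 * (int n - m) - 2)))"
      unfolding lam_def X' distrib_left by (simp only: mult_ac)
    ultimately show ?thesis unfolding lam_def by simp
  qed
  have one: "cz (r powi (2 * m)) * cz (r powi (- (2 * m))) = 1"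
    by (simp flip: cz.mult power_int_add)
  have L: "?L (?p n) = cz (?l n) * ?p n" for n by (rule Lop_awp[OF a(1) g(1)])
  have L': "?L' (?p' n) = cz (?l' n) * ?p' n" for n
  proof (cases "m \<le> int n")
    case True
    hence "int (nat (int n - m)) = int n - m" by simp
    thus ?thesis using Lop_awp[OF a(2) g(2), of "nat (int n - m)"] True by simp
  qed (simp add: klin_0[OF klin_Lop])
  show ?thesis
  proof safe
    fix n assume S: "S \<in> Sh ?L ?L' (r powi (- (2 * m)))"
    have pS: "?p n \<in> Sym" by (rule awp_Sym[OF a(1)])
    have "cz (?l n) * S (?p n) = S (?L (?p n))" unfolding L by (rule klin_scale[OF ShD(2)[OF S], symmetric])
    also have "\<dots> = cz (r powi (- (2 * m))) * ?L' (S (?p n))" by (rule ShD(4)[OF S pS])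
    finally have "cz (r powi (- (2 * m))) * ?L' (S (?p n)) = cz (r powi (- (2 * m)) * ?l' n) * S (?p n)" unfolding l ..
    hence "cz (r powi (2 * m)) * (cz (r powi (- (2 * m))) * ?L' (S (?p n))) =
        cz (r powi (2 * m)) * (cz (r powi (- (2 * m))) * (cz (?l' n) * S (?p n)))" by (simp only: cz.mult mult.assoc)
    hence eig: "?L' (S (?p n)) = cz (?l' n) * S (?p n)"
      unfolding mult.assoc[symmetric] one unfolding mult_1 .
    note eu = Lop_eigen_unique[OF a(2) g(2) ShD(3)[OF S pS] eig]
    show "\<exists>C. S (?p n) = cz C * ?p' n"
    proof (cases "m \<le> int n")
      case True
      thus ?thesis using eu(2) by simp
    next
      case False
      thus ?thesis using eu(1) by simp
    qed
  next
    assume S: "S \<in> DO" "\<forall>f\<in>Sym. S f \<in> Sym" and SC: "\<forall>n. \<exists>C. S (?p n) = cz C * ?p' n"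
    have kS: "klin S" by (rule klin_DO[OF S(1)])
    show "S \<in> Sh ?L ?L' (r powi (- (2 * m)))"
    proof (rule ShI[OF S(1)])
      fix f :: "'f poly fract" assume f: "f \<in> Sym"
      show "S f \<in> Sym" using S(2) f by blast
      show "S (?L f) = cz (r powi (- (2 * m))) * ?L' (S f)"
      proof (rule klin_eq_on_awp[OF a(1) klin_comp[OF kS klin_Lop] klin_cmult[OF klin_comp[OF klin_Lop kS]] _ f])
        fix n
        obtain C where C: "S (?p n) = cz C * ?p' n" using SC by blast
        have "S (?L (?p n)) = cz (r powi (- (2 * m)) * ?l' n) * (cz C * ?p' n)"
          unfolding L klin_scale[OF kS] C l ..
        also have "\<dots> = cz (r powi (- (2 * m))) * ?L' (S (?p n))"
          unfolding C klin_scale[OF klin_Lop] L' by (simp only: cz.mult mult_ac)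
        finally show "S (?L (?p n)) = cz (r powi (- (2 * m))) * ?L' (S (?p n))" .
      qed
    qed
  qed (auto simp: Sh_def)
qed

text \<open>The same operator, hence the same order \<open>s\<close>, serves for all four
  parameters, each of which symmetry of \<open>Lop\<close> allows to be put in front.\<close>

lemma leading_parity_all:
  assumes S: "S \<in> Sh (Lop r a b c d) (Lop r a' b' c' d') \<kappa>" "\<kappa> \<noteq> 0" "S \<noteq> (\<lambda>_. 0)"
    and sq: "\<And>x j. x \<in> {a, b, c, d} \<Longrightarrow> x \<noteq> 0 \<and> x ^ 2 \<noteq> r powi j"
    and a: "\<And>y j. y \<in> {b, c, d, b', c', d'} \<Longrightarrow> y \<noteq> a * r powi j"
    and b: "\<And>y j. y \<in> {a, c, d, a', c', d'} \<Longrightarrow> y \<noteq> b * r powi j"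
    and c: "\<And>y j. y \<in> {a, b, d, a', b', d'} \<Longrightarrow> y \<noteq> c * r powi j"
    and d: "\<And>y j. y \<in> {a, b, c, a', b', c'} \<Longrightarrow> y \<noteq> d * r powi j"
  shows "\<exists>s k1 k2 k3 k4. a' = a * r powi (s - 2 * k1) \<and> b' = b * r powi (s - 2 * k2) \<and>
    c' = c * r powi (s - 2 * k3) \<and> d' = d * r powi (s - 2 * k4)"
proof -
  obtain s x where t: "leading S s x" using DO_leading[OF ShD(1)[OF S(1)] S(3)] by blast
  have p: "Lop r a b c d = Lop r b a c d" "Lop r a b c d = Lop r c a b d" "Lop r a b c d = Lop r d a b c" for a b c d
    by (metis Lop_swap)+
  have "\<exists>k. a' = a * r powi (s - 2 * k)"
    by (rule leading_parity[OF S(1,2) t _ _ a]) (use sq in auto)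
  moreover have "\<exists>k. b' = b * r powi (s - 2 * k)"
    by (rule leading_parity[OF S(1)[unfolded p(1)[of a b c d] p(1)[of a' b' c' d']] S(2) t _ _ b]) (use sq in auto)
  moreover have "\<exists>k. c' = c * r powi (s - 2 * k)"
    by (rule leading_parity[OF S(1)[unfolded p(2)[of a b c d] p(2)[of a' b' c' d']] S(2) t _ _ c]) (use sq in auto)
  moreover have "\<exists>k. d' = d * r powi (s - 2 * k)"
    by (rule leading_parity[OF S(1)[unfolded p(3)[of a b c d] p(3)[of a' b' c' d']] S(2) t _ _ d]) (use sq in auto)
  ultimately show ?thesis by blast
qed

lemma Sh_module:
  assumes "a \<noteq> 0" "gen (a * b * c * d)"
  shows "Module.module (op_ring (Sh (Lop r a b c d) (Lop r a b c d) 1)) (op_module (Sh (Lop r a b c d) (Lop r a' b' c' d') \<kappa>))"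
proof -
  let ?A = "Sh (Lop r a b c d) (Lop r a b c d) 1"
  have neg: "(\<lambda>f. - S f) \<in> Sh (Lop r a b c d) (Lop r x y z w) \<mu>" if "S \<in> Sh (Lop r a b c d) (Lop r x y z w) \<mu>" for S x y z w \<mu>
    using Sh_scale[OF klin_Lop that, of "- 1"] by (simp add: cz.uminus)
  show ?thesis
  proof (rule op_module_module)
    show "id \<in> ?A" unfolding id_def by (rule Sh_id)
    fix X Y assume XY: "X \<in> ?A" "Y \<in> ?A"
    show "X \<circ> Y \<in> ?A" unfolding comp_def using Sh_comp[OF XY(2,1)] by simp
    show "X \<circ> Y = Y \<circ> X" unfolding comp_def using Sh_commute[OF assms XY] by blast
  next
    fix S X assume S: "S \<in> Sh (Lop r a b c d) (Lop r a' b' c' d') \<kappa>" and X: "X \<in> ?A"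
    show "S \<circ> X \<in> Sh (Lop r a b c d) (Lop r a' b' c' d') \<kappa>"
      unfolding comp_def using Sh_comp[OF X S] by simp
  qed (blast intro: Sh_zero[OF klin_Lop] Sh_add[OF klin_Lop] neg klin_add[OF ShD(2)])+
qed

lemma op_module_0:
  assumes "a \<noteq> 0" "gen (a * b * c * d)"
  shows "free_module_of_rank (op_ring (Sh (Lop r a b c d) (Lop r a b c d) 1)) (op_module {\<lambda>_. 0}) 0"
proof (rule op_module_free_0)
  let ?A = "Sh (Lop r a b c d) (Lop r a b c d) 1"
  interpret Module.module "op_ring ?A" "op_module ?A" by (rule Sh_module[OF assms])
  have k0: "X 0 = 0" if "X \<in> ?A" for X using klin_0[OF ShD(2)[OF that]] .
  show "Module.module (op_ring ?A) (op_module {\<lambda>_. 0})"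
  proof (rule moduleI)
    show "cring (op_ring ?A)" by (rule R.is_cring)
    show "abelian_group (op_module {\<lambda>_. 0})" by (rule abelian_groupI) (simp_all add: op_module_def)
  qed (simp_all add: op_ring_def op_module_def fun_eq_iff)
qed

lemma Sh_free_1:
  assumes a: "a \<noteq> 0" and g: "gen (a * b * c * d)" and a2: "\<And>j. a ^ 2 \<noteq> r powi j"
    and y: "\<And>y j. y \<in> {b, c, d, b', c', d'} \<Longrightarrow> y \<noteq> a * r powi j" and \<kappa>: "\<kappa> \<noteq> 0"
    and T: "\<exists>T\<in>Sh (Lop r a b c d) (Lop r a' b' c' d') \<kappa>. T \<noteq> (\<lambda>_. 0)"
  shows "free_module_of_rank (op_ring (Sh (Lop r a b c d) (Lop r a b c d) 1))
    (op_module (Sh (Lop r a b c d) (Lop r a' b' c' d') \<kappa>)) 1"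
proof -
  obtain T where T: "T \<in> Sh (Lop r a b c d) (Lop r a' b' c' d') \<kappa>" "T \<noteq> (\<lambda>_. 0)" using T by blast
  have "\<exists>S0\<in>Sh (Lop r a b c d) (Lop r a' b' c' d') \<kappa>. S0 \<noteq> (\<lambda>_. 0) \<and>
      (\<forall>S\<in>Sh (Lop r a b c d) (Lop r a' b' c' d') \<kappa>. \<exists>X\<in>Sh (Lop r a b c d) (Lop r a b c d) 1. S = (\<lambda>f. S0 (X f)))"
    by (rule Sh_cyclic[OF a a2 y \<kappa> T])
  then obtain S0 where S0: "S0 \<in> Sh (Lop r a b c d) (Lop r a' b' c' d') \<kappa>" "S0 \<noteq> (\<lambda>_. 0)"
    "\<And>S. S \<in> Sh (Lop r a b c d) (Lop r a' b' c' d') \<kappa> \<Longrightarrow> \<exists>X\<in>Sh (Lop r a b c d) (Lop r a b c d) 1. S = S0 \<circ> X"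
    unfolding comp_def by (elim bexE conjE) blast
  show ?thesis
  proof (rule op_module_free_1[OF Sh_module[OF a g] S0(1,3)])
    fix X Y assume X: "X \<in> Sh (Lop r a b c d) (Lop r a b c d) 1" and Y: "Y \<in> Sh (Lop r a b c d) (Lop r a b c d) 1"
      and eq: "S0 \<circ> X = S0 \<circ> Y"
    show "X = Y"
      by (rule Sh_comp_cancel[OF ShD(1)[OF S0(1)] S0(2) ShD(1)[OF X] ShD(1)[OF Y] eq[unfolded comp_def]])
  qed
qed

lemma DO_eq_0:
  assumes "a \<noteq> 0" "S \<in> DO" "\<And>n. S (lz (awp r a b c d n)) = 0"
  shows "S = (\<lambda>_. 0)"
proof (rule DO_ext[OF assms(2) DO_zero])
  fix f :: "'f poly fract" assume "f \<in> Sym"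
  thus "S f = 0"
    by (rule klin_eq_on_awp[OF assms(1) klin_DO[OF assms(2)] klin_DO[OF DO_zero] assms(3)])
qed

end

section \<open>Genericity of the parameters\<close>

lemma par_gmon:
  "par_a * q_root powi i = of_rat (- 1) * gmon (2, - 1, 0, 0, i)"
  "par_b * q_root powi i = of_rat 1 * gmon (0, 1, 0, 0, i)"
  "par_c * q_root powi i = of_rat (- 1) * gmon (0, 0, 2, - 1, i)"
  "par_d * q_root powi i = of_rat 1 * gmon (0, 0, 0, 1, i)"
  by (simp_all add: par_a_def par_c_def power_int_minus divide_inverse of_rat_minus)

lemma gmon_neq:
  assumes "s * s = 1" "t * t = 1" "e \<noteq> e'"
  shows "of_rat s * gmon e \<noteq> of_rat t * gmon e'"
proof
  assume eq: "of_rat s * gmon e = of_rat t * gmon e'"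
  have "gmon e = of_rat (s * s) * gmon e" using assms by simp
  also have "\<dots> = of_rat (s * t) * gmon e'" by (simp only: of_rat_mult mult.assoc eq)
  finally have "e = e'" by (rule gmon_eq_iff[rotated]) (use assms in \<open>simp add: mult_ac\<close>)
  thus False using assms by blast
qed

lemma par_neq:
  "par_a * q_root powi i \<noteq> par_b * q_root powi j" "par_a * q_root powi i \<noteq> par_c * q_root powi j"
  "par_a * q_root powi i \<noteq> par_d * q_root powi j" "par_b * q_root powi i \<noteq> par_c * q_root powi j"
  "par_b * q_root powi i \<noteq> par_d * q_root powi j" "par_c * q_root powi i \<noteq> par_d * q_root powi j"
  unfolding par_gmon by (rule gmon_neq; simp)+

lemma par_square_neq:
  assumes "x \<in> {par_a, par_b, par_c, par_d}"
  shows "x ^ 2 \<noteq> q_root powi j"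
proof -
  have q: "q_root powi j = of_rat 1 * gmon (0, 0, 0, 0, j)" by simp
  have sq: "x ^ 2 = (x * q_root powi 0) * (x * q_root powi 0)" for x by (simp add: power2_eq_square)
  have "par_a ^ 2 = of_rat 1 * gmon (4, - 2, 0, 0, 0)" "par_b ^ 2 = of_rat 1 * gmon (0, 2, 0, 0, 0)"
    "par_c ^ 2 = of_rat 1 * gmon (0, 0, 4, - 2, 0)" "par_d ^ 2 = of_rat 1 * gmon (0, 0, 0, 2, 0)"
    by (simp_all add: par_a_def par_c_def power_int_minus divide_inverse power_mult_distrib power_inverse)
  thus ?thesis using assms unfolding q by (elim insertE emptyE) (simp only:, rule gmon_neq; simp)+
qed

text \<open>A shifted parameter is an original one times a power of \<open>u\<close>, so it suffices
  to distinguish the original parameters modulo powers of \<open>u\<close>.\<close>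

lemma orbit_neq:
  assumes "\<And>z i j. z \<in> {u, v, w} \<Longrightarrow> x * q_root powi i \<noteq> z * q_root powi j"
    and "y \<in> {u, v, w, u * q_root powi i, v * q_root powi j, w * q_root powi k}"
  shows "y \<noteq> x * (q_root ^ N) powi n"
proof -
  have "\<exists>z\<in>{u, v, w}. \<exists>i. y = z * q_root powi i"
  proof -
    have "z = z * q_root powi 0" for z by simp
    thus ?thesis using assms(2) by blast
  qed
  thus ?thesis using assms(1) by (metis power_int_mult power_int_of_nat)
qed

lemma par_orbit_neq:
  "y \<in> {par_b, par_c, par_d, par_b * q_root powi j, par_c * q_root powi k, par_d * q_root powi l} \<Longrightarrow> y \<noteq> par_a * (q_root ^ N) powi n"
  "y \<in> {par_a, par_c, par_d, par_a * q_root powi i, par_c * q_root powi k, par_d * q_root powi l} \<Longrightarrow> y \<noteq> par_b * (q_root ^ N) powi n"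
  "y \<in> {par_a, par_b, par_d, par_a * q_root powi i, par_b * q_root powi j, par_d * q_root powi l} \<Longrightarrow> y \<noteq> par_c * (q_root ^ N) powi n"
  "y \<in> {par_a, par_b, par_c, par_a * q_root powi i, par_b * q_root powi j, par_c * q_root powi k} \<Longrightarrow> y \<noteq> par_d * (q_root ^ N) powi n"
  by (erule orbit_neq[rotated]; auto simp only: insert_iff empty_iff simp_thms dest: par_neq[THEN notE] par_neq[THEN not_sym, THEN notE])+

lemma q_root_powi_inj: "q_root powi i = q_root powi j \<Longrightarrow> i = j"
proof -
  interpret q_shift "q_root ^ 1" by (rule q_shift_q_root) simp
  show "q_root powi i = q_root powi j \<Longrightarrow> i = j" using r_powi_eq_iff by simp
qed

section \<open>Translation of the statement into intertwiners\<close>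

lemma vector_4: "(vector [x1, x2, x3, x4] :: 'a::zero ^ 4) $ 1 = x1" "(vector [x1, x2, x3, x4] :: 'a::zero ^ 4) $ 2 = x2"
  "(vector [x1, x2, x3, x4] :: 'a::zero ^ 4) $ 3 = x3" "(vector [x1, x2, x3, x4] :: 'a::zero ^ 4) $ 4 = x4"
  by (simp_all add: vector_def)

lemma scalar_shift_dir:
  "scalar_product h (shift_dir $ 1) = (h $ 1 + h $ 2 + h $ 3 + h $ 4) / 2"
  "scalar_product h (shift_dir $ 2) = (h $ 1 + h $ 2 - h $ 3 - h $ 4) / 2"
  "scalar_product h (shift_dir $ 3) = (h $ 1 - h $ 2 + h $ 3 - h $ 4) / 2"
  "scalar_product h (shift_dir $ 4) = (h $ 1 - h $ 2 - h $ 3 + h $ 4) / 2"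
  by (simp_all add: scalar_product_def sum_4 shift_dir_def vector_4 field_simps)

lemma const_z_cz: "const_z = cz"
  by (rule ext) (simp only: const_z_def cz_def)

lemma laurent_z_lz: "laurent_z = lz"
  by (rule ext) (simp only: laurent_z_def lz_def const_z_cz zz_def)

lemma sym_laurent_z_Sym: "sym_laurent_z = Sym"
  by (simp only: sym_laurent_z_def laurent_z_lz sym_laurent_symL[OF zero_less_one] Sym_eq)

lemma q_pow_int:
  assumes "2 * of_nat N * x = (of_int e :: rat)"
  shows "q_pow N x = q_root powi e"
  unfolding q_pow_def assms by simp

lemma rN_powi: "(q_root ^ N) powi j = q_root powi (int N * j)"
  by (simp add: power_int_mult)

context
  fixes N :: nat
  assumes N: "N > 0"
begin

interpretation q_shift "rN N" by (rule q_shift_q_root) (rule N)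

lemma T_pow_Tn: "T_pow N n = Tn n"
proof -
  have "2 * of_nat N * (of_int n / 2) = (of_int (int N * n) :: rat)" by simp
  from q_pow_int[OF this] show ?thesis unfolding T_pow_def Tn_def zscale_def rN_powi by (simp only:)
qed

lemma symmetric_difference_operators_DO:
  "symmetric_difference_operators N = {S \<in> DO. \<forall>f\<in>Sym. S f \<in> Sym}"
proof -
  have "difference_operators N = DO"
    unfolding difference_operators_def DO_def dop_def fsupp_def T_pow_Tn ..
  thus ?thesis unfolding symmetric_difference_operators_def sym_laurent_z_Sym image_subset_iff by (simp only:)
qed

context
  fixes h :: "rat ^ 4"
  assumes h: "\<And>i. 2 * of_nat N * h $ i \<in> \<int>"
begin

text \<open>The exponent of \<open>u\<close> in \<open>q^(h_i)\<close>; the assumption on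
  \<open>h\<close> makes the floor exact.\<close>

definition hexp :: "4 \<Rightarrow> int" where "hexp i = \<lfloor>2 * of_nat N * h $ i\<rfloor>"

lemma hexp: "2 * of_nat N * h $ i = of_int (hexp i)"
  using h[of i] by (auto simp: hexp_def elim!: Ints_cases)

lemma q_pow_hexp: "q_pow N (h $ i) = q_root powi hexp i"
  by (rule q_pow_int[OF hexp])

abbreviation "L' \<equiv> Lop (rN N) (par_a * q_root powi hexp 1) (par_b * q_root powi hexp 2)
    (par_c * q_root powi hexp 3) (par_d * q_root powi hexp 4)"

abbreviation "\<sigma> \<equiv> (h $ 1 + h $ 2 + h $ 3 + h $ 4) / 2"

lemma shift_operators_awp:
  "shift_operators N h = {S \<in> DO. (\<forall>f\<in>Sym. S f \<in> Sym) \<and>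
    (\<forall>n. \<exists>C. S (lz (PN N n)) = cz C * lz (askey_wilson_shifted N h (of_nat n - \<sigma>)))}"
  unfolding shift_operators_def symmetric_difference_operators_DO const_z_cz laurent_z_lz askey_wilson_eq[OF N]
  by blast

lemma shift_operators_Sh:
  assumes \<sigma>: "\<sigma> = of_int m"
  shows "shift_operators N h = Sh (LN N) L' (rN N powi (- (2 * m)))"
proof -
  \<comment> \<open>The product of the parameters is multiplied by \<open>u^(4 m N)\<close>, that is
    by \<open>r^(4 m)\<close>.\<close>
  have "of_int (hexp 1 + hexp 2 + hexp 3 + hexp 4) = 2 * of_nat N * (h $ 1 + h $ 2 + h $ 3 + h $ 4)"
    by (simp only: of_int_add hexp[symmetric] distrib_left)
  also have "\<dots> = of_int (int N * (4 * m))" using \<sigma> by simp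
  finally have sum: "hexp 1 + hexp 2 + hexp 3 + hexp 4 = int N * (4 * m)" by (simp only: of_int_eq_iff)
  have X': "par_a * q_root powi hexp 1 * (par_b * q_root powi hexp 2) * (par_c * q_root powi hexp 3) *
      (par_d * q_root powi hexp 4) = par_a * par_b * par_c * par_d * (rN N) powi (4 * m)"
  proof -
    have "par_a * par_b * par_c * par_d = gmon (2, 0, 2, 0, 0)"
      using par_prod[of 0 0 0 0] by (simp only: power_int_0_right mult_1_right add_0)
    thus ?thesis unfolding par_prod sum rN_powi by simp
  qed
  have sh: "lz (askey_wilson_shifted N h (of_nat n - \<sigma>)) = (if m \<le> int n then
     lz (awp (rN N) (par_a * q_root powi hexp 1) (par_b * q_root powi hexp 2)
    (par_c * q_root powi hexp 3) (par_d * q_root powi hexp 4) (nat (int n - m))) else 0)" for n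
  proof (cases "m \<le> int n")
    case True
    hence "of_nat n - \<sigma> = of_nat (nat (int n - m))" unfolding \<sigma> by (simp add: of_nat_nat)
    thus ?thesis using True by (simp only: askey_wilson_shifted_eq[OF N] q_pow_hexp if_True)
  next
    case False
    \<comment> \<open>A negative degree is not a natural number, so the convention in
      \<open>askey_wilson_shifted\<close> yields the zero required by
      \<open>Sh_iff_awp\<close>.\<close>
    have "of_nat n - \<sigma> \<noteq> (of_nat k :: rat)" for k
    proof
      assume "of_nat n - \<sigma> = (of_nat k :: rat)"
      hence "of_int (int n - m) = (of_int (int k) :: rat)" unfolding \<sigma> by simp
      hence "int n - m = int k" by (simp only: of_int_eq_iff)
      thus False using False by simp
    qed
    hence "of_nat n - \<sigma> \<notin> \<nat>" by (auto elim!: Nats_cases)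
    thus ?thesis using False by (simp only: askey_wilson_shifted_def if_False lz.zero)
  qed
  have nz: "par_a \<noteq> 0" "par_a * q_root powi hexp 1 \<noteq> 0" by simp_all
  show ?thesis
    unfolding shift_operators_awp sh PN_def set_eq_iff mem_Collect_eq
    by (intro allI Sh_iff_awp[OF nz gen_par0[OF N] gen_par[OF N] X', symmetric])
qed

text \<open>No degree \<open>n - \<sigma>\<close> is then a natural number, so the operator kills
  every Askey--Wilson polynomial, and these span \<open>Sym\<close>.\<close>

lemma shift_operators_trivial:
  assumes \<sigma>: "\<sigma> \<notin> \<int>"
  shows "shift_operators N h = {\<lambda>_. 0}"
proof -
  have "of_nat n - \<sigma> \<notin> \<nat>" for n
  proof
    assume "of_nat n - \<sigma> \<in> \<nat>"
    hence "of_nat n - \<sigma> \<in> \<int>" using Nats_subset_Ints by blast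
    from Ints_diff[OF Ints_of_nat this, of n] have "of_nat n - (of_nat n - \<sigma>) \<in> \<int>" .
    thus False using \<sigma> by simp
  qed
  hence z: "cz C * lz (askey_wilson_shifted N h (of_nat n - \<sigma>)) = 0" for n C
    by (simp only: askey_wilson_shifted_def if_False lz.zero mult_zero_right)
  show ?thesis
  proof (intro equalityI subsetI)
    fix S assume "S \<in> shift_operators N h"
    hence S: "S \<in> DO" "\<And>n. S (lz (PN N n)) = 0" unfolding shift_operators_awp z by blast+
    have "S = (\<lambda>_. 0)" by (rule DO_eq_0[OF par_nonzero(1) S(1) S(2)[unfolded PN_def]])
    thus "S \<in> {\<lambda>_. 0}" by simp
  next
    fix S :: "ratfun_z \<Rightarrow> ratfun_z" assume "S \<in> {\<lambda>_. 0}"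
    thus "S \<in> shift_operators N h" unfolding shift_operators_awp z using DO_zero by auto
  qed
qed

text \<open>For integral \<open>\<sigma>\<close> a nonzero operator of order \<open>s\<close> would
  make each \<open>h_i\<close> congruent to \<open>s / 2\<close>, hence every sum of two of them an
  integer.\<close>

lemma shift_operators_nonlattice:
  assumes "\<not> (\<forall>i. scalar_product h (shift_dir $ i) \<in> \<int>)"
  shows "shift_operators N h = {\<lambda>_. 0}"
proof (cases "\<sigma> \<in> \<int>")
  case True
  then obtain m where m: "\<sigma> = of_int m" by (rule Ints_cases)
  have "S = (\<lambda>_. 0)" if S: "S \<in> Sh (LN N) L' (rN N powi (- (2 * m)))" for S
  proof (rule ccontr)
    assume S0: "S \<noteq> (\<lambda>_. 0)"
    have sq: "x \<noteq> 0 \<and> x ^ 2 \<noteq> rN N powi j" if "x \<in> {par_a, par_b, par_c, par_d}" for x j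
      using that par_square_neq[OF that] unfolding rN_powi by auto
    have "rN N powi (- (2 * m)) \<noteq> 0" by simp
    have "\<exists>s k1 k2 k3 k4. par_a * q_root powi hexp 1 = par_a * rN N powi (s - 2 * k1) \<and>
      par_b * q_root powi hexp 2 = par_b * rN N powi (s - 2 * k2) \<and>
      par_c * q_root powi hexp 3 = par_c * rN N powi (s - 2 * k3) \<and>
      par_d * q_root powi hexp 4 = par_d * rN N powi (s - 2 * k4)"
      by (rule leading_parity_all[OF S \<open>_ \<noteq> 0\<close> S0]; (rule sq, assumption | erule par_orbit_neq))
    then obtain s k1 k2 k3 k4 where k: "par_a * q_root powi hexp 1 = par_a * rN N powi (s - 2 * k1)"
      "par_b * q_root powi hexp 2 = par_b * rN N powi (s - 2 * k2)"
      "par_c * q_root powi hexp 3 = par_c * rN N powi (s - 2 * k3)"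
      "par_d * q_root powi hexp 4 = par_d * rN N powi (s - 2 * k4)" by blast
    have hk: "h $ i = of_int s / 2 - of_int k" if "x * q_root powi hexp i = x * rN N powi (s - 2 * k)" "x \<noteq> 0" for x i k
    proof -
      have "q_root powi hexp i = q_root powi (int N * (s - 2 * k))"
        using that unfolding rN_powi mult_cancel_left by blast
      hence "hexp i = int N * (s - 2 * k)" by (rule q_root_powi_inj)
      hence "2 * of_nat N * h $ i = of_nat N * (of_int s - 2 * of_int k)" unfolding hexp by simp
      hence "of_nat N * (2 * h $ i) = of_nat N * (of_int s - 2 * of_int k)" by (simp only: mult_ac)
      hence "2 * h $ i = of_int s - 2 * of_int k" using N by (simp only: mult_cancel_left of_nat_eq_0_iff) simp
      thus ?thesis by simp
    qed
    note hs = hk[OF k(1) par_nonzero(1)] hk[OF k(2) gens_nonzero(2)] hk[OF k(3) par_nonzero(2)] hk[OF k(4) gens_nonzero(4)]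
    \<comment> \<open>The other three inner products differ from \<open>\<sigma>\<close> by a sum of
      two components of \<open>h\<close>.\<close>
    have "(h $ 1 + h $ 2 - h $ 3 - h $ 4) / 2 = \<sigma> - (h $ 3 + h $ 4)"
      "(h $ 1 - h $ 2 + h $ 3 - h $ 4) / 2 = \<sigma> - (h $ 2 + h $ 4)"
      "(h $ 1 - h $ 2 - h $ 3 + h $ 4) / 2 = \<sigma> - (h $ 2 + h $ 3)" by (simp_all add: field_simps)
    moreover have "h $ 3 + h $ 4 = of_int (s - k3 - k4)" "h $ 2 + h $ 4 = of_int (s - k2 - k4)"
      "h $ 2 + h $ 3 = of_int (s - k2 - k3)" unfolding hs by (simp_all add: field_simps)
    ultimately have "\<forall>i. scalar_product h (shift_dir $ i) \<in> \<int>"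
      unfolding forall_4 scalar_shift_dir using True by (metis Ints_diff Ints_of_int)
    thus False using assms by blast
  qed
  moreover have "(\<lambda>_. 0) \<in> Sh (LN N) L' (rN N powi (- (2 * m)))" by (rule Sh_zero[OF klin_Lop])
  ultimately show ?thesis unfolding shift_operators_Sh[OF m] by blast
qed (rule shift_operators_trivial)

lemma shift_operators_lattice:
  assumes "\<forall>i. scalar_product h (shift_dir $ i) \<in> \<int>"
  obtains m where "shift_operators N h = Sh (LN N) L' (rN N powi (- (2 * m)))"
    "\<exists>T\<in>Sh (LN N) L' (rN N powi (- (2 * m))). T \<noteq> (\<lambda>_. 0)"
proof -
  obtain n1 n2 n3 n4 where n: "\<sigma> = of_int n1" "(h $ 1 + h $ 2 - h $ 3 - h $ 4) / 2 = of_int n2"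
    "(h $ 1 - h $ 2 + h $ 3 - h $ 4) / 2 = of_int n3" "(h $ 1 - h $ 2 - h $ 3 + h $ 4) / 2 = of_int n4"
    using assms unfolding forall_4 scalar_shift_dir by (metis Ints_cases)
  have hx: "q_root powi hexp i = rN N powi k" if "2 * h $ i = of_int k" for i k
  proof -
    have "of_int (hexp i) = of_nat N * (2 * h $ i)" unfolding hexp[symmetric] by simp
    also have "\<dots> = of_int (int N * k)" unfolding that by simp
    finally show ?thesis unfolding rN_powi of_int_eq_iff by (simp only:)
  qed
  \<comment> \<open>Expansion of \<open>h\<close> in the orthonormal vectors \<open>v_i\<close>,
    doubled because \<open>r\<close> is the square root of \<open>q\<close>.\<close>
  have e: "q_root powi hexp 1 = rN N powi (n1 + n2 + n3 + n4)" "q_root powi hexp 2 = rN N powi (n1 + n2 - n3 - n4)"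
    "q_root powi hexp 3 = rN N powi (n1 - n2 + n3 - n4)" "q_root powi hexp 4 = rN N powi (n1 - n2 - n3 + n4)"
    by (rule hx; simp add: n[symmetric] field_simps)+
  show ?thesis
  proof (rule that)
    show "shift_operators N h = Sh (LN N) L' (rN N powi (- (2 * n1)))" by (rule shift_operators_Sh[OF n(1)])
    show "\<exists>T\<in>Sh (LN N) L' (rN N powi (- (2 * n1))). T \<noteq> (\<lambda>_. 0)"
      unfolding e by (rule Sh_lattice) simp_all
  qed
qed

end

text \<open>For the zero shift \<open>m\<close> is zero, so the scalar is \<open>1\<close> and the
  shifted operator is \<open>LN N\<close> itself.\<close>

lemma shift_ring_eq: "shift_ring N = op_ring (Sh (LN N) (LN N) 1)"
proof -
  have h: "2 * of_nat N * (0 :: rat ^ 4) $ i \<in> \<int>" for i by simp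
  have "hexp 0 i = 0" for i by (simp add: hexp_def[OF h])
  hence "shift_operators N 0 = Sh (LN N) (LN N) 1"
    using shift_operators_Sh[OF h, of 0] by simp
  thus ?thesis by (simp only: shift_ring_def op_ring_def)
qed

lemma shift_module_free:
  fixes h :: "rat ^ 4"
  assumes h: "\<And>i. 2 * of_nat N * h $ i \<in> \<int>"
  shows "free_module_of_rank (shift_ring N) (shift_module N h)
           (if \<forall>i. scalar_product h (shift_dir $ i) \<in> \<int> then 1 else 0)"
proof -
  have M: "shift_module N h = op_module (shift_operators N h)"
    by (simp only: shift_module_def op_module_def)
  show ?thesis
  proof (cases "\<forall>i. scalar_product h (shift_dir $ i) \<in> \<int>")
    case True
    have a2: "par_a ^ 2 \<noteq> rN N powi j" for j using par_square_neq[of par_a] unfolding rN_powi by simp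
    obtain m where m: "shift_operators N h = Sh (LN N) (L' h) (rN N powi (- (2 * m)))"
      "\<exists>T\<in>Sh (LN N) (L' h) (rN N powi (- (2 * m))). T \<noteq> (\<lambda>_. 0)"
      by (rule shift_operators_lattice[OF h True])
    have "rN N powi (- (2 * m)) \<noteq> 0" by simp
    from Sh_free_1[OF par_nonzero(1) gen_par0[OF N] a2 par_orbit_neq(1) this m(2)]
    show ?thesis unfolding M shift_ring_eq m(1) if_P[OF True] .
  next
    case False
    show ?thesis unfolding M shift_ring_eq shift_operators_nonlattice[OF h False] if_not_P[OF False]
      by (rule op_module_0[OF par_nonzero(1) gen_par0[OF N]])
  qed
qed

end

theorem theorem3p31:
  fixes h :: "rat ^ 4" and N :: nat
  assumes "N > 0"
    and "\<And>i. 2 * of_nat N * h $ i \<in> \<int>"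
  shows "free_module_of_rank (shift_ring N) (shift_module N h)
           (if \<forall>i. scalar_product h (shift_dir $ i) \<in> \<int> then 1 else 0)"
  by (rule shift_module_free[OF assms])

end
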